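(* Consider the semi-implicit time Euler scheme $\{u^n,\theta^n\}_{n=0,\dots,N}$ with mesh $h=T/N$ for the stochastic Boussinesq system with additive noise, as defined in the context, with $C_L=0$. (i) Let $\theta_0\in H^0$ and $u_0\in V^0$ be deterministic, and set $$\alpha_1:=\frac{\nu\kappa\lambda_1\tilde\lambda_1}{4\big[2T\,\mathrm{Tr}(\tilde Q)+\kappa\tilde\lambda_1\mathrm{Tr}(Q)\big]}.$$ Then for any $\alpha\in(0,\alpha_1)$ there exists a constant $C(\alpha)<\infty$ such that for $N$ large enough, $$\mathbb E\Big[\exp\Big(\alpha\max_{0\le n\le N}\Big\{\|u^n\|_{V^0}^2+\frac TN\,\nu\sum_{l=1}^n\|A^{1/2}u^l\|_{V^0}^2\Big\}\Big)\Big]\le C(\alpha).\qquad( * )$$ (ii) Let $\theta_0$ and $u_0$ be random, $\mathcal F_0$-measurable, and such that for some constants $\gamma_0,\tilde\gamma_0>0$, $\mathbb E[\exp(\gamma_0\|u_0\|_{V^0}^2)]<\infty$ and $\mathbb E[\exp(\tilde\gamma_0\|\theta_0\|_{H^0}^2)]<\infty$. Set $$\tilde\alpha_1:=\frac{\nu\kappa\lambda_1\tilde\lambda_1}{4\big[2T\,\mathrm{Tr}(\tilde Q)+\kappa\tilde\lambda_1\mathrm{Tr}(Q)\big]+\frac{2\kappa\tilde\lambda_1T}{\tilde\gamma_0}+\frac{\nu\kappa\lambda_1\tilde\lambda_1}{\gamma_0}}.$$ Then for every $\alpha\in(0,\tilde\alpha_1)$, $( * )$ holds for $N$ large enough, for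 some constant $C(\alpha)<\infty$.
   Context: Domain and spaces. $L>0$, $T>0$, $D=[0,L]^2$; $v_1,v_2$ is the canonical basis of $\mathbb R^2$. Velocity fields are periodic of period $L$ in both variables. $V^0$ is the closed subspace of $L^2(D)^2$ of divergence-free periodic fields (normalized to have zero spatial mean, so that the Poincar\'e inequality below holds), with the $L^2$ norm; $V^k=\{\phi\in W^{k,2}(D)^2:\ \mathrm{div}\,\phi=0\}$ (same conventions), with the $W^{k,2}$ norm. $\Pi:L^2(D)^2\to V^0$ is the orthogonal (Leray) projection, $A=-\Pi\Delta$ is the Stokes operator with domain $V^2$ and eigenvalues $\lambda_1\le\lambda_2\le\dots$, $\lambda_1>0$: $\|u\|_{V^0}^2\le\lambda_1^{-1}\|A^{1/2}u\|_{V^0}^2$ for $u\in V^1$. Temperatures $\theta$ vanish on $\{x_2=0\}\cup\{x_2=L\}$ and are periodic of period $L$ in $x_1$; $\tilde A=-\Delta$ on $L^2(D)$ with these boundary conditions, with eigenvalues $\tilde\lambda_1\le\tilde\lambda_2\le\dots$, $\tilde\lambda_1>0$: $\|\theta\|_{H^0}^2\le\tilde\lambda_1^{-1}\|\tilde A^{1/2}\theta\|_{H^0}^2$ for $\theta\in H^1$; $H^k=\mathrm{Dom}(\tilde A^{k/2})$, $H^0=L^2(D)$. $B(u,v)=\Pi[(u\cdot\nabla)v]$; $(u\cdot\nabla)\theta=\sum_{i=1,2}u_i\partial_i\theta$. Additive noise. On a filtered probability space $(\Omega,\mathcal F,(\mathcal F_t)_{t\ge0},\mathbb P)$, $W(t)=\sum_{j\ge1}\sqrt{q_j}\,\beta_j(t)\zeta_j$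 and $\tilde W(t)=\sum_{j\ge1}\sqrt{\tilde q_j}\,\tilde\beta_j(t)\tilde\zeta_j$, where $\{\beta_j\},\{\tilde\beta_j\}$ are mutually independent one-dimensional $(\mathcal F_t)$-Brownian motions, $\{\zeta_j\}$ (resp. $\{\tilde\zeta_j\}$) is a complete orthonormal system of $V^0$ (resp. $H^0$) with $A\zeta_j=\lambda_j\zeta_j$ (resp. $\tilde A\tilde\zeta_j=\tilde\lambda_j\tilde\zeta_j$), $q_j,\tilde q_j>0$, $Q\zeta_j=q_j\zeta_j$, $\tilde Q\tilde\zeta_j=\tilde q_j\tilde\zeta_j$, $\mathrm{Tr}(Q)=\sum_jq_j$, $\mathrm{Tr}(\tilde Q)=\sum_j\tilde q_j$. Standing assumption: $\sum_j\lambda_jq_j<\infty$ and $\sum_j\tilde\lambda_j\tilde q_j<\infty$. Scheme (with $C_L=0$). $\nu,\kappa>0$ are constants. For $N\ge1$, $h=T/N$, $t_j=jh$, $\Delta_lW=W(t_l)-W(t_{l-1})$, $\Delta_l\tilde W=\tilde W(t_l)-\tilde W(t_{l-1})$. Set $u^0=u_0$, $\theta^0=\theta_0$, and for $l=1,\dots,N$ let $u^l\in V^1$, $\theta^l\in H^1$ ($\mathcal F_{t_l}$-measurable) solve, for all $\varphi\in V^1$, $\psi\in H^1$, $$(u^l-u^{l-1}+h\nu Au^l+hB(u^{l-1},u^l),\varphi)=h(\Pi(\theta^{l-1}v_2),\varphi)+(\Delta_lW,\varphi),$$ $$(\theta^l-\theta^{l-1}+h\kappa\tilde A\theta^l+h(u^{l-1}\cdot\nabla)\theta^l,\psi)=(\Delta_l\tilde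 W,\psi),$$ with $Au^l$, $\tilde A\theta^l$ understood in the weak sense. *)

theory Defs
  imports "HOL-Probability.Probability"
begin

section \<open>Square-integrable functions\<close>

text \<open>
  Elements of the \<open>L\<^sup>2\<close> spaces are represented by functions; functions that agree almost everywhere
  represent the same element, and no notion below distinguishes them.
\<close>

definition L2 :: "'a measure \<Rightarrow> ('a \<Rightarrow> 'b::euclidean_space) set" where
  "L2 M = {f \<in> borel_measurable M. integrable M (\<lambda>x. (norm (f x))\<^sup>2)}"

definition L2_inner :: "'a measure \<Rightarrow> ('a \<Rightarrow> 'b::euclidean_space) \<Rightarrow> ('a \<Rightarrow> 'b) \<Rightarrow> real" where
  "L2_inner M f g = (\<integral>x. f x \<bullet> g x \<partial>M)"

definition L2_norm :: "'a measure \<Rightarrow> ('a \<Rightarrow> 'b::euclidean_space) \<Rightarrow> real" where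
  "L2_norm M f = sqrt (L2_inner M f f)"

text \<open>The Borel \<open>\<sigma>\<close>-algebra of a subspace \<open>X\<close>, generated by its norm-open subsets.\<close>

definition L2_borel :: "'a measure \<Rightarrow> ('a \<Rightarrow> 'b::euclidean_space) set \<Rightarrow> ('a \<Rightarrow> 'b) measure" where
  "L2_borel M X = sigma X
     {U. U \<subseteq> X \<and> (\<forall>f\<in>U. \<exists>\<epsilon>>0. \<forall>g\<in>X. L2_norm M (\<lambda>x. f x - g x) < \<epsilon> \<longrightarrow> g \<in> U)}"

definition complete_orthonormal ::
  "'a measure \<Rightarrow> ('a \<Rightarrow> 'b::euclidean_space) set \<Rightarrow> (nat \<Rightarrow> 'a \<Rightarrow> 'b) \<Rightarrow> bool" where
  "complete_orthonormal M X e \<longleftrightarrow>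
     (\<forall>j. e j \<in> X) \<and>
     (\<forall>i j. L2_inner M (e i) (e j) = (if i = j then 1 else 0)) \<and>
     (\<forall>f\<in>X. (\<lambda>n. L2_norm M (\<lambda>x. f x - (\<Sum>j<n. L2_inner M f (e j) *\<^sub>R e j x))) \<longlonglongrightarrow> 0)"

text \<open>
  Let \<open>S\<close> be a positive self-adjoint operator on \<open>X\<close> with the complete orthonormal system \<open>e\<close> of
  eigenvectors and the eigenvalues \<open>lam\<close>. Then \<open>S\<^sup>s f = (\<Sum>j. (lam j powr s * \<langle>f, e j\<rangle>) e j)\<close>;
  \<open>power_dom\<close> is the domain of \<open>S\<^sup>s\<close> and \<open>power_norm\<close> is the norm of \<open>S\<^sup>s f\<close>.
\<close>

definition power_dom ::
  "'a measure \<Rightarrow> ('a \<Rightarrow> 'b::euclidean_space) set \<Rightarrow> (nat \<Rightarrow> real) \<Rightarrow> (nat \<Rightarrow> 'a \<Rightarrow> 'b) \<Rightarrow> real \<Rightarrow> ('a \<Rightarrow> 'b) set" where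
  "power_dom M X lam e s =
     {f \<in> X. summable (\<lambda>j. (lam j powr s * L2_inner M f (e j))\<^sup>2)}"

definition power_norm ::
  "'a measure \<Rightarrow> (nat \<Rightarrow> real) \<Rightarrow> (nat \<Rightarrow> 'a \<Rightarrow> 'b::euclidean_space) \<Rightarrow> real \<Rightarrow> ('a \<Rightarrow> 'b) \<Rightarrow> real" where
  "power_norm M lam e s f = sqrt (\<Sum>j. (lam j powr s * L2_inner M f (e j))\<^sup>2)"


section \<open>Function spaces on the square\<close>

type_synonym scalar_field = "real^2 \<Rightarrow> real"
type_synonym vector_field = "real^2 \<Rightarrow> real^2"
type_synonym matrix_field = "real^2 \<Rightarrow> real^2^2"

definition square_measure :: "real \<Rightarrow> (real^2) measure" where
  "square_measure L = restrict_space lborel {x. \<forall>i. 0 \<le> x $ i \<and> x $ i \<le> L}"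

definition partial :: "2 \<Rightarrow> scalar_field \<Rightarrow> scalar_field" where
  "partial i f x = frechet_derivative f (at x) (axis i 1)"

primrec times_cont_diff :: "nat \<Rightarrow> scalar_field \<Rightarrow> bool" where
  "times_cont_diff 0 f = continuous_on UNIV f"
| "times_cont_diff (Suc k) f =
     ((\<forall>x. f differentiable (at x)) \<and> (\<forall>i. times_cont_diff k (partial i f)))"

definition smooth :: "scalar_field \<Rightarrow> bool" where
  "smooth f \<longleftrightarrow> (\<forall>k. times_cont_diff k f)"

definition periodic_in :: "2 \<Rightarrow> real \<Rightarrow> scalar_field \<Rightarrow> bool" where
  "periodic_in i L f \<longleftrightarrow> (\<forall>x. f (x + axis i L) = f x)"

definition smooth_periodic :: "real \<Rightarrow> scalar_field set" where
  "smooth_periodic L = {f. smooth f \<and> periodic_in 1 L f \<and> periodic_in 2 L f}"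

definition smooth_strip :: "real \<Rightarrow> scalar_field set" where
  "smooth_strip L = {f. smooth f \<and> periodic_in 1 L f}"

definition smooth_strip0 :: "real \<Rightarrow> scalar_field set" where
  "smooth_strip0 L =
     {f \<in> smooth_strip L. \<exists>\<epsilon>>0. \<forall>x. x $ 2 \<le> \<epsilon> \<or> x $ 2 \<ge> L - \<epsilon> \<longrightarrow> f x = 0}"

text \<open>
  \<open>g\<close> is the gradient of \<open>f\<close>, where \<open>f\<close> lies in the closure of the class \<open>S\<close> of smooth functions in
  the \<open>W\<^sup>1\<^sup>,\<^sup>2\<close> norm. For \<open>S = smooth_periodic L\<close> this closure is \<open>W\<^sup>1\<^sup>,\<^sup>2\<close> with periodic boundary
  conditions, for \<open>S = smooth_strip L\<close> it is \<open>W\<^sup>1\<^sup>,\<^sup>2\<close> with periodicity in the first variable only, and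
  for \<open>S = smooth_strip0 L\<close> it is the subspace of the latter of functions with zero trace on the
  walls \<open>x\<^sub>2 = 0\<close> and \<open>x\<^sub>2 = L\<close>.
\<close>

definition has_grad :: "real \<Rightarrow> scalar_field set \<Rightarrow> scalar_field \<Rightarrow> vector_field \<Rightarrow> bool" where
  "has_grad L S f g \<longleftrightarrow>
     f \<in> L2 (square_measure L) \<and> g \<in> L2 (square_measure L) \<and>
     (\<exists>F. (\<forall>n. F n \<in> S) \<and>
        (\<lambda>n. L2_norm (square_measure L) (\<lambda>x. F n x - f x)) \<longlonglongrightarrow> 0 \<and>
        (\<lambda>n. L2_norm (square_measure L) (\<lambda>x. (\<chi> i. partial i (F n) x) - g x)) \<longlonglongrightarrow> 0)"

text \<open>
  \<open>d\<close> is the Laplacian of the \<open>W\<^sup>2\<^sup>,\<^sup>2\<close> function \<open>f\<close>; the second class of smooth functions gives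
  the boundary conditions imposed on the first-order derivatives of \<open>f\<close>.
\<close>

definition has_laplacian ::
  "real \<Rightarrow> scalar_field set \<Rightarrow> scalar_field set \<Rightarrow> scalar_field \<Rightarrow> scalar_field \<Rightarrow> bool" where
  "has_laplacian L S S' f d \<longleftrightarrow>
     d \<in> borel_measurable (square_measure L) \<and>
     (\<exists>g H. has_grad L S f g \<and> (\<forall>i. has_grad L S' (\<lambda>x. g x $ i) (H i)) \<and>
        (AE x in square_measure L. d x = (\<Sum>i\<in>UNIV. H i x $ i)))"


subsection \<open>Velocity fields\<close>

text \<open>Testing the divergence with periodic functions includes the periodicity of the normal component.\<close>

definition V0 :: "real \<Rightarrow> vector_field set" where
  "V0 L = {u \<in> L2 (square_measure L).
     (\<forall>f\<in>smooth_periodic L. L2_inner (square_measure L) u (\<lambda>x. \<chi> i. partial i f x) = 0) \<and>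
     (\<integral>x. u x \<partial>square_measure L) = 0}"

text \<open>Row \<open>i\<close> of \<open>G x\<close> is the gradient of the component \<open>u\<^sub>i\<close>, so \<open>G x *v w\<close> is \<open>(w \<cdot> \<nabla>) u\<close> at \<open>x\<close>.\<close>

definition has_grad_vel :: "real \<Rightarrow> vector_field \<Rightarrow> matrix_field \<Rightarrow> bool" where
  "has_grad_vel L u G \<longleftrightarrow>
     (\<forall>i. has_grad L (smooth_periodic L) (\<lambda>x. u x $ i) (\<lambda>x. G x $ i))"

definition V1 :: "real \<Rightarrow> vector_field set" where
  "V1 L = {u \<in> V0 L. \<exists>G. has_grad_vel L u G}"

text \<open>\<open>p\<close> is the orthogonal (Leray) projection of \<open>f\<close> onto \<open>V0 L\<close>.\<close>

definition leray :: "real \<Rightarrow> vector_field \<Rightarrow> vector_field \<Rightarrow> bool" where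
  "leray L f p \<longleftrightarrow> f \<in> L2 (square_measure L) \<and> p \<in> V0 L \<and>
     (\<forall>v\<in>V0 L. L2_inner (square_measure L) (\<lambda>x. f x - p x) v = 0)"

text \<open>Graph of the Stokes operator: \<open>u\<close> is in its domain and is mapped to \<open>w\<close>.\<close>

definition stokes :: "real \<Rightarrow> vector_field \<Rightarrow> vector_field \<Rightarrow> bool" where
  "stokes L u w \<longleftrightarrow> u \<in> V0 L \<and>
     (\<exists>d. (\<forall>i. has_laplacian L (smooth_periodic L) (smooth_periodic L)
                 (\<lambda>x. u x $ i) (\<lambda>x. d x $ i)) \<and>
          leray L (\<lambda>x. - d x) w)"


subsection \<open>Temperatures\<close>

abbreviation H0 :: "real \<Rightarrow> scalar_field set" where
  "H0 L \<equiv> L2 (square_measure L)"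

definition has_grad_temp :: "real \<Rightarrow> scalar_field \<Rightarrow> vector_field \<Rightarrow> bool" where
  "has_grad_temp L \<theta> g \<longleftrightarrow> has_grad L (smooth_strip0 L) \<theta> g"

text \<open>Graph of minus the Laplacian with the boundary conditions of the temperature.\<close>

definition temp_op :: "real \<Rightarrow> scalar_field \<Rightarrow> scalar_field \<Rightarrow> bool" where
  "temp_op L \<theta> w \<longleftrightarrow> has_laplacian L (smooth_strip0 L) (smooth_strip L) \<theta> (\<lambda>x. - w x)"

text \<open>The domain of the square root of the operator above, which has eigenvalues \<open>lam\<close> and eigenfunctions \<open>e\<close>.\<close>

definition H1 :: "real \<Rightarrow> (nat \<Rightarrow> real) \<Rightarrow> (nat \<Rightarrow> scalar_field) \<Rightarrow> scalar_field set" where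
  "H1 L lam e = power_dom (square_measure L) (H0 L) lam e (1/2)"


section \<open>Noise\<close>

definition filtered_prob_space :: "'w measure \<Rightarrow> (real \<Rightarrow> 'w measure) \<Rightarrow> bool" where
  "filtered_prob_space P F \<longleftrightarrow> prob_space P \<and>
     (\<forall>t\<ge>0. subalgebra P (F t)) \<and> (\<forall>s t. 0 \<le> s \<and> s \<le> t \<longrightarrow> subalgebra (F t) (F s))"

definition events_of :: "'w measure \<Rightarrow> ('w \<Rightarrow> real) \<Rightarrow> 'w set set" where
  "events_of P X = {X -` A \<inter> space P | A. A \<in> sets borel}"

definition brownian_motion ::
  "'w measure \<Rightarrow> (real \<Rightarrow> 'w measure) \<Rightarrow> (real \<Rightarrow> 'w \<Rightarrow> real) \<Rightarrow> bool" where
  "brownian_motion P F b \<longleftrightarrow>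
     (\<forall>t\<ge>0. b t \<in> borel_measurable (F t)) \<and>
     (AE w in P. b 0 w = 0) \<and>
     (AE w in P. continuous_on {0..} (\<lambda>t. b t w)) \<and>
     (\<forall>s t. 0 \<le> s \<and> s < t \<longrightarrow>
        distributed P lborel (\<lambda>w. b t w - b s w) (normal_density 0 (sqrt (t - s))) \<and>
        prob_space.indep_set P (sets (F s)) (events_of P (\<lambda>w. b t w - b s w)))"

text \<open>
  Mutually independent Brownian motions with respect to a common filtration: for \<open>s < t\<close>, the past
  \<open>F s\<close> and the increments over \<open>[s,t]\<close> of all the Brownian motions form an independent family
  (by adaptedness, this contains the independence of the processes).
\<close>

definition independent_brownian_motions ::
  "'w measure \<Rightarrow> (real \<Rightarrow> 'w measure) \<Rightarrow> ('i \<Rightarrow> real \<Rightarrow> 'w \<Rightarrow> real) \<Rightarrow> bool" where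
  "independent_brownian_motions P F b \<longleftrightarrow>
     (\<forall>i. brownian_motion P F (b i)) \<and>
     (\<forall>s t. 0 \<le> s \<and> s < t \<longrightarrow>
        prob_space.indep_sets P
          (case_option (sets (F s)) (\<lambda>i. events_of P (\<lambda>w. b i t w - b i s w))) UNIV)"

text \<open>\<open>W t = (\<Sum>j. sqrt (q j) * b j t * e j)\<close> in \<open>X\<close>, almost surely for every \<open>t \<ge> 0\<close>.\<close>

definition noise_series ::
  "'w measure \<Rightarrow> 'a measure \<Rightarrow> ('a \<Rightarrow> 'b::euclidean_space) set \<Rightarrow> (nat \<Rightarrow> real) \<Rightarrow> (nat \<Rightarrow> 'a \<Rightarrow> 'b)
    \<Rightarrow> (nat \<Rightarrow> real \<Rightarrow> 'w \<Rightarrow> real) \<Rightarrow> (real \<Rightarrow> 'w \<Rightarrow> 'a \<Rightarrow> 'b) \<Rightarrow> bool" where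
  "noise_series P M X q e b W \<longleftrightarrow>
     (\<forall>t\<ge>0. AE w in P. W t w \<in> X \<and>
        (\<lambda>n. L2_norm M (\<lambda>x. W t w x - (\<Sum>j<n. (sqrt (q j) * b j t w) *\<^sub>R e j x))) \<longlonglongrightarrow> 0)"


section \<open>The semi-implicit Euler scheme\<close>

text \<open>
  One step for the velocity: \<open>v\<close> and \<open>th\<close> are the velocity and the temperature at the previous time,
  \<open>u\<close> is the new velocity and \<open>dW\<close> the increment of the noise. The pairing of \<open>\<Pi> [(v \<cdot> \<nabla>) u]\<close> with
  \<open>\<phi>\<close> in \<open>V1 L\<close> is the integral of \<open>((v \<cdot> \<nabla>) u) \<bullet> \<phi>\<close>, as \<open>(v \<cdot> \<nabla>) u\<close> need not be square integrable;
  the equation includes that this integral exists.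
\<close>

definition velocity_step ::
  "real \<Rightarrow> real \<Rightarrow> real \<Rightarrow> vector_field \<Rightarrow> scalar_field \<Rightarrow> vector_field \<Rightarrow> vector_field \<Rightarrow> bool" where
  "velocity_step L h \<nu> v th dW u \<longleftrightarrow> u \<in> V1 L \<and>
     (\<exists>G p. has_grad_vel L u G \<and> leray L (\<lambda>x. th x *\<^sub>R axis 2 1) p \<and>
       (\<forall>\<phi>\<in>V1 L. \<forall>K. has_grad_vel L \<phi> K \<longrightarrow>
          integrable (square_measure L) (\<lambda>x. (G x *v v x) \<bullet> \<phi> x) \<and>
          L2_inner (square_measure L) (\<lambda>x. u x - v x) \<phi>
            + h * \<nu> * L2_inner (square_measure L) G K
            + h * L2_inner (square_measure L) (\<lambda>x. G x *v v x) \<phi>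
          = h * L2_inner (square_measure L) p \<phi> + L2_inner (square_measure L) dW \<phi>))"

text \<open>Here \<open>g\<close> and \<open>k\<close> are the gradients that every element of \<open>H1 L lam e\<close> has.\<close>

definition temperature_step ::
  "real \<Rightarrow> (nat \<Rightarrow> real) \<Rightarrow> (nat \<Rightarrow> scalar_field) \<Rightarrow> real \<Rightarrow> real
    \<Rightarrow> vector_field \<Rightarrow> scalar_field \<Rightarrow> scalar_field \<Rightarrow> scalar_field \<Rightarrow> bool" where
  "temperature_step L lam e h \<kappa> v th dW \<theta> \<longleftrightarrow> \<theta> \<in> H1 L lam e \<and>
     (\<exists>g. has_grad_temp L \<theta> g \<and>
       (\<forall>\<psi>\<in>H1 L lam e. \<forall>k. has_grad_temp L \<psi> k \<longrightarrow>
          integrable (square_measure L) (\<lambda>x. (v x \<bullet> g x) * \<psi> x) \<and>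
          L2_inner (square_measure L) (\<lambda>x. \<theta> x - th x) \<psi>
            + h * \<kappa> * L2_inner (square_measure L) g k
            + h * L2_inner (square_measure L) (\<lambda>x. v x \<bullet> g x) \<psi>
          = L2_inner (square_measure L) dW \<psi>))"

definition euler_scheme ::
  "real \<Rightarrow> real \<Rightarrow> real \<Rightarrow> real \<Rightarrow> (nat \<Rightarrow> real) \<Rightarrow> (nat \<Rightarrow> scalar_field)
    \<Rightarrow> 'w measure \<Rightarrow> (real \<Rightarrow> 'w measure)
    \<Rightarrow> (real \<Rightarrow> 'w \<Rightarrow> vector_field) \<Rightarrow> (real \<Rightarrow> 'w \<Rightarrow> scalar_field)
    \<Rightarrow> ('w \<Rightarrow> vector_field) \<Rightarrow> ('w \<Rightarrow> scalar_field) \<Rightarrow> nat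
    \<Rightarrow> (nat \<Rightarrow> 'w \<Rightarrow> vector_field) \<Rightarrow> (nat \<Rightarrow> 'w \<Rightarrow> scalar_field) \<Rightarrow> bool" where
  "euler_scheme L T \<nu> \<kappa> lamt \<zeta>t P F W Wt u0 \<theta>0 N u \<theta> \<longleftrightarrow>
     (let h = T / real N; t = (\<lambda>l::nat. real l * h) in
       (\<forall>w\<in>space P. u 0 w = u0 w \<and> \<theta> 0 w = \<theta>0 w) \<and>
       (\<forall>l\<in>{1..N}.
          u l \<in> F (t l) \<rightarrow>\<^sub>M L2_borel (square_measure L) (V0 L) \<and>
          \<theta> l \<in> F (t l) \<rightarrow>\<^sub>M L2_borel (square_measure L) (H0 L) \<and>
          (AE w in P.
             velocity_step L h \<nu> (u (l - 1) w) (\<theta> (l - 1) w)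
               (\<lambda>x. W (t l) w x - W (t (l - 1)) w x) (u l w) \<and>
             temperature_step L lamt \<zeta>t h \<kappa> (u (l - 1) w) (\<theta> (l - 1) w)
               (\<lambda>x. Wt (t l) w x - Wt (t (l - 1)) w x) (\<theta> l w))))"

definition max_energy ::
  "real \<Rightarrow> real \<Rightarrow> real \<Rightarrow> (nat \<Rightarrow> real) \<Rightarrow> (nat \<Rightarrow> vector_field) \<Rightarrow> nat
    \<Rightarrow> (nat \<Rightarrow> 'w \<Rightarrow> vector_field) \<Rightarrow> 'w \<Rightarrow> real" where
  "max_energy L T \<nu> lam \<zeta> N u w =
     Max ((\<lambda>n. (L2_norm (square_measure L) (u n w))\<^sup>2
             + T / real N * \<nu> * (\<Sum>l=1..n. (power_norm (square_measure L) lam \<zeta> (1/2) (u l w))\<^sup>2))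
          ` {0..N})"

end

theory Submission
  imports Defs
begin

text \<open>
  Testing the two equations with the new iterates removes the transport terms, since a divergence-free
  field is orthogonal to gradients; for merely square-integrable transporting fields this needs a
  truncation of the nonlinearity. Bounding the gradients by the Poincare inequality, the energies at
  step \<open>n\<close> are dominated by the initial energies, by the buoyancy term
  \<open>h (2 / (\<nu> \<lambda>\<^sub>1)) (\<Sum>l<n. \<parallel>\<theta>\<^sup>l\<parallel>\<^sup>2)\<close>, which is at most \<open>2 T / (\<nu> \<lambda>\<^sub>1)\<close> times the maximum of
  \<open>\<parallel>\<theta>\<^sup>l\<parallel>\<^sup>2\<close>, and by sums of \<open>2 \<langle>\<Delta>W, v\<rangle> + \<parallel>\<Delta>W\<parallel>\<^sup>2 - \<rho> h \<parallel>v\<parallel>\<^sup>2\<close>, where \<open>v\<close> is the previous iterate and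
  \<open>\<rho>\<close> comes from the dissipation. By the Gaussian integral \<open>\<integral> exp (a x + b x\<^sup>2)\<close>, the exponential of \<open>B\<close> times
  such a sum is, up to a bounded factor, a supermartingale if \<open>2 B Tr Q < \<rho>\<close> and \<open>h\<close> is small; there is
  room for an exponent slightly larger than \<open>B\<close>, so the maximal inequality bounds the exponential
  moment of the maximum over \<open>n\<close>. The initial velocity, the initial temperature and the two noise sums
  are separated by convexity of \<open>exp\<close>, with weights summing to \<open>1\<close>; such weights exist
  because \<open>\<alpha>\<close> is below the stated threshold. A deterministic initial condition has all
  exponential moments, so that case is the random one
  with the two exponents of the initial data large.
\<close>

section \<open>Square-integrable functions\<close>

text \<open>The noise increment must be paired with an iterate known before it. Testing pairs it
  with the new iterate; the squared norm of the difference of the two iterates, which the implicit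
  scheme provides for free, pays for passing to the old one, at the price of
  \<open>\<parallel>\<Delta>W\<parallel>\<^sup>2\<close>. What remains is quadratic in Gaussians
  independent of the past, and the dissipation has to beat the variance of its linear part, at most
  \<open>4 B^2 Tr Q h\<close> times the squared norm of the old iterate. The constants come from
  splitting the velocity dissipation: one half is the sum kept in the energy, a quarter absorbs the
  buoyancy by Young's inequality, and the last quarter leaves
  \<open>\<rho> = \<nu> \<lambda>\<^sub>1 / 2\<close> for the noise. So
  \<open>2 B Tr Q < \<rho>\<close> reads \<open>4 B Tr Q < \<nu> \<lambda>\<^sub>1\<close>, which is
  the 4 in front of the trace. The noise is tied to the Brownian motions only by almost surely
  convergent series, so every exponential moment is estimated through a measurable majorant built
  from the Brownian motions.\<close>

lemma L2_measurable: "f \<in> L2 M \<Longrightarrow> f \<in> borel_measurable M"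
  by (simp add: L2_def)

lemma L2_integrable_norm2: "f \<in> L2 M \<Longrightarrow> integrable M (\<lambda>x. (norm (f x))\<^sup>2)"
  by (simp add: L2_def)

lemma L2_integrable_norm_mult:
  assumes "f \<in> L2 M" "g \<in> L2 M"
  shows "integrable M (\<lambda>x. norm (f x) * norm (g x))"
proof (rule Bochner_Integration.integrable_bound)
  show "integrable M (\<lambda>x. (norm (f x))\<^sup>2 + (norm (g x))\<^sup>2)"
    using assms by (intro Bochner_Integration.integrable_add L2_integrable_norm2)
  show "(\<lambda>x. norm (f x) * norm (g x)) \<in> borel_measurable M"
    using assms[THEN L2_measurable] by measurable
  have "norm (f x) * norm (g x) \<le> (norm (f x))\<^sup>2 + (norm (g x))\<^sup>2" for x
    using sum_squares_bound[of "norm (f x)" "norm (g x)"]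
      mult_nonneg_nonneg[OF norm_ge_zero norm_ge_zero, of "f x" "g x"] by linarith
  then show "AE x in M. norm (norm (f x) * norm (g x)) \<le> norm ((norm (f x))\<^sup>2 + (norm (g x))\<^sup>2)"
    by (auto simp: abs_mult)
qed

lemma L2_integrable_inner:
  assumes "f \<in> L2 M" "g \<in> L2 M"
  shows "integrable M (\<lambda>x. f x \<bullet> g x)"
  by (rule Bochner_Integration.integrable_bound[OF L2_integrable_norm_mult[OF assms]])
     (use assms[THEN L2_measurable] in \<open>auto simp: Cauchy_Schwarz_ineq2\<close>)

lemma L2_integrable_mult:
  fixes f g :: "'a \<Rightarrow> real"
  shows "f \<in> L2 M \<Longrightarrow> g \<in> L2 M \<Longrightarrow> integrable M (\<lambda>x. f x * g x)"
  using L2_integrable_inner[of f M g] by simp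

lemma L2_add: "f \<in> L2 M \<Longrightarrow> g \<in> L2 M \<Longrightarrow> (\<lambda>x. f x + g x) \<in> L2 M"
proof -
  assume fg: "f \<in> L2 M" "g \<in> L2 M"
  have "(\<lambda>x. (norm (f x + g x))\<^sup>2) = (\<lambda>x. (norm (f x))\<^sup>2 + (norm (g x))\<^sup>2 + 2 * (f x \<bullet> g x))"
    by (simp add: power2_norm_eq_inner inner_simps inner_commute algebra_simps)
  with fg show ?thesis
    using L2_integrable_inner[OF fg] by (auto simp: L2_def)
qed

lemma L2_scaleR: "f \<in> L2 M \<Longrightarrow> (\<lambda>x. c *\<^sub>R f x) \<in> L2 M"
  by (auto simp: L2_def power_mult_distrib)

lemma L2_diff: "f \<in> L2 M \<Longrightarrow> g \<in> L2 M \<Longrightarrow> (\<lambda>x. f x - g x) \<in> L2 M"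
  using L2_add[of f M "\<lambda>x. (-1) *\<^sub>R g x"] L2_scaleR[of g M "-1"] by simp

lemma L2_zero [simp]: "(\<lambda>x. 0) \<in> L2 M"
  by (simp add: L2_def)

lemma L2_sum: "(\<And>i. i \<in> I \<Longrightarrow> f i \<in> L2 M) \<Longrightarrow> (\<lambda>x. \<Sum>i\<in>I. f i x) \<in> L2 M"
  by (induction I rule: infinite_finite_induct) (auto intro: L2_add)

lemma L2_inner_add_left:
  "f \<in> L2 M \<Longrightarrow> g \<in> L2 M \<Longrightarrow> k \<in> L2 M \<Longrightarrow>
    L2_inner M (\<lambda>x. f x + g x) k = L2_inner M f k + L2_inner M g k"
  by (simp add: L2_inner_def inner_add_left L2_integrable_inner)

lemma L2_inner_diff_left:
  "f \<in> L2 M \<Longrightarrow> g \<in> L2 M \<Longrightarrow> k \<in> L2 M \<Longrightarrow>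
    L2_inner M (\<lambda>x. f x - g x) k = L2_inner M f k - L2_inner M g k"
  by (simp add: L2_inner_def inner_diff_left L2_integrable_inner)

lemma L2_inner_scaleR_left: "L2_inner M (\<lambda>x. c *\<^sub>R f x) k = c * L2_inner M f k"
  by (simp add: L2_inner_def)

lemma L2_inner_commute: "L2_inner M f g = L2_inner M g f"
  by (simp add: L2_inner_def inner_commute)

lemma L2_inner_add_right:
  "f \<in> L2 M \<Longrightarrow> g \<in> L2 M \<Longrightarrow> k \<in> L2 M \<Longrightarrow>
    L2_inner M k (\<lambda>x. f x + g x) = L2_inner M k f + L2_inner M k g"
  by (simp add: L2_inner_def inner_add_right L2_integrable_inner)

lemma L2_inner_diff_right:
  "f \<in> L2 M \<Longrightarrow> g \<in> L2 M \<Longrightarrow> k \<in> L2 M \<Longrightarrow>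
    L2_inner M k (\<lambda>x. f x - g x) = L2_inner M k f - L2_inner M k g"
  by (simp add: L2_inner_def inner_diff_right L2_integrable_inner)

lemma L2_inner_scaleR_right: "L2_inner M k (\<lambda>x. c *\<^sub>R f x) = c * L2_inner M k f"
  by (simp add: L2_inner_def)

lemma L2_inner_sum_left:
  "(\<And>i. i \<in> I \<Longrightarrow> f i \<in> L2 M) \<Longrightarrow> k \<in> L2 M \<Longrightarrow>
    L2_inner M (\<lambda>x. \<Sum>i\<in>I. f i x) k = (\<Sum>i\<in>I. L2_inner M (f i) k)"
  unfolding L2_inner_def inner_sum_left
  by (rule Bochner_Integration.integral_sum) (auto intro: L2_integrable_inner)

lemma L2_inner_self_nonneg [simp]: "0 \<le> L2_inner M f f"
  by (simp add: L2_inner_def integral_nonneg_AE)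

lemma L2_norm_nonneg [simp]: "0 \<le> L2_norm M f"
  by (simp add: L2_norm_def)

lemma L2_norm_power2: "(L2_norm M f)\<^sup>2 = L2_inner M f f"
  by (simp add: L2_norm_def)

lemma L2_norm_minus_commute: "L2_norm M (\<lambda>x. f x - g x) = L2_norm M (\<lambda>x. g x - f x)"
  by (simp add: L2_norm_def L2_inner_def inner_diff_left inner_diff_right algebra_simps)

lemma L2_norm_add_power2:
  assumes "f \<in> L2 M" "g \<in> L2 M"
  shows "(L2_norm M (\<lambda>x. f x + g x))\<^sup>2 =
    (L2_norm M f)\<^sup>2 + 2 * L2_inner M f g + (L2_norm M g)\<^sup>2"
  using assms L2_add[OF assms]
  by (simp add: L2_norm_power2 L2_inner_add_left L2_inner_add_right L2_inner_commute[of M g f])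

lemma L2_norm_diff_power2:
  assumes "f \<in> L2 M" "g \<in> L2 M"
  shows "(L2_norm M (\<lambda>x. f x - g x))\<^sup>2 =
    (L2_norm M f)\<^sup>2 - 2 * L2_inner M f g + (L2_norm M g)\<^sup>2"
  using assms L2_diff[OF assms]
  by (simp add: L2_norm_power2 L2_inner_diff_left L2_inner_diff_right L2_inner_commute[of M g f])

text \<open>Discriminant argument. Functions equal almost everywhere are not identified, so the form
  is only semidefinite and a vanishing squared norm of \<open>g\<close> is a case of its
  own.\<close>

lemma L2_Cauchy_Schwarz:
  assumes "f \<in> L2 M" "g \<in> L2 M"
  shows "\<bar>L2_inner M f g\<bar> \<le> L2_norm M f * L2_norm M g"
proof (rule abs_le_square_iff[THEN iffD2, of _ "L2_norm M f * L2_norm M g", simplified abs_of_nonneg, simplified])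
  let ?a = "L2_inner M f f" and ?b = "L2_inner M f g" and ?c = "L2_inner M g g"
  have quad: "0 \<le> ?a - 2 * t * ?b + t\<^sup>2 * ?c" for t
  proof -
    have "0 \<le> (L2_norm M (\<lambda>x. f x - t *\<^sub>R g x))\<^sup>2" by simp
    also have "\<dots> = ?a - 2 * t * ?b + t\<^sup>2 * ?c"
      unfolding L2_norm_diff_power2[OF assms(1) L2_scaleR[OF assms(2)]]
      unfolding L2_norm_power2
      by (simp add: L2_inner_scaleR_left L2_inner_scaleR_right power2_eq_square)
    finally show ?thesis .
  qed
  have "?b\<^sup>2 \<le> ?a * ?c"
  proof (cases "?c = 0")
    case True
    have "?b = 0"
    proof (rule ccontr)
      \<comment> \<open>Without its quadratic term the bound is affine in \<open>t\<close>; at the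
        \<open>t\<close> inserted below it takes the value -1.\<close>
      assume "?b \<noteq> 0"
      then show False using quad[of "(?a + 1) / (2 * ?b)"] True by simp
    qed
    then show ?thesis by (simp add: True)
  next
    case False
    then have "?c > 0" using L2_inner_self_nonneg[of M g] by linarith
    then show ?thesis using quad[of "?b / ?c"]
      by (simp add: field_simps power2_eq_square)
  qed
  then show "?b\<^sup>2 \<le> (L2_norm M f * L2_norm M g)\<^sup>2"
    by (simp add: power_mult_distrib L2_norm_power2)
qed

lemma L2_norm_triangle:
  assumes "f \<in> L2 M" "g \<in> L2 M"
  shows "L2_norm M (\<lambda>x. f x + g x) \<le> L2_norm M f + L2_norm M g"
  by (rule power2_le_imp_le)
     (use L2_Cauchy_Schwarz[OF assms] in \<open>simp_all add: L2_norm_add_power2[OF assms] power2_sum\<close>)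

lemma L2_norm_diff_ge:
  assumes "f \<in> L2 M" "g \<in> L2 M"
  shows "\<bar>L2_norm M f - L2_norm M g\<bar> \<le> L2_norm M (\<lambda>x. f x - g x)"
  using L2_norm_triangle[OF L2_diff[OF assms] assms(2)]
    L2_norm_triangle[OF L2_diff[OF assms(2,1)] assms(1)] L2_norm_minus_commute[of M f g]
  by simp

lemma tendsto_L2_norm:
  assumes "\<And>n. F n \<in> L2 M" "f \<in> L2 M" "(\<lambda>n. L2_norm M (\<lambda>x. F n x - f x)) \<longlonglongrightarrow> 0"
  shows "(\<lambda>n. L2_norm M (F n)) \<longlonglongrightarrow> L2_norm M f"
  by (rule LIM_zero_cancel, rule Lim_null_comparison[OF _ assms(3)])
     (use L2_norm_diff_ge[OF assms(1,2)] in \<open>simp add: always_eventually\<close>)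

lemma tendsto_L2_inner:
  assumes F: "\<And>n. F n \<in> L2 M" "f \<in> L2 M" "(\<lambda>n. L2_norm M (\<lambda>x. F n x - f x)) \<longlonglongrightarrow> 0"
    and G: "\<And>n. G n \<in> L2 M" "g \<in> L2 M" "(\<lambda>n. L2_norm M (\<lambda>x. G n x - g x)) \<longlonglongrightarrow> 0"
  shows "(\<lambda>n. L2_inner M (F n) (G n)) \<longlonglongrightarrow> L2_inner M f g"
proof (rule LIM_zero_cancel, rule Lim_null_comparison)
  let ?bd = "\<lambda>n. L2_norm M (\<lambda>x. F n x - f x) * L2_norm M (G n) + L2_norm M f * L2_norm M (\<lambda>x. G n x - g x)"
  have "L2_inner M (F n) (G n) - L2_inner M f g =
      L2_inner M (\<lambda>x. F n x - f x) (G n) + L2_inner M f (\<lambda>x. G n x - g x)" for n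
    using F(1,2) G(1,2)
    by (simp add: L2_inner_diff_left L2_inner_commute[of M f])
  then show "\<forall>\<^sub>F n in sequentially. norm (L2_inner M (F n) (G n) - L2_inner M f g) \<le> ?bd n"
    using L2_Cauchy_Schwarz[OF L2_diff[OF F(1,2)] G(1)] L2_Cauchy_Schwarz[OF F(2) L2_diff[OF G(1,2)]]
    by (auto intro!: always_eventually order_trans[OF abs_triangle_ineq] add_mono)
  show "?bd \<longlonglongrightarrow> 0"
    using tendsto_add[OF tendsto_mult[OF F(3) tendsto_L2_norm[OF G]] tendsto_mult[OF tendsto_const G(3)]]
    by simp
qed

lemma L2_norm_zero [simp]: "L2_norm M (\<lambda>x. 0) = 0"
  by (simp add: L2_norm_def L2_inner_def)

text \<open>Convergence in L2 is convergence to 0 in L1 of the squared differences, to which the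
  subsequence theorem for L1 applies.\<close>

lemma L2_AE_subseq:
  fixes f :: "'a \<Rightarrow> real"
  assumes "\<And>n. F n \<in> L2 M" "f \<in> L2 M" "(\<lambda>n. L2_norm M (\<lambda>x. F n x - f x)) \<longlonglongrightarrow> 0"
  shows "\<exists>r. strict_mono r \<and> (AE x in M. (\<lambda>n. F (r n) x) \<longlonglongrightarrow> f x)"
proof -
  have int: "integrable M (\<lambda>x. (F n x - f x)\<^sup>2)" for n
    using L2_integrable_norm2[OF L2_diff[OF assms(1,2)], of n] by simp
  have "(\<lambda>n. (L2_norm M (\<lambda>x. F n x - f x))\<^sup>2) \<longlonglongrightarrow> 0"
    using tendsto_power[OF assms(3), of 2] by simp
  then have "(\<lambda>n. \<integral>x. norm ((F n x - f x)\<^sup>2) \<partial>M) \<longlonglongrightarrow> 0"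
    by (simp only: L2_norm_power2) (simp add: L2_inner_def power2_eq_square)
  from tendsto_L1_AE_subseq[OF int this] obtain r where
    r: "strict_mono r" and lim: "AE x in M. (\<lambda>n. (F (r n) x - f x)\<^sup>2) \<longlonglongrightarrow> 0" by blast
  have *: "X \<longlonglongrightarrow> a" if "(\<lambda>n. (X n - a)\<^sup>2) \<longlonglongrightarrow> 0" for X :: "nat \<Rightarrow> real" and a
    using tendsto_real_sqrt[OF that] by (simp add: tendsto_rabs_zero_iff LIM_zero_cancel)
  have "AE x in M. (\<lambda>n. F (r n) x) \<longlonglongrightarrow> f x"
    using lim by eventually_elim (rule *)
  with r show ?thesis by blast
qed

section \<open>Orthonormal systems and Parseval's identity\<close>

lemma L2_inner_orthonormal_sum:
  assumes co: "complete_orthonormal M X e" and X: "X \<subseteq> L2 M"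
  shows "(L2_norm M (\<lambda>x. \<Sum>j<(n::nat). a j *\<^sub>R e j x))\<^sup>2 = (\<Sum>j<n. (a j)\<^sup>2)"
    and "g \<in> L2 M \<Longrightarrow> L2_inner M (\<lambda>x. \<Sum>j<n. a j *\<^sub>R e j x) g = (\<Sum>j<n. a j * L2_inner M g (e j))"
proof -
  have e: "e j \<in> L2 M" for j using co X by (auto simp: complete_orthonormal_def)
  show 2: "L2_inner M (\<lambda>x. \<Sum>j<n. a j *\<^sub>R e j x) g = (\<Sum>j<n. a j * L2_inner M g (e j))"
    if "g \<in> L2 M" for g
    using that by (subst L2_inner_sum_left) (auto intro: L2_scaleR e simp: L2_inner_scaleR_left L2_inner_commute)
  have s: "(\<lambda>x. \<Sum>j<n. a j *\<^sub>R e j x) \<in> L2 M" by (intro L2_sum L2_scaleR e)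
  have "L2_inner M (\<lambda>x. \<Sum>j<n. a j *\<^sub>R e j x) (e k) = (if k < n then a k else 0)" for k
  proof -
    have *: "L2_inner M (e k) (e j) = (if k = j then 1 else 0)" for j
      using co unfolding complete_orthonormal_def by blast
    show ?thesis by (simp add: 2[OF e] * if_distrib cong: if_cong)
  qed
  then show "(L2_norm M (\<lambda>x. \<Sum>j<n. a j *\<^sub>R e j x))\<^sup>2 = (\<Sum>j<n. (a j)\<^sup>2)"
    unfolding L2_norm_power2 by (simp add: 2 s power2_eq_square)
qed

text \<open>The norms of the partial expansions converge along with the expansions, and by
  orthonormality their squares are the partial sums of the squared coefficients.\<close>

lemma L2_Parseval:
  assumes co: "complete_orthonormal M X e" and X: "X \<subseteq> L2 M" and f: "f \<in> X"
  shows "(\<lambda>j. (L2_inner M f (e j))\<^sup>2) sums (L2_norm M f)\<^sup>2"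
proof -
  have e: "e j \<in> L2 M" for j using co X by (auto simp: complete_orthonormal_def)
  let ?s = "\<lambda>n x. \<Sum>j<n. L2_inner M f (e j) *\<^sub>R e j x"
  have "(\<lambda>n. L2_norm M (?s n)) \<longlonglongrightarrow> L2_norm M f"
    by (rule tendsto_L2_norm)
       (use f X co in \<open>auto intro!: L2_sum L2_scaleR e simp: L2_norm_minus_commute[of M _ f] complete_orthonormal_def\<close>)
  then have "(\<lambda>n. (L2_norm M (?s n))\<^sup>2) \<longlonglongrightarrow> (L2_norm M f)\<^sup>2" by (rule tendsto_power)
  then show ?thesis by (simp add: sums_def L2_inner_orthonormal_sum[OF co X])
qed

section \<open>Smooth functions and integration by parts on the square\<close>

abbreviation grad :: "scalar_field \<Rightarrow> vector_field" where
  "grad f x \<equiv> \<chi> i. partial i f x"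

section \<open>Calculus of the classes of smooth functions\<close>

lemma partial_eqI: "(f has_derivative f') (at x) \<Longrightarrow> partial i f x = f' (axis i 1)"
  unfolding partial_def using frechet_derivative_at[of f f' x] by simp

lemma times_cont_diff_const: "times_cont_diff k (\<lambda>x. c)"
proof (induction k arbitrary: c)
  case (Suc k)
  have "partial i (\<lambda>x. c) = (\<lambda>x. 0)" for i
    by (rule ext, rule partial_eqI[of _ "\<lambda>_. 0", simplified]) simp
  with Suc show ?case by simp
qed simp

lemma times_cont_diff_Suc: "times_cont_diff (Suc k) f \<Longrightarrow> times_cont_diff k f"
proof (induction k arbitrary: f)
  case 0
  then show ?case
    by (auto intro!: differentiable_imp_continuous_on simp: differentiable_on_def
        intro: differentiable_at_withinI)
next
  case (Suc k)
  then show ?case unfolding times_cont_diff.simps(2)[of "Suc k"] by simp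
qed

lemma times_cont_diff_add:
  "times_cont_diff k f \<Longrightarrow> times_cont_diff k g \<Longrightarrow> times_cont_diff k (\<lambda>x. f x + g x)"
proof (induction k arbitrary: f g)
  case 0 then show ?case by (auto intro: continuous_intros)
next
  case (Suc k)
  have "partial i (\<lambda>x. f x + g x) = (\<lambda>x. partial i f x + partial i g x)" for i
  proof
    fix x
    show "partial i (\<lambda>x. f x + g x) x = partial i f x + partial i g x"
      unfolding partial_def[of i f] partial_def[of i g]
      by (rule partial_eqI, rule has_derivative_add)
         (use Suc.prems in \<open>simp_all add: frechet_derivative_works[symmetric]\<close>)
  qed
  with Suc show ?case by simp
qed

lemma times_cont_diff_mult:
  "times_cont_diff k f \<Longrightarrow> times_cont_diff k g \<Longrightarrow> times_cont_diff k (\<lambda>x. f x * g x)"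
proof (induction k arbitrary: f g)
  case 0 then show ?case by (auto intro: continuous_intros)
next
  case (Suc k)
  have "partial i (\<lambda>x. f x * g x) = (\<lambda>x. f x * partial i g x + partial i f x * g x)" for i
  proof
    fix x
    show "partial i (\<lambda>x. f x * g x) x = f x * partial i g x + partial i f x * g x"
      unfolding partial_def[of i f] partial_def[of i g]
      by (rule partial_eqI, rule has_derivative_mult)
         (use Suc.prems in \<open>simp_all add: frechet_derivative_works[symmetric]\<close>)
  qed
  with Suc times_cont_diff_Suc[OF Suc.prems(1)] times_cont_diff_Suc[OF Suc.prems(2)]
  show ?case by (simp add: times_cont_diff_add)
qed

lemma partial_inverse:
  assumes "f differentiable (at x)" "f x \<noteq> 0"
  shows "partial i (\<lambda>x. inverse (f x)) x = - (inverse (f x) * partial i f x * inverse (f x))"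
  unfolding partial_def[of i f]
  by (rule partial_eqI, rule Deriv.has_derivative_inverse)
     (use assms in \<open>simp_all add: frechet_derivative_works[symmetric]\<close>)

lemma times_cont_diff_inverse:
  "times_cont_diff k f \<Longrightarrow> (\<And>x. f x \<noteq> 0) \<Longrightarrow> times_cont_diff k (\<lambda>x. inverse (f x))"
proof (induction k arbitrary: f)
  case 0 then show ?case by (auto intro: continuous_intros)
next
  case (Suc k)
  \<comment> \<open>The derivative contains the reciprocal of \<open>f\<close> again, so the
    induction hypothesis is applied to \<open>f\<close> itself at order \<open>k\<close>.\<close>
  have "partial i (\<lambda>x. inverse (f x)) = (\<lambda>x. (-1) * (inverse (f x) * partial i f x * inverse (f x)))" for i
    using Suc.prems by (auto simp: partial_inverse)
  moreover have "times_cont_diff k (\<lambda>x. inverse (f x))"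
    using Suc.IH[OF times_cont_diff_Suc[OF Suc.prems(1)]] Suc.prems(2) by blast
  ultimately have "times_cont_diff k (partial i (\<lambda>x. inverse (f x)))" for i
    using Suc.prems(1) by (simp only:) (intro times_cont_diff_mult times_cont_diff_const, simp_all)
  with Suc.prems show ?case by simp
qed

lemma times_cont_diff_sum:
  "finite I \<Longrightarrow> (\<And>i. i \<in> I \<Longrightarrow> times_cont_diff k (f i)) \<Longrightarrow> times_cont_diff k (\<lambda>x. \<Sum>i\<in>I. f i x)"
  by (induction I rule: finite_induct) (auto intro: times_cont_diff_const times_cont_diff_add)

lemma times_cont_diff_shift: "times_cont_diff k f \<Longrightarrow> times_cont_diff k (\<lambda>x. f (x - c))"
proof (induction k arbitrary: f)
  case 0 then show ?case
    by (auto intro!: continuous_intros continuous_on_compose2[of UNIV f])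
next
  case (Suc k)
  have der: "((\<lambda>x. f (x - c)) has_derivative frechet_derivative f (at (x - c))) (at x)" for x
  proof -
    have "((\<lambda>x. x - c) has_derivative (\<lambda>h. h)) (at x)" by (auto intro!: derivative_eq_intros)
    from has_derivative_compose[OF this, of f "frechet_derivative f (at (x - c))"] Suc.prems
    show ?thesis by (simp add: frechet_derivative_works[symmetric])
  qed
  then have "partial i (\<lambda>x. f (x - c)) = (\<lambda>x. partial i f (x - c))" for i
    by (auto simp: partial_def[of i f] partial_eqI)
  with der Suc show ?case by (auto simp: differentiable_def)
qed

lemma partial_cong_open:
  assumes "open U" "x \<in> U" "\<And>y. y \<in> U \<Longrightarrow> f y = g y"
  shows "partial i f x = partial i g x"
proof -
  have "(f has_derivative D) (at x) \<longleftrightarrow> (g has_derivative D) (at x)" for D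
    using has_derivative_transform_within_open[OF _ assms(1,2), of f D UNIV g]
      has_derivative_transform_within_open[OF _ assms(1,2), of g D UNIV f] assms(3) by auto
  then show ?thesis by (simp add: partial_def frechet_derivative_def)
qed

text \<open>Smoothness is defined on the whole plane, so functions glued from pieces need a local
  criterion. The induction goes through because partial derivatives inherit agreement on open
  sets.\<close>

lemma times_cont_diff_local:
  assumes "\<And>x. \<exists>U g. open U \<and> x \<in> U \<and> times_cont_diff k g \<and> (\<forall>y\<in>U. f y = g y)"
  shows "times_cont_diff k f"
  using assms
proof (induction k arbitrary: f)
  case 0
  have "isCont f x" for x
  proof -
    obtain U g where U: "open U" "x \<in> U" "continuous_on UNIV g" "\<forall>y\<in>U. f y = g y"
      using 0[of x] by auto
    then have "isCont g x" by (simp add: continuous_on_eq_continuous_at)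
    moreover have "\<forall>\<^sub>F y in nhds x. f y = g y" using U by (auto simp: eventually_nhds)
    ultimately show ?thesis by (simp add: isCont_cong)
  qed
  then show ?case by (simp add: continuous_on_eq_continuous_at)
next
  case (Suc k)
  have "f differentiable (at x)" for x
  proof -
    obtain U g where U: "open U" "x \<in> U" "times_cont_diff (Suc k) g" "\<forall>y\<in>U. f y = g y"
      using Suc.prems[of x] by blast
    then have "g differentiable (at x)" by simp
    then obtain D where "(g has_derivative D) (at x)" by (auto simp: differentiable_def)
    from has_derivative_transform_within_open[OF this U(1,2), of f] U(4)
    show ?thesis by (auto simp: differentiable_def)
  qed
  moreover have "times_cont_diff k (partial i f)" for i
  proof (rule Suc.IH)
    fix x
    obtain U g where U: "open U" "x \<in> U" "times_cont_diff (Suc k) g" "\<forall>y\<in>U. f y = g y"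
      using Suc.prems[of x] by blast
    then have "\<forall>y\<in>U. partial i f y = partial i g y" by (auto intro: partial_cong_open)
    moreover have "times_cont_diff k (partial i g)" using U(3) by simp
    ultimately show "\<exists>U g. open U \<and> x \<in> U \<and> times_cont_diff k g \<and> (\<forall>y\<in>U. partial i f y = g y)"
      using U(1,2) by blast
  qed
  ultimately show ?case by simp
qed

lemma smooth_differentiable: "smooth f \<Longrightarrow> f differentiable (at x)"
  unfolding smooth_def by (metis times_cont_diff.simps(2))

lemma smooth_continuous: "smooth f \<Longrightarrow> continuous_on UNIV f"
  unfolding smooth_def by (metis times_cont_diff.simps(1))

lemma smooth_partial: "smooth f \<Longrightarrow> smooth (partial i f)"
  unfolding smooth_def by (metis times_cont_diff.simps(2))

section \<open>Integration over the square\<close>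

lemma sets_square_aux: "{x :: real^2. \<forall>i. 0 \<le> x $ i \<and> x $ i \<le> L} = cbox 0 (\<chi> i. L)"
  by (auto simp: mem_box_cart)

lemma space_square_measure: "space (square_measure L) = {x. \<forall>i. 0 \<le> x $ i \<and> x $ i \<le> L}"
  by (simp add: square_measure_def space_restrict_space)

lemma integral_square_measure:
  fixes f :: "real^2 \<Rightarrow> 'b::{banach, second_countable_topology}"
  shows "(\<integral>x. f x \<partial>square_measure L) = (\<integral>x. indicator (cbox 0 (\<chi> i. L)) x *\<^sub>R f x \<partial>lborel)"
  unfolding square_measure_def sets_square_aux by (subst integral_restrict_space) auto

lemma integrable_square_measure:
  fixes f :: "real^2 \<Rightarrow> 'b::{banach, second_countable_topology}"
  shows "integrable (square_measure L) f \<longleftrightarrow> integrable lborel (\<lambda>x. indicator (cbox 0 (\<chi> i. L)) x *\<^sub>R f x)"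
  unfolding square_measure_def sets_square_aux by (subst integrable_restrict_space) auto

lemma borel_measurable_square_measure:
  "f \<in> borel_measurable borel \<Longrightarrow> f \<in> borel_measurable (square_measure L)"
  unfolding square_measure_def by (rule measurable_restrict_space1) simp

lemma continuous_L2_square:
  fixes f :: "real^2 \<Rightarrow> 'b::euclidean_space"
  assumes "continuous_on UNIV f"
  shows "f \<in> L2 (square_measure L)"
  unfolding L2_def
  by (auto intro!: borel_measurable_square_measure borel_measurable_continuous_onI assms
      borel_integrable_compact continuous_intros continuous_on_subset[OF assms]
      simp: integrable_square_measure simp del: scaleR_conv_of_real real_scaleR_def)

lemma smooth_L2: "smooth f \<Longrightarrow> f \<in> L2 (square_measure L)"
  by (simp add: continuous_L2_square smooth_continuous)

lemma smooth_grad_L2: "smooth f \<Longrightarrow> grad f \<in> L2 (square_measure L)"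
  by (intro continuous_L2_square continuous_on_vec_lambda smooth_continuous smooth_partial)

text \<open>Coordinates that single out direction \<open>i\<close>, so that one computation serves
  derivatives in both directions.\<close>

definition plane_pt :: "2 \<Rightarrow> real \<Rightarrow> real \<Rightarrow> real^2" where
  "plane_pt i a b = (\<chi> j. if j = i then a else b)"

lemma plane_pt_eq: "plane_pt i a b = a *\<^sub>R axis i 1 + plane_pt i 0 b"
  by (simp add: plane_pt_def vec_eq_iff axis_def)

lemma continuous_plane_pt: "continuous_on UNIV (\<lambda>(a, b). plane_pt i a b)"
proof -
  have "continuous_on UNIV (\<lambda>x :: real \<times> real. if j = i then fst x else snd x)" for j
    by (cases "j = i") (auto intro: continuous_intros)
  then show ?thesis
    unfolding plane_pt_def split_beta by (intro continuous_on_vec_lambda)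
qed

lemma measurable_plane_pt [measurable]: "(\<lambda>(a, b). plane_pt i a b) \<in> borel_measurable (lborel \<Otimes>\<^sub>M lborel)"
  using borel_measurable_continuous_onI[OF continuous_plane_pt, of i]
  by (simp add: lborel_prod)

text \<open>Makes Fubini's theorem available on \<open>real^2\<close>, with either coordinate as the
  inner one. Lebesgue measure is determined by its values on boxes, and the preimage of a box is a
  product of two intervals.\<close>

lemma lborel_plane: "lborel = distr (lborel \<Otimes>\<^sub>M lborel) borel (\<lambda>(a, b). plane_pt i a b)"
proof (rule lborel_eqI)
  fix l u :: "real^2" assume le: "\<And>b. b \<in> Basis \<Longrightarrow> l \<bullet> b \<le> u \<bullet> b"
  define k :: 2 where "k = (if i = 1 then 2 else 1)"
  have k: "k \<noteq> i" "UNIV = {i, k}" using exhaust_2[of i] by (auto simp: k_def UNIV_2)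
  have le': "l $ j \<le> u $ j" for j
    using le[of "axis j 1"] by (auto simp: inner_axis Basis_vec_def)
  have "(\<lambda>(a, b). plane_pt i a b) -` box l u \<inter> space (lborel \<Otimes>\<^sub>M lborel) = box (l $ i) (u $ i) \<times> box (l $ k) (u $ k)"
  proof -
    have all: "(\<forall>j. Q j) \<longleftrightarrow> Q i \<and> Q k" for Q
    proof -
      have "(\<forall>j. Q j) \<longleftrightarrow> (\<forall>j\<in>{i, k}. Q j)" unfolding k(2)[symmetric] by simp
      then show ?thesis by simp
    qed
    have "plane_pt i a b \<in> box l u \<longleftrightarrow> a \<in> box (l $ i) (u $ i) \<and> b \<in> box (l $ k) (u $ k)" for a b
      unfolding mem_box_cart all[of "\<lambda>j. l $ j < plane_pt i a b $ j \<and> plane_pt i a b $ j < u $ j"]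
      using k(1) by (simp add: plane_pt_def)
    then show ?thesis by (auto simp: space_pair_measure)
  qed
  then have "emeasure (distr (lborel \<Otimes>\<^sub>M lborel) borel (\<lambda>(a, b). plane_pt i a b)) (box l u)
      = ennreal (u $ i - l $ i) * ennreal (u $ k - l $ k)"
    by (subst emeasure_distr) (auto simp: lborel.emeasure_pair_measure_Times le')
  also have "\<dots> = ennreal (\<Prod>j\<in>UNIV. (u - l) $ j)"
    using k le' by (simp add: k(2) ennreal_mult)
  also have "(\<Prod>j\<in>UNIV. (u - l) $ j) = (\<Prod>b\<in>Basis. (u - l) \<bullet> b)"
  proof -
    have inj: "inj (\<lambda>j::2. axis j (1::real))" by (auto simp: inj_def axis_eq_axis)
    have B: "Basis = range (\<lambda>j::2. axis j (1::real))" by (auto simp: Basis_vec_def)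
    show ?thesis unfolding B by (subst prod.reindex[OF inj]) (simp add: inner_axis)
  qed
  finally show "emeasure (distr (lborel \<Otimes>\<^sub>M lborel) borel (\<lambda>(a, b). plane_pt i a b)) (box l u)
      = ennreal (\<Prod>b\<in>Basis. (u - l) \<bullet> b)" .
qed simp

text \<open>For a fixed transverse coordinate the fundamental theorem of calculus leaves the
  difference of the values on two opposite sides, which \<open>bd\<close> makes zero; Fubini's
  theorem then integrates over the transverse coordinate.\<close>

lemma integral_partial_eq_0:
  assumes L: "0 \<le> L" and d: "\<And>x. f differentiable (at x)" and c: "continuous_on UNIV (partial i f)"
    and bd: "\<And>b. f (plane_pt i L b) = f (plane_pt i 0 b)"
  shows "(\<integral>x. partial i f x \<partial>square_measure L) = 0"
proof -
  let ?g = "\<lambda>x. indicator (cbox 0 (\<chi> i. L)) x * partial i f x"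
  have int: "integrable lborel ?g"
    using borel_integrable_compact[of "cbox 0 (\<chi> i. L)" "partial i f"] continuous_on_subset[OF c] by simp
  have ind: "indicator (cbox 0 (\<chi> i. L)) (plane_pt i a b) = (indicator {0..L} a * indicator {0..L} b :: real)" for a b
  proof -
    have "(\<forall>j. 0 \<le> plane_pt i a b $ j \<and> plane_pt i a b $ j \<le> L) \<longleftrightarrow> (0 \<le> a \<and> a \<le> L) \<and> (0 \<le> b \<and> b \<le> L)"
      using exhaust_2[of i] by (auto simp: plane_pt_def forall_2 split: if_splits)
    then show ?thesis by (auto simp: mem_box_cart split: split_indicator)
  qed
  have der: "((\<lambda>a. f (plane_pt i a b)) has_real_derivative partial i f (plane_pt i a b)) (at a)" for a b
  proof -
    have "((\<lambda>a. a *\<^sub>R axis i 1 + plane_pt i 0 b) has_derivative (\<lambda>h. h *\<^sub>R axis i 1)) (at a)"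
      by (auto intro!: derivative_eq_intros)
    then have "((\<lambda>a. plane_pt i a b) has_derivative (\<lambda>h. h *\<^sub>R axis i 1)) (at a)"
      by (simp only: plane_pt_eq[symmetric])
    from has_derivative_compose[OF this, of f "frechet_derivative f (at (plane_pt i a b))"] d
    have "((\<lambda>a. f (plane_pt i a b)) has_derivative
        (\<lambda>h. frechet_derivative f (at (plane_pt i a b)) (h *\<^sub>R axis i 1))) (at a)"
      by (simp add: frechet_derivative_works[symmetric])
    moreover have "linear (frechet_derivative f (at (plane_pt i a b)))"
      using d linear_frechet_derivative by blast
    ultimately show ?thesis
      by (simp add: has_field_derivative_def partial_def linear_cmul mult.commute[of _ "frechet_derivative _ _ _"])
  qed
  have cont: "isCont (\<lambda>a. partial i f (plane_pt i a b)) a" for a b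
  proof -
    have "continuous_on UNIV (\<lambda>a. partial i f (plane_pt i a b))"
      by (rule continuous_on_compose2[OF c], subst plane_pt_eq) (auto intro!: continuous_intros)
    then show ?thesis by (simp add: continuous_on_eq_continuous_at)
  qed
  have inner: "(\<integral>a. ?g (plane_pt i a b) \<partial>lborel) = 0" for b
  proof -
    have "(\<integral>a. ?g (plane_pt i a b) \<partial>lborel) = (\<integral>a. indicator {0..L} b * (partial i f (plane_pt i a b) * indicator {0..L} a) \<partial>lborel)"
      by (simp add: ind mult_ac)
    also have "\<dots> = indicator {0..L} b * (f (plane_pt i L b) - f (plane_pt i 0 b))"
      by (subst integral_mult_right_zero, subst integral_FTC_Icc_real[OF L der cont]) simp
    finally show ?thesis by (simp add: bd)
  qed
  have int': "integrable (lborel \<Otimes>\<^sub>M lborel) (\<lambda>(a, b). ?g (plane_pt i a b))"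
  proof -
    have "integrable (distr (lborel \<Otimes>\<^sub>M lborel) borel (\<lambda>(a, b). plane_pt i a b)) ?g"
      using int by (subst (asm) lborel_plane[of i])
    then show ?thesis
      by (subst (asm) integrable_distr_eq) (use int in \<open>auto simp: case_prod_beta'\<close>)
  qed
  have "(\<integral>x. ?g x \<partial>lborel) = (\<integral>x. ?g x \<partial>distr (lborel \<Otimes>\<^sub>M lborel) borel (\<lambda>(a, b). plane_pt i a b))"
    by (subst lborel_plane[of i]) simp
  also have "\<dots> = (\<integral>p. (\<lambda>(a, b). ?g (plane_pt i a b)) p \<partial>(lborel \<Otimes>\<^sub>M lborel))"
    by (subst integral_distr) (use int in \<open>auto simp: case_prod_beta'\<close>)
  also have "\<dots> = (\<integral>b. \<integral>a. ?g (plane_pt i a b) \<partial>lborel \<partial>lborel)"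
    using lborel_pair.integral_snd[OF int'] by simp
  finally show ?thesis by (simp add: inner integral_square_measure)
qed

lemma L2_component:
  fixes g :: "'a \<Rightarrow> real ^ 'n"
  assumes "g \<in> L2 M"
  shows "(\<lambda>x. g x $ i) \<in> L2 M" and "L2_norm M (\<lambda>x. g x $ i) \<le> L2_norm M g"
proof -
  have [measurable]: "(\<lambda>x. g x $ i) \<in> borel_measurable M"
    by (rule borel_measurable_continuous_on[OF _ L2_measurable[OF assms]]) (intro continuous_intros)
  have le: "(g x $ i)\<^sup>2 \<le> (norm (g x))\<^sup>2" for x
    using component_le_norm_cart[of "g x" i] by (simp add: abs_le_square_iff[symmetric])
  have "integrable M (\<lambda>x. (g x $ i)\<^sup>2)"
    by (rule Bochner_Integration.integrable_bound[OF L2_integrable_norm2[OF assms]]) (auto simp: le)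
  then show 1: "(\<lambda>x. g x $ i) \<in> L2 M" by (simp add: L2_def)
  show "L2_norm M (\<lambda>x. g x $ i) \<le> L2_norm M g"
    unfolding L2_norm_def L2_inner_def
    by (intro real_sqrt_le_mono integral_mono L2_integrable_inner 1 assms)
       (use le in \<open>simp_all add: power2_norm_eq_inner power2_eq_square[of "_ $ i"]\<close>)
qed

lemma L2_vec:
  fixes g :: "'a \<Rightarrow> 'b::euclidean_space ^ 'n"
  assumes "\<And>i. (\<lambda>x. g x $ i) \<in> L2 M"
  shows "g \<in> L2 M"
proof -
  have [measurable]: "(\<lambda>x. g x $ i) \<in> borel_measurable M" for i by (rule L2_measurable[OF assms])
  have "g \<in> borel_measurable M"
    unfolding borel_measurable_euclidean_space[of g]
    by (auto simp: Basis_vec_def inner_axis)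
  moreover have "(norm (g x))\<^sup>2 = (\<Sum>i\<in>UNIV. (norm (g x $ i))\<^sup>2)" for x
    by (simp add: power2_norm_eq_inner inner_vec_def)
  ultimately show ?thesis using assms by (simp add: L2_def)
qed

lemma L2_inner_vec:
  fixes f g :: "'a \<Rightarrow> 'b::euclidean_space ^ 'n"
  assumes "\<And>i. (\<lambda>x. f x $ i) \<in> L2 M" "\<And>i. (\<lambda>x. g x $ i) \<in> L2 M"
  shows "L2_inner M f g = (\<Sum>i\<in>UNIV. L2_inner M (\<lambda>x. f x $ i) (\<lambda>x. g x $ i))"
  unfolding L2_inner_def inner_vec_def
  by (rule Bochner_Integration.integral_sum) (intro L2_integrable_inner assms)

text \<open>The boundary terms of \<open>\<integral> f \<nabla>g + g \<nabla>f\<close> on the square vanish.\<close>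

definition boundary_compatible :: "real \<Rightarrow> scalar_field set \<Rightarrow> scalar_field set \<Rightarrow> bool" where
  "boundary_compatible L S S' \<longleftrightarrow> (\<forall>f\<in>S. \<forall>g\<in>S'. smooth f \<and> smooth g \<and>
     (\<forall>i b. f (plane_pt i L b) * g (plane_pt i L b) = f (plane_pt i 0 b) * g (plane_pt i 0 b)))"

lemma plane_pt_shift: "plane_pt i L b = plane_pt i 0 b + axis i L"
  by (simp add: plane_pt_def vec_eq_iff axis_def)

lemma boundary_compatible_periodic:
  "boundary_compatible L (smooth_periodic L) (smooth_periodic L)"
proof -
  have *: "f (plane_pt i L b) = f (plane_pt i 0 b)" if "f \<in> smooth_periodic L" for f i b
    using that exhaust_2[of i] by (auto simp: smooth_periodic_def periodic_in_def plane_pt_shift[of _ L])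
  moreover have "smooth f" if "f \<in> smooth_periodic L" for f
    using that by (simp add: smooth_periodic_def)
  ultimately show ?thesis unfolding boundary_compatible_def by (metis *)
qed

text \<open>In direction 1 both factors are periodic; on the walls the factor from
  \<open>smooth_strip0\<close> vanishes, whatever the other one does there.\<close>

lemma boundary_compatible_strip:
  "boundary_compatible L (smooth_strip0 L) (smooth_strip L)"
proof -
  have per: "f (plane_pt 1 L b) = f (plane_pt 1 0 b)" if "f \<in> smooth_strip L" for f b
    using that by (auto simp: smooth_strip_def periodic_in_def plane_pt_shift[of _ L])
  have zero: "f (plane_pt 2 L b) = 0" "f (plane_pt 2 0 b) = 0" if "f \<in> smooth_strip0 L" for f b
    using that by (auto simp: smooth_strip0_def plane_pt_def)
  have "f (plane_pt i L b) * g (plane_pt i L b) = f (plane_pt i 0 b) * g (plane_pt i 0 b)"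
    if "f \<in> smooth_strip0 L" "g \<in> smooth_strip L" for f g i b
    using exhaust_2[of i] per[of f b] per[of g b] zero[of f b] that by (auto simp: smooth_strip0_def)
  then show ?thesis by (auto simp: boundary_compatible_def smooth_strip0_def smooth_strip_def)
qed

lemma smooth_integration_by_parts:
  assumes "0 \<le> L" "boundary_compatible L S S'" "f \<in> S" "g \<in> S'"
  shows "L2_inner (square_measure L) (partial i f) g + L2_inner (square_measure L) f (partial i g) = 0"
proof -
  have sm: "smooth f" "smooth g" using assms by (auto simp: boundary_compatible_def)
  have "partial i (\<lambda>x. f x * g x) x = f x * partial i g x + partial i f x * g x" for x
    unfolding partial_def[of i f] partial_def[of i g]
    by (rule partial_eqI, rule has_derivative_mult)
       (use sm[THEN smooth_differentiable] in \<open>simp_all add: frechet_derivative_works[symmetric]\<close>)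
  then have eq: "partial i (\<lambda>x. f x * g x) = (\<lambda>x. f x * partial i g x + partial i f x * g x)" ..
  have "(\<integral>x. partial i (\<lambda>x. f x * g x) x \<partial>square_measure L) = 0"
  proof (rule integral_partial_eq_0)
    show "continuous_on UNIV (partial i (\<lambda>x. f x * g x))" unfolding eq
      by (intro continuous_intros smooth_continuous smooth_partial sm)
  qed (use assms sm[THEN smooth_differentiable] in \<open>auto simp: boundary_compatible_def\<close>)
  then show ?thesis unfolding eq
    by (subst (asm) Bochner_Integration.integral_add)
       (auto simp: L2_inner_def intro!: L2_integrable_mult smooth_L2 smooth_partial sm)
qed

section \<open>Weak gradients: integration by parts and Green's formula\<close>

lemma has_grad_approx:
  assumes "has_grad L S f g" "\<And>F. F \<in> S \<Longrightarrow> smooth F"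
  obtains F where "\<And>n. F n \<in> S" "\<And>n. F n \<in> L2 (square_measure L)" "\<And>n. grad (F n) \<in> L2 (square_measure L)"
    "(\<lambda>n. L2_norm (square_measure L) (\<lambda>x. F n x - f x)) \<longlonglongrightarrow> 0"
    "(\<lambda>n. L2_norm (square_measure L) (\<lambda>x. grad (F n) x - g x)) \<longlonglongrightarrow> 0"
proof -
  obtain F where F: "\<And>n. F n \<in> S"
    "(\<lambda>n. L2_norm (square_measure L) (\<lambda>x. F n x - f x)) \<longlonglongrightarrow> 0"
    "(\<lambda>n. L2_norm (square_measure L) (\<lambda>x. grad (F n) x - g x)) \<longlonglongrightarrow> 0"
    using assms(1) unfolding has_grad_def by blast
  show thesis
    by (rule that[OF F(1) smooth_L2 smooth_grad_L2 F(2,3)]) (use assms(2) F(1) in auto)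
qed

lemma L2_component_tendsto:
  fixes g :: "'a \<Rightarrow> real ^ 'n"
  assumes "\<And>n. F n \<in> L2 M" "g \<in> L2 M" "(\<lambda>n. L2_norm M (\<lambda>x. F n x - g x)) \<longlonglongrightarrow> 0"
  shows "(\<lambda>n. L2_norm M (\<lambda>x. F n x $ i - g x $ i)) \<longlonglongrightarrow> 0"
proof (rule Lim_null_comparison[OF always_eventually assms(3)], rule allI)
  fix n
  show "norm (L2_norm M (\<lambda>x. F n x $ i - g x $ i)) \<le> L2_norm M (\<lambda>x. F n x - g x)"
    using L2_component(2)[OF L2_diff[OF assms(1)[of n] assms(2)], of i] by simp
qed

text \<open>The identity is continuous in L2 for functions and gradients together, so it passes from
  the smooth classes to their closures. The two classes may differ, as they do for a temperature and
  the components of a temperature gradient.\<close>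

lemma has_grad_integration_by_parts:
  assumes L: "0 \<le> L" and comp: "boundary_compatible L S S'" and fg: "has_grad L S f g" "has_grad L S' f' g'"
    and ne: "S \<noteq> {}" "S' \<noteq> {}"
  shows "L2_inner (square_measure L) (\<lambda>x. g x $ i) f' + L2_inner (square_measure L) f (\<lambda>x. g' x $ i) = 0"
proof -
  let ?M = "square_measure L"
  have sm: "F \<in> S \<Longrightarrow> smooth F" "F \<in> S' \<Longrightarrow> smooth F" for F
    using comp ne by (auto simp: boundary_compatible_def)
  have L2: "f \<in> L2 ?M" "g \<in> L2 ?M" "f' \<in> L2 ?M" "g' \<in> L2 ?M"
    using fg by (auto simp: has_grad_def)
  obtain F where F: "\<And>n. F n \<in> S" "\<And>n. F n \<in> L2 ?M" "\<And>n. grad (F n) \<in> L2 ?M"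
    "(\<lambda>n. L2_norm ?M (\<lambda>x. F n x - f x)) \<longlonglongrightarrow> 0" "(\<lambda>n. L2_norm ?M (\<lambda>x. grad (F n) x - g x)) \<longlonglongrightarrow> 0"
    by (rule has_grad_approx[OF fg(1) sm(1)]) (assumption | rule that)+
  obtain F' where F': "\<And>n. F' n \<in> S'" "\<And>n. F' n \<in> L2 ?M" "\<And>n. grad (F' n) \<in> L2 ?M"
    "(\<lambda>n. L2_norm ?M (\<lambda>x. F' n x - f' x)) \<longlonglongrightarrow> 0" "(\<lambda>n. L2_norm ?M (\<lambda>x. grad (F' n) x - g' x)) \<longlonglongrightarrow> 0"
    by (rule has_grad_approx[OF fg(2) sm(2)]) (assumption | rule that)+
  have "(\<lambda>n. L2_inner ?M (\<lambda>x. grad (F n) x $ i) (F' n) + L2_inner ?M (F n) (\<lambda>x. grad (F' n) x $ i)) \<longlonglongrightarrow>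
     L2_inner ?M (\<lambda>x. g x $ i) f' + L2_inner ?M f (\<lambda>x. g' x $ i)"
    by (intro tendsto_add tendsto_L2_inner L2_component(1) L2_component_tendsto L2 F F')
  moreover have "L2_inner ?M (\<lambda>x. grad (F n) x $ i) (F' n) + L2_inner ?M (F n) (\<lambda>x. grad (F' n) x $ i) = 0" for n
    using smooth_integration_by_parts[OF L comp F(1) F'(1)] by simp
  ultimately show ?thesis by (simp add: LIMSEQ_const_iff)
qed

lemma smooth_const: "smooth (\<lambda>x. c)"
  by (simp add: smooth_def times_cont_diff_const)

text \<open>The components of the gradient of \<open>f\<close> lie in the closure of
  \<open>S'\<close> and the test function in that of \<open>S\<close>, which is the pairing for
  which integration by parts has no boundary term. It is applied to each component and
  summed.\<close>

lemma has_laplacian_Green: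
  assumes L: "0 \<le> L" and comp: "boundary_compatible L S S'" and lap: "has_laplacian L S S' f d"
    and ne: "S \<noteq> {}" "S' \<noteq> {}"
  obtains g where "has_grad L S f g"
    "\<And>u k. has_grad L S u k \<Longrightarrow> L2_inner (square_measure L) k g = - L2_inner (square_measure L) u d"
proof -
  let ?M = "square_measure L"
  obtain g H where gH: "has_grad L S f g" "\<And>i. has_grad L S' (\<lambda>x. g x $ i) (H i)"
    "AE x in ?M. d x = (\<Sum>i\<in>UNIV. H i x $ i)" and [measurable]: "d \<in> borel_measurable ?M"
    using lap unfolding has_laplacian_def by blast
  show thesis
  proof (rule that[OF gH(1)])
    fix u k assume uk: "has_grad L S u k"
    have L2: "u \<in> L2 ?M" "k \<in> L2 ?M" "g \<in> L2 ?M" "\<And>i. H i \<in> L2 ?M"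
      using uk gH by (auto simp: has_grad_def)
    then have [measurable]: "u \<in> borel_measurable ?M" "\<And>i. (\<lambda>x. H i x $ i) \<in> borel_measurable ?M"
      by (auto intro: L2_measurable L2_component(1))
    have "L2_inner ?M k g = (\<Sum>i\<in>UNIV. L2_inner ?M (\<lambda>x. k x $ i) (\<lambda>x. g x $ i))"
      by (intro L2_inner_vec L2_component(1) L2)
    also have "\<dots> = (\<Sum>i\<in>UNIV. - L2_inner ?M u (\<lambda>x. H i x $ i))"
      using has_grad_integration_by_parts[OF L comp uk gH(2) ne]
      by (intro sum.cong refl) (simp add: eq_neg_iff_add_eq_0)
    also have "\<dots> = - L2_inner ?M u (\<lambda>x. \<Sum>i\<in>UNIV. H i x $ i)"
      by (subst L2_inner_commute, subst L2_inner_sum_left)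
         (auto intro!: L2_component(1) L2 simp: L2_inner_commute[of _ u] sum_negf)
    also have "L2_inner ?M u (\<lambda>x. \<Sum>i\<in>UNIV. H i x $ i) = L2_inner ?M u d"
      unfolding L2_inner_def by (rule integral_cong_AE) (use gH(3) in auto)
    finally show "L2_inner ?M k g = - L2_inner ?M u d" .
  qed
qed

lemma zero_smooth_periodic: "(\<lambda>x. 0) \<in> smooth_periodic L"
  by (simp add: smooth_periodic_def periodic_in_def smooth_const)

lemma zero_smooth_strip0: "(\<lambda>x. 0) \<in> smooth_strip0 L"
  by (auto simp: smooth_strip0_def smooth_strip_def periodic_in_def smooth_const intro: exI[of _ 1])

text \<open>Green's formula with the Laplacian replaced by means of the eigenvalue equation. Applied
  to two eigenfunctions it gives the orthogonality of their gradients.\<close>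

lemma temp_op_weak:
  assumes L: "0 \<le> L" and "temp_op L z (\<lambda>x. c *\<^sub>R z x)"
  obtains k where "has_grad_temp L z k"
    "\<And>\<theta> g. has_grad_temp L \<theta> g \<Longrightarrow> L2_inner (square_measure L) g k = c * L2_inner (square_measure L) \<theta> z"
proof -
  have ne: "smooth_strip0 L \<noteq> {}" "smooth_strip L \<noteq> {}"
    using zero_smooth_strip0[of L] by (auto simp: smooth_strip0_def simp del: mem_Collect_eq)
  obtain k where k: "has_grad L (smooth_strip0 L) z k"
    "\<And>u g. has_grad L (smooth_strip0 L) u g \<Longrightarrow>
       L2_inner (square_measure L) g k = - L2_inner (square_measure L) u (\<lambda>x. - (c *\<^sub>R z x))"
    using has_laplacian_Green[OF L boundary_compatible_strip assms(2)[unfolded temp_op_def] ne] by blast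
  have "L2_inner (square_measure L) u (\<lambda>x. - (c *\<^sub>R z x)) = - (c * L2_inner (square_measure L) u z)" for u
    using L2_inner_scaleR_right[of "square_measure L" u "- c" z] by simp
  with k show thesis by (intro that[of k]) (auto simp: has_grad_temp_def)
qed

text \<open>Green's formula is applied to each component. The Laplacian agrees with minus the Stokes
  operator only up to the part removed by the Leray projection, and that part is orthogonal to the
  divergence-free field \<open>u\<close>.\<close>

lemma stokes_weak:
  assumes L: "0 \<le> L" and st: "stokes L z (\<lambda>x. c *\<^sub>R z x)"
  obtains K where "has_grad_vel L z K"
    "\<And>u G. u \<in> V0 L \<Longrightarrow> has_grad_vel L u G \<Longrightarrow>
       L2_inner (square_measure L) G K = c * L2_inner (square_measure L) u z"
proof -
  let ?M = "square_measure L"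
  obtain d where z: "z \<in> V0 L"
    and d: "\<And>i. has_laplacian L (smooth_periodic L) (smooth_periodic L) (\<lambda>x. z x $ i) (\<lambda>x. d x $ i)"
    and ler: "leray L (\<lambda>x. - d x) (\<lambda>x. c *\<^sub>R z x)"
    using st unfolding stokes_def by blast
  have ne: "smooth_periodic L \<noteq> {}" using zero_smooth_periodic by blast
  have dL2: "d \<in> L2 ?M" using L2_scaleR[of "\<lambda>x. - d x" ?M "-1"] ler by (simp add: leray_def)
  have "\<exists>k. has_grad L (smooth_periodic L) (\<lambda>x. z x $ i) k \<and>
      (\<forall>u g. has_grad L (smooth_periodic L) u g \<longrightarrow> L2_inner ?M g k = - L2_inner ?M u (\<lambda>x. d x $ i))" for i
    using has_laplacian_Green[OF L boundary_compatible_periodic d[of i] ne ne] by metis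
  then obtain k where k: "\<And>i. has_grad L (smooth_periodic L) (\<lambda>x. z x $ i) (k i)"
    "\<And>i u g. has_grad L (smooth_periodic L) u g \<Longrightarrow> L2_inner ?M g (k i) = - L2_inner ?M u (\<lambda>x. d x $ i)"
    by metis
  show thesis
  proof (rule that[of "\<lambda>x. \<chi> i. k i x"])
    show "has_grad_vel L z (\<lambda>x. \<chi> i. k i x)" using k(1) by (simp add: has_grad_vel_def)
    fix u G assume u: "u \<in> V0 L" and G: "has_grad_vel L u G"
    have uL2: "u \<in> L2 ?M" using u by (simp add: V0_def)
    have zL2: "z \<in> L2 ?M" using z by (simp add: V0_def)
    have "L2_inner ?M G (\<lambda>x. \<chi> i. k i x) = (\<Sum>i\<in>UNIV. L2_inner ?M (\<lambda>x. G x $ i) (k i))"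
      using G k(1) by (subst L2_inner_vec) (auto simp: has_grad_vel_def has_grad_def)
    also have "\<dots> = (\<Sum>i\<in>UNIV. - L2_inner ?M (\<lambda>x. u x $ i) (\<lambda>x. d x $ i))"
      using G k(2) by (intro sum.cong refl) (simp add: has_grad_vel_def)
    also have "\<dots> = - L2_inner ?M u d"
      by (subst L2_inner_vec[of u]) (auto intro!: L2_component(1) uL2 dL2 simp: sum_negf)
    also have "\<dots> = L2_inner ?M (\<lambda>x. - d x) u"
      using L2_inner_scaleR_left[of ?M "-1" d u] by (simp add: L2_inner_commute)
    also have "\<dots> = L2_inner ?M (\<lambda>x. c *\<^sub>R z x) u"
    proof -
      have "L2_inner ?M (\<lambda>x. - d x - c *\<^sub>R z x) u = 0" using ler u by (simp add: leray_def)
      then show ?thesis using ler uL2 L2_scaleR[OF zL2]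
        by (subst (asm) L2_inner_diff_left) (auto simp: leray_def)
    qed
    finally show "L2_inner ?M G (\<lambda>x. \<chi> i. k i x) = c * L2_inner ?M u z"
      by (simp add: L2_inner_scaleR_left L2_inner_commute)
  qed
qed

section \<open>Cancellation of the transport terms and energy estimates of one step\<close>

text \<open>\<open>F\<close> vanishes near both walls, so copies of it stacked in the second
  variable fit together smoothly, and derivatives on the closed square are unchanged.\<close>

lemma periodic_extension:
  assumes L: "L > 0" and F: "F \<in> smooth_strip0 L"
  obtains F' where "F' \<in> smooth_periodic L"
    "\<And>x. x \<in> space (square_measure L) \<Longrightarrow> F' x = F x"
    "\<And>x i. x \<in> space (square_measure L) \<Longrightarrow> partial i F' x = partial i F x"
proof -
  obtain e0 where e0: "e0 > 0" "\<forall>x. x $ 2 \<le> e0 \<or> x $ 2 \<ge> L - e0 \<longrightarrow> F x = 0"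
    and sF: "smooth F" "periodic_in 1 L F"
    using F by (auto simp: smooth_strip0_def smooth_strip_def)
  \<comment> \<open>The cap by \<open>L\<close> ensures that a point of the enlarged strip
    \<open>U k\<close> lies in cell \<open>k\<close> or in one of its two neighbours.\<close>
  define e where "e = min e0 L"
  have z: "F x = 0" if "x $ 2 \<le> e \<or> x $ 2 \<ge> L - e" for x
    using e0 L that by (auto simp: e_def)
  have e: "0 < e" "e \<le> L" using e0 L by (auto simp: e_def)
  define G where "G k x = F (x - axis 2 (L * real_of_int k))" for k :: int and x :: "real^2"
  define F' where "F' x = G \<lfloor>x $ 2 / L\<rfloor> x" for x
  define U where "U k = {x :: real^2. L * real_of_int k - e < x $ 2 \<and> x $ 2 < L * real_of_int k + L + e}" for k :: int
  have openU: "open (U k)" for k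
    unfolding U_def by (intro open_Collect_conj open_Collect_less continuous_intros)
  \<comment> \<open>A point of \<open>U k\<close> outside cell \<open>k\<close> is within
    \<open>e\<close> of that cell's edge, where both translates in question are zero.\<close>
  have eqU: "F' x = G k x" if x: "x \<in> U k" for x k
  proof -
    let ?f = "\<lfloor>x $ 2 / L\<rfloor>"
    have fl: "L * real_of_int ?f \<le> x $ 2" "x $ 2 < L * real_of_int ?f + L"
      using floor_divide_lower[OF L, of "x $ 2"] floor_divide_upper[OF L, of "x $ 2"]
      by (simp_all add: algebra_simps)
    have lt: "L * real_of_int a < L * real_of_int b \<longleftrightarrow> a < b" for a b
      using L by simp
    consider "?f = k" | "?f = k + 1" | "?f = k - 1"
    proof -
      have "L * real_of_int ?f < L * real_of_int (k + 2)" "L * real_of_int (k - 2) < L * real_of_int ?f"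
        using fl x e by (auto simp: U_def algebra_simps)
      then have "?f < k + 2" "k - 2 < ?f" unfolding lt by auto
      then show thesis using that by linarith
    qed
    then show ?thesis
    proof cases
      case 1 then show ?thesis by (simp add: F'_def)
    next
      case 2
      have "G ?f x = 0" "G k x = 0" unfolding G_def
        by (rule z; use 2 fl x e in \<open>auto simp: U_def axis_def algebra_simps\<close>)+
      then show ?thesis by (simp add: F'_def)
    next
      case 3
      have "G ?f x = 0" "G k x = 0" unfolding G_def
        by (rule z; use 3 fl x e in \<open>auto simp: U_def axis_def algebra_simps\<close>)+
      then show ?thesis by (simp add: F'_def)
    qed
  qed
  have inU: "x \<in> U \<lfloor>x $ 2 / L\<rfloor>" for x
    using floor_divide_lower[OF L, of "x $ 2"] floor_divide_upper[OF L, of "x $ 2"] e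
    by (simp add: U_def algebra_simps)
  have "times_cont_diff k F'" for k
  proof (rule times_cont_diff_local)
    fix x :: "real^2"
    have "times_cont_diff k (G \<lfloor>x $ 2 / L\<rfloor>)"
      unfolding G_def using sF by (intro times_cont_diff_shift) (simp add: smooth_def)
    then show "\<exists>U g. open U \<and> x \<in> U \<and> times_cont_diff k g \<and> (\<forall>y\<in>U. F' y = g y)"
      using openU inU eqU by blast
  qed
  moreover have "periodic_in 1 L F'"
  proof -
    have "F' (x + axis 1 L) = F' x" for x
    proof -
      have "x + axis 1 L - axis 2 c = (x - axis 2 c) + axis 1 L" for c by simp
      then have "F (x + axis 1 L - axis 2 c) = F (x - axis 2 c)" for c
        using sF(2) unfolding periodic_in_def by metis
      then show ?thesis by (simp add: F'_def G_def axis_def)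
    qed
    then show ?thesis by (simp add: periodic_in_def)
  qed
  moreover have "periodic_in 2 L F'"
  proof -
    have "F' (x + axis 2 L) = F' x" for x
    proof -
      have "\<lfloor>(x + axis 2 L) $ 2 / L\<rfloor> = \<lfloor>x $ 2 / L\<rfloor> + 1"
        using L by (simp add: axis_def add_divide_distrib)
      moreover have "x + axis 2 L - axis 2 (L * (c + 1)) = x - axis 2 (L * c)" for c
        by (simp add: vec_eq_iff axis_def algebra_simps)
      ultimately show ?thesis unfolding F'_def G_def by (simp only: of_int_add of_int_1)
    qed
    then show ?thesis by (simp add: periodic_in_def)
  qed
  ultimately have sp: "F' \<in> smooth_periodic L" by (simp add: smooth_periodic_def smooth_def)
  have G0: "G 0 = F"
  proof
    have *: "axis 2 0 = (0 :: real^2)" by (simp add: vec_eq_iff axis_def)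
    show "G 0 x = F x" for x by (simp only: G_def of_int_0 mult_zero_right * diff_zero)
  qed
  have inU0: "x \<in> U 0" if "x \<in> space (square_measure L)" for x
    using that e by (auto simp: space_square_measure U_def intro: le_less_trans[of _ L] less_le_trans[of _ 0])
  show thesis
  proof (rule that[OF sp])
    fix x assume x: "x \<in> space (square_measure L)"
    show "F' x = F x" using eqU[OF inU0[OF x]] by (simp add: G0)
    show "partial i F' x = partial i F x" for i
      using partial_cong_open[OF openU inU0[OF x], of F' "G 0" i] eqU by (simp add: G0)
  qed
qed

text \<open>The divergence condition in \<open>V0\<close> is tested with fully periodic functions
  only; through this lemma it also applies to temperatures, which are periodic in one variable and
  vanish on the walls.\<close>

lemma has_grad_temp_periodic:
  assumes L: "L > 0" and "has_grad_temp L f g"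
  shows "has_grad L (smooth_periodic L) f g"
proof -
  let ?M = "square_measure L"
  obtain F where fg: "f \<in> L2 ?M" "g \<in> L2 ?M" and F: "\<And>n::nat. F n \<in> smooth_strip0 L"
    "(\<lambda>n. L2_norm ?M (\<lambda>x. F n x - f x)) \<longlonglongrightarrow> 0" "(\<lambda>n. L2_norm ?M (\<lambda>x. grad (F n) x - g x)) \<longlonglongrightarrow> 0"
    using assms(2) unfolding has_grad_temp_def has_grad_def by blast
  have "\<forall>n. \<exists>F'. F' \<in> smooth_periodic L \<and>
     (\<forall>x\<in>space ?M. F' x = F n x \<and> (\<forall>i. partial i F' x = partial i (F n) x))"
    by (rule allI) (rule periodic_extension[OF L F(1)], blast)
  then obtain F' where F': "\<And>n. F' n \<in> smooth_periodic L"
    "\<And>n x. x \<in> space ?M \<Longrightarrow> F' n x = F n x" "\<And>n x i. x \<in> space ?M \<Longrightarrow> partial i (F' n) x = partial i (F n) x"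
    by metis
  have "L2_norm ?M (\<lambda>x. F' n x - f x) = L2_norm ?M (\<lambda>x. F n x - f x)"
    "L2_norm ?M (\<lambda>x. grad (F' n) x - g x) = L2_norm ?M (\<lambda>x. grad (F n) x - g x)" for n
    unfolding L2_norm_def L2_inner_def
    by (intro arg_cong[where f = sqrt] Bochner_Integration.integral_cong refl; simp add: F')+
  with fg F F' show ?thesis unfolding has_grad_def by (intro conjI exI[of _ F']) auto
qed

section \<open>Orthogonality of the transport term\<close>

text \<open>A single subsequence for all components is required because the truncation depends on
  all of them at once; it is refined one index at a time.\<close>

lemma L2_AE_subseq_finite:
  fixes f :: "'i \<Rightarrow> 'a \<Rightarrow> real"
  assumes "finite I" and "\<And>i n. i \<in> I \<Longrightarrow> F i n \<in> L2 M" "\<And>i. i \<in> I \<Longrightarrow> f i \<in> L2 M"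
    "\<And>i. i \<in> I \<Longrightarrow> (\<lambda>n. L2_norm M (\<lambda>x. F i n x - f i x)) \<longlonglongrightarrow> 0"
  shows "\<exists>r. strict_mono r \<and> (\<forall>i\<in>I. AE x in M. (\<lambda>n. F i (r n) x) \<longlonglongrightarrow> f i x)"
  using assms
proof (induction I rule: finite_induct)
  case empty show ?case by (auto intro: exI[of _ id] simp: strict_mono_id)
next
  case (insert j I)
  obtain r where r: "strict_mono r" "\<forall>i\<in>I. AE x in M. (\<lambda>n. F i (r n) x) \<longlonglongrightarrow> f i x"
    using insert.IH insert.prems by blast
  have "(\<lambda>n. L2_norm M (\<lambda>x. F j (r n) x - f j x)) \<longlonglongrightarrow> 0"
    using LIMSEQ_subseq_LIMSEQ[OF insert.prems(3) r(1), of j] by (simp add: o_def)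
  with L2_AE_subseq[of "\<lambda>n. F j (r n)" M "f j"] insert.prems(1,2)
  obtain r' where r': "strict_mono r'" "AE x in M. (\<lambda>n. F j (r (r' n)) x) \<longlonglongrightarrow> f j x" by auto
  have "AE x in M. (\<lambda>n. F i ((r \<circ> r') n) x) \<longlonglongrightarrow> f i x" if "i \<in> insert j I" for i
  proof (cases "i = j")
    case False
    with that r(2) have "AE x in M. (\<lambda>n. F i (r n) x) \<longlonglongrightarrow> f i x" by auto
    then show ?thesis
      by eventually_elim (drule LIMSEQ_subseq_LIMSEQ[OF _ r'(1)], simp add: o_def)
  qed (use r' in \<open>simp add: o_def\<close>)
  then show ?case using strict_mono_o[OF r(1) r'(1)] by blast
qed

text \<open>
  The weight \<open>trunc K\<close> is the derivative of the bounded function \<open>s \<mapsto> - K\<^sup>2 / (K + s)\<close> and tends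
  to \<open>1\<close> as \<open>K\<close> grows. It truncates the nonlinearity in the proof that \<open>(v \<cdot> \<nabla>) u\<close> is orthogonal to \<open>u\<close>.
\<close>

definition trunc :: "real \<Rightarrow> real \<Rightarrow> real" where
  "trunc K s = (K / (K + s))\<^sup>2"

lemma trunc_bounds:
  assumes "K \<ge> 1" "s \<ge> 0"
  shows "0 \<le> trunc K s" "trunc K s \<le> 1" "y\<^sup>2 \<le> s \<Longrightarrow> \<bar>trunc K s * y\<bar> \<le> K"
proof -
  have q: "0 \<le> K / (K + s)" "K / (K + s) \<le> 1" using assms by (auto simp: divide_le_eq)
  show "0 \<le> trunc K s" by (simp add: trunc_def)
  show "trunc K s \<le> 1" unfolding trunc_def using q by (rule power_le_one)
  show "\<bar>trunc K s * y\<bar> \<le> K" if "y\<^sup>2 \<le> s"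
  proof -
    have "\<bar>y\<bar> \<le> 1 + y\<^sup>2"
    proof (cases "\<bar>y\<bar> \<le> 1")
      case False
      then have "\<bar>y\<bar> \<le> \<bar>y\<bar> ^ 2" by (intro self_le_power) auto
      then show ?thesis by simp
    qed (use zero_le_power2[of y] in linarith)
    then have y: "\<bar>y\<bar> \<le> K + s" using assms that by linarith
    have "\<bar>trunc K s * y\<bar> = (K / (K + s)) * ((K / (K + s)) * \<bar>y\<bar>)"
      using q by (simp add: trunc_def abs_mult power2_eq_square)
    also have "\<dots> \<le> 1 * ((K / (K + s)) * (K + s))"
      using q y by (intro mult_mono mult_left_mono mult_nonneg_nonneg) auto
    finally show ?thesis using assms by simp
  qed
qed

text \<open>Chain rule for \<open>- K^2 / (K + s)\<close> at the sum of squares \<open>s\<close>. As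
  \<open>K \<ge> 1\<close>, the denominator stays positive and the composition is smooth and
  periodic, hence an admissible test function for the divergence condition.\<close>

lemma smooth_trunc_primitive:
  fixes F :: "'i \<Rightarrow> scalar_field"
  assumes I: "finite I" and K: "K \<ge> 1" and F: "\<And>i. i \<in> I \<Longrightarrow> F i \<in> smooth_periodic L"
  obtains \<rho> where "\<rho> \<in> smooth_periodic L"
    "\<And>x. grad \<rho> x = (2 * trunc K (\<Sum>i\<in>I. (F i x)\<^sup>2)) *\<^sub>R (\<Sum>i\<in>I. F i x *\<^sub>R grad (F i) x)"
proof -
  have sF: "i \<in> I \<Longrightarrow> smooth (F i)" for i using F by (auto simp: smooth_periodic_def)
  define s where "s x = K + (\<Sum>i\<in>I. F i x * F i x)" for x
  have s_pos: "s x > 0" for x unfolding s_def using K by (intro add_pos_nonneg sum_nonneg) auto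
  have sm_s: "times_cont_diff k s" for k
    unfolding s_def using sF I
    by (intro times_cont_diff_add times_cont_diff_const times_cont_diff_sum times_cont_diff_mult) (auto simp: smooth_def)
  define \<rho> where "\<rho> x = (- K\<^sup>2) * inverse (s x)" for x
  have inv_s: "times_cont_diff k (\<lambda>x. inverse (s x))" for k
    using s_pos by (intro times_cont_diff_inverse sm_s) (metis less_irrefl)
  have "times_cont_diff k \<rho>" for k
    unfolding \<rho>_def by (rule times_cont_diff_mult[OF times_cont_diff_const inv_s])
  moreover have "\<rho> (x + axis j L) = \<rho> x" for x j
    using F exhaust_2[of j] unfolding \<rho>_def s_def by (auto simp: smooth_periodic_def periodic_in_def)
  ultimately have per: "\<rho> \<in> smooth_periodic L"
    by (simp add: smooth_periodic_def smooth_def periodic_in_def)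
  have dF: "(F i has_derivative frechet_derivative (F i) (at x)) (at x)" if "i \<in> I" for i x
    using smooth_differentiable[OF sF[OF that]] frechet_derivative_works by blast
  have "grad \<rho> x = (2 * trunc K (\<Sum>i\<in>I. (F i x)\<^sup>2)) *\<^sub>R (\<Sum>i\<in>I. F i x *\<^sub>R grad (F i) x)" for x
  proof -
    have "(s has_derivative (\<lambda>h. \<Sum>i\<in>I. 2 * F i x * frechet_derivative (F i) (at x) h)) (at x)"
      unfolding s_def
      by (auto intro!: derivative_eq_intros dF sum.cong simp: fun_eq_iff algebra_simps)
    then have "(\<rho> has_derivative (\<lambda>h. (K\<^sup>2 * (inverse (s x))\<^sup>2) * (\<Sum>i\<in>I. 2 * F i x * frechet_derivative (F i) (at x) h))) (at x)"
      unfolding \<rho>_def using s_pos[of x]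
      by (auto intro!: derivative_eq_intros simp: fun_eq_iff power2_eq_square algebra_simps)
    from partial_eqI[OF this]
    have p: "partial j \<rho> x = (K\<^sup>2 * (inverse (s x))\<^sup>2) * (\<Sum>i\<in>I. 2 * F i x * partial j (F i) x)" for j
      by (simp add: partial_def)
    have t: "trunc K (\<Sum>i\<in>I. (F i x)\<^sup>2) = K\<^sup>2 * (inverse (s x))\<^sup>2"
      by (simp add: trunc_def s_def power2_eq_square divide_inverse algebra_simps)
    have 2: "(\<Sum>i\<in>I. 2 * F i x * partial j (F i) x) = 2 * (\<Sum>i\<in>I. F i x * partial j (F i) x)" for j
      by (simp add: sum_distrib_left mult_ac)
    show ?thesis unfolding t vec_eq_iff by (simp add: p 2 sum_component)
  qed
  with per show thesis by (rule that)
qed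

text \<open>Formally the integrand is half of \<open>v\<close> times the gradient of the sum of
  squares, but that sum is not an admissible test function, and \<open>v\<close> is merely in L2.
  For smooth approximations a bounded function of the sum of squares is used instead; the
  approximation is removed at fixed truncation, and the truncation afterwards. Integrability is
  given for the sum over \<open>I\<close> only, so all components share one truncation factor, which
  can be pulled out of the sum.\<close>

lemma divergence_free_cancellation:
  fixes u :: "'i \<Rightarrow> scalar_field"
  assumes I: "finite I" and v: "v \<in> V0 L"
    and u: "\<And>i. i \<in> I \<Longrightarrow> has_grad L (smooth_periodic L) (u i) (G i)"
    and int: "integrable (square_measure L) (\<lambda>x. \<Sum>i\<in>I. u i x * (v x \<bullet> G i x))"
  shows "(\<integral>x. (\<Sum>i\<in>I. u i x * (v x \<bullet> G i x)) \<partial>square_measure L) = 0"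
proof -
  let ?M = "square_measure L"
  have vL2: "v \<in> L2 ?M" and div: "\<And>f. f \<in> smooth_periodic L \<Longrightarrow> L2_inner ?M v (grad f) = 0"
    using v by (auto simp: V0_def)
  have uL2: "i \<in> I \<Longrightarrow> u i \<in> L2 ?M" and GL2: "i \<in> I \<Longrightarrow> G i \<in> L2 ?M" for i
    using u by (auto simp: has_grad_def)
  have smp: "F \<in> smooth_periodic L \<Longrightarrow> smooth F" for F by (simp add: smooth_periodic_def)
  have "\<forall>i\<in>I. \<exists>F. (\<forall>n. F n \<in> smooth_periodic L) \<and>
      (\<lambda>n. L2_norm ?M (\<lambda>x. F n x - u i x)) \<longlonglongrightarrow> 0 \<and> (\<lambda>n. L2_norm ?M (\<lambda>x. grad (F n) x - G i x)) \<longlonglongrightarrow> 0"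
    using u unfolding has_grad_def by blast
  from bchoice[OF this] obtain F0 where "\<forall>i\<in>I. (\<forall>n. F0 i n \<in> smooth_periodic L) \<and>
      (\<lambda>n. L2_norm ?M (\<lambda>x. F0 i n x - u i x)) \<longlonglongrightarrow> 0 \<and> (\<lambda>n. L2_norm ?M (\<lambda>x. grad (F0 i n) x - G i x)) \<longlonglongrightarrow> 0"
    by blast
  then have F0: "\<And>i n. i \<in> I \<Longrightarrow> F0 i n \<in> smooth_periodic L"
      "\<And>i. i \<in> I \<Longrightarrow> (\<lambda>n. L2_norm ?M (\<lambda>x. F0 i n x - u i x)) \<longlonglongrightarrow> 0"
      "\<And>i. i \<in> I \<Longrightarrow> (\<lambda>n. L2_norm ?M (\<lambda>x. grad (F0 i n) x - G i x)) \<longlonglongrightarrow> 0"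
    by blast+
  have "\<exists>r. strict_mono r \<and> (\<forall>i\<in>I. AE x in ?M. (\<lambda>n. F0 i (r n) x) \<longlonglongrightarrow> u i x)"
    by (rule L2_AE_subseq_finite[OF I]) (auto intro: smooth_L2 smp F0 uL2)
  then obtain r where r: "strict_mono r" "\<And>i. i \<in> I \<Longrightarrow> AE x in ?M. (\<lambda>n. F0 i (r n) x) \<longlonglongrightarrow> u i x"
    by blast
  define F where "F i n = F0 i (r n)" for i n
  have F: "\<And>i n. i \<in> I \<Longrightarrow> F i n \<in> smooth_periodic L"
      "\<And>i. i \<in> I \<Longrightarrow> (\<lambda>n. L2_norm ?M (\<lambda>x. grad (F i n) x - G i x)) \<longlonglongrightarrow> 0"
      "\<And>i. i \<in> I \<Longrightarrow> AE x in ?M. (\<lambda>n. F i n x) \<longlonglongrightarrow> u i x"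
  proof -
    show "F i n \<in> smooth_periodic L" if "i \<in> I" for i n using F0(1)[OF that] by (simp add: F_def)
    show "(\<lambda>n. L2_norm ?M (\<lambda>x. grad (F i n) x - G i x)) \<longlonglongrightarrow> 0" if "i \<in> I" for i
      using LIMSEQ_subseq_LIMSEQ[OF F0(3)[OF that] r(1)] by (simp add: F_def o_def)
    show "AE x in ?M. (\<lambda>n. F i n x) \<longlonglongrightarrow> u i x" if "i \<in> I" for i
      using r(2)[OF that] by (simp add: F_def)
  qed
  have [measurable]: "v \<in> borel_measurable ?M" by (rule L2_measurable[OF vL2])
  have um [measurable]: "i \<in> I \<Longrightarrow> u i \<in> borel_measurable ?M" for i by (rule L2_measurable[OF uL2])
  have Gm [measurable]: "i \<in> I \<Longrightarrow> G i \<in> borel_measurable ?M" for i by (rule L2_measurable[OF GL2])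
  have Fm [measurable]: "i \<in> I \<Longrightarrow> F i n \<in> borel_measurable ?M" for i n
    by (rule L2_measurable[OF smooth_L2[OF smp[OF F(1)]]])
  have F_sq: "(F i n x)\<^sup>2 \<le> (\<Sum>i\<in>I. (F i n x)\<^sup>2)" if "i \<in> I" for i n x
    using member_le_sum[of i I "\<lambda>i. (F i n x)\<^sup>2"] that I by simp
  have u_sq: "(u i x)\<^sup>2 \<le> (\<Sum>i\<in>I. (u i x)\<^sup>2)" if "i \<in> I" for i x
    using member_le_sum[of i I "\<lambda>i. (u i x)\<^sup>2"] that I by simp
  \<comment> \<open>At a fixed level \<open>K\<close> all multipliers of \<open>v\<close> are
    bounded by \<open>K\<close>, which compensates for \<open>v\<close> being only in L2.\<close>
  have trunc0: "(\<integral>x. trunc K (\<Sum>i\<in>I. (u i x)\<^sup>2) * (\<Sum>i\<in>I. u i x * (v x \<bullet> G i x)) \<partial>?M) = 0" if K: "K \<ge> 1" for K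
  proof -
    define p where "p i n x = trunc K (\<Sum>i\<in>I. (F i n x)\<^sup>2) * F i n x" for i n x
    define q where "q i x = trunc K (\<Sum>i\<in>I. (u i x)\<^sup>2) * u i x" for i x
    have pb: "i \<in> I \<Longrightarrow> \<bar>p i n x\<bar> \<le> K" and qb: "i \<in> I \<Longrightarrow> \<bar>q i x\<bar> \<le> K" for i n x
      unfolding p_def q_def using F_sq u_sq by (auto intro!: trunc_bounds(3) K sum_nonneg)
    have pm [measurable]: "i \<in> I \<Longrightarrow> p i n \<in> borel_measurable ?M" for i n
      unfolding p_def trunc_def by measurable
    have qm [measurable]: "i \<in> I \<Longrightarrow> q i \<in> borel_measurable ?M" for i
      unfolding q_def trunc_def by measurable
    have pv: "(\<lambda>x. p i n x *\<^sub>R v x) \<in> L2 ?M" and pv_norm: "L2_norm ?M (\<lambda>x. p i n x *\<^sub>R v x) \<le> K * L2_norm ?M v"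
      if i: "i \<in> I" for i n
    proof -
      have le: "(norm (p i n x *\<^sub>R v x))\<^sup>2 \<le> K\<^sup>2 * (norm (v x))\<^sup>2" for x
        using power_mono[OF pb[OF i, of n x] abs_ge_zero, of 2]
        by (simp add: power_mult_distrib mult_right_mono)
      have intv: "integrable ?M (\<lambda>x. K\<^sup>2 * (norm (v x))\<^sup>2)"
        using L2_integrable_norm2[OF vL2] by simp
      have i2: "integrable ?M (\<lambda>x. (norm (p i n x *\<^sub>R v x))\<^sup>2)"
        by (rule Bochner_Integration.integrable_bound[OF intv]) (use le i in auto)
      then show "(\<lambda>x. p i n x *\<^sub>R v x) \<in> L2 ?M" using i by (simp add: L2_def)
      have "(L2_norm ?M (\<lambda>x. p i n x *\<^sub>R v x))\<^sup>2 = (\<integral>x. (norm (p i n x *\<^sub>R v x))\<^sup>2 \<partial>?M)"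
        by (simp only: L2_norm_power2 L2_inner_def power2_norm_eq_inner)
      also have "\<dots> \<le> (\<integral>x. K\<^sup>2 * (norm (v x))\<^sup>2 \<partial>?M)" by (rule integral_mono[OF i2 intv le])
      also have "\<dots> = (K * L2_norm ?M v)\<^sup>2"
        unfolding power_mult_distrib L2_norm_power2 by (simp add: L2_inner_def power2_norm_eq_inner)
      finally show "L2_norm ?M (\<lambda>x. p i n x *\<^sub>R v x) \<le> K * L2_norm ?M v"
        by (rule power2_le_imp_le) (use K in auto)
    qed
    have grads: "i \<in> I \<Longrightarrow> grad (F i n) \<in> L2 ?M" for i n by (intro smooth_grad_L2 smp F)
    \<comment> \<open>The gradient of the primitive is twice the sum of \<open>p i n\<close> times
      the gradient of \<open>F i n\<close>, so the divergence condition applies before any limit is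
      taken.\<close>
    have zero: "(\<Sum>i\<in>I. L2_inner ?M (\<lambda>x. p i n x *\<^sub>R v x) (grad (F i n))) = 0" for n
    proof -
      obtain \<rho> where \<rho>: "\<rho> \<in> smooth_periodic L"
        "\<And>x. grad \<rho> x = (2 * trunc K (\<Sum>i\<in>I. (F i n x)\<^sup>2)) *\<^sub>R (\<Sum>i\<in>I. F i n x *\<^sub>R grad (F i n) x)"
        using smooth_trunc_primitive[OF I K, of "\<lambda>i. F i n" L] F(1) by blast
      have "0 = L2_inner ?M v (\<lambda>x. grad \<rho> x)" using div[OF \<rho>(1)] by simp
      also have "\<dots> = L2_inner ?M v (\<lambda>x. 2 *\<^sub>R (\<Sum>i\<in>I. p i n x *\<^sub>R grad (F i n) x))"
        unfolding \<rho>(2) by (simp add: p_def scaleR_sum_right mult.assoc)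
      also have "\<dots> = 2 * (\<integral>x. (\<Sum>i\<in>I. (p i n x *\<^sub>R v x) \<bullet> grad (F i n) x) \<partial>?M)"
        unfolding L2_inner_scaleR_right by (simp add: L2_inner_def inner_sum_right mult.commute)
      also have "\<dots> = 2 * (\<Sum>i\<in>I. L2_inner ?M (\<lambda>x. p i n x *\<^sub>R v x) (grad (F i n)))"
        unfolding L2_inner_def
        by (subst Bochner_Integration.integral_sum) (rule L2_integrable_inner[OF pv grads], assumption+, rule refl)
      finally show ?thesis by simp
    qed
    have AEc: "AE x in ?M. \<forall>i\<in>I. (\<lambda>n. F i n x) \<longlonglongrightarrow> u i x"
      using F(3) I by (simp add: AE_ball_countable countable_finite)
    have AEp: "AE x in ?M. (\<lambda>n. p i n x * (v x \<bullet> G i x)) \<longlonglongrightarrow> q i x * (v x \<bullet> G i x)" if "i \<in> I" for i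
      using AEc
    proof eventually_elim
      case (elim x)
      have "K + (\<Sum>i\<in>I. (u i x)\<^sup>2) \<noteq> 0" using K sum_nonneg[of I "\<lambda>i. (u i x)\<^sup>2"] by auto
      then show ?case using elim that unfolding p_def q_def trunc_def
        by (intro tendsto_intros) auto
    qed
    \<comment> \<open>The gradient of \<open>F i n\<close> is split into \<open>G i\<close> and an
      error. Against \<open>G i\<close> the bounded multipliers converge almost everywhere and
      dominated convergence applies; the error tends to 0 in L2 and meets \<open>p i n\<close> times
      \<open>v\<close>, which is bounded in L2.\<close>
    have lim2: "(\<lambda>n. \<integral>x. p i n x * (v x \<bullet> G i x) \<partial>?M) \<longlonglongrightarrow> (\<integral>x. q i x * (v x \<bullet> G i x) \<partial>?M)" if i: "i \<in> I" for i
    proof (rule integral_dominated_convergence[OF _ _ _ AEp[OF i]])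
      show "integrable ?M (\<lambda>x. K * \<bar>v x \<bullet> G i x\<bar>)"
        using L2_integrable_inner[OF vL2 GL2[OF i]] by simp
      show "AE x in ?M. norm (p i n x * (v x \<bullet> G i x)) \<le> K * \<bar>v x \<bullet> G i x\<bar>" for n
        using pb[OF i] by (auto simp: abs_mult intro!: mult_right_mono)
      show "(\<lambda>x. q i x * (v x \<bullet> G i x)) \<in> borel_measurable ?M" using i by measurable
      show "(\<lambda>x. p i n x * (v x \<bullet> G i x)) \<in> borel_measurable ?M" for n using i by measurable
    qed
    have lim1: "(\<lambda>n. L2_inner ?M (\<lambda>x. p i n x *\<^sub>R v x) (\<lambda>x. grad (F i n) x - G i x)) \<longlonglongrightarrow> 0" if i: "i \<in> I" for i
    proof (rule Lim_null_comparison[OF always_eventually])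
      show "\<forall>n. norm (L2_inner ?M (\<lambda>x. p i n x *\<^sub>R v x) (\<lambda>x. grad (F i n) x - G i x))
          \<le> (K * L2_norm ?M v) * L2_norm ?M (\<lambda>x. grad (F i n) x - G i x)"
        unfolding real_norm_def
        by (intro allI order_trans[OF L2_Cauchy_Schwarz[OF pv[OF i] L2_diff[OF grads[OF i] GL2[OF i]]]]
            mult_right_mono[OF pv_norm[OF i] L2_norm_nonneg])
      show "(\<lambda>n. (K * L2_norm ?M v) * L2_norm ?M (\<lambda>x. grad (F i n) x - G i x)) \<longlonglongrightarrow> 0"
        using tendsto_mult[OF tendsto_const F(2)[OF i], of "K * L2_norm ?M v"] by simp
    qed
    have "(\<lambda>n. L2_inner ?M (\<lambda>x. p i n x *\<^sub>R v x) (grad (F i n))) \<longlonglongrightarrow> (\<integral>x. q i x * (v x \<bullet> G i x) \<partial>?M)" if i: "i \<in> I" for i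
    proof -
      have "L2_inner ?M (\<lambda>x. p i n x *\<^sub>R v x) (grad (F i n)) =
        L2_inner ?M (\<lambda>x. p i n x *\<^sub>R v x) (\<lambda>x. grad (F i n) x - G i x) + (\<integral>x. p i n x * (v x \<bullet> G i x) \<partial>?M)" for n
        by (simp add: L2_inner_diff_right[OF grads[OF i] GL2[OF i] pv[OF i]]) (simp add: L2_inner_def)
      then show ?thesis using tendsto_add[OF lim1[OF i] lim2[OF i]] by simp
    qed
    then have "(\<lambda>n. \<Sum>i\<in>I. L2_inner ?M (\<lambda>x. p i n x *\<^sub>R v x) (grad (F i n))) \<longlonglongrightarrow> (\<Sum>i\<in>I. \<integral>x. q i x * (v x \<bullet> G i x) \<partial>?M)"
      by (rule tendsto_sum)
    then have "(\<Sum>i\<in>I. \<integral>x. q i x * (v x \<bullet> G i x) \<partial>?M) = 0"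
      unfolding zero by (simp add: LIMSEQ_const_iff)
    moreover have "(\<Sum>i\<in>I. \<integral>x. q i x * (v x \<bullet> G i x) \<partial>?M) = (\<integral>x. (\<Sum>i\<in>I. q i x * (v x \<bullet> G i x)) \<partial>?M)"
    proof (rule Bochner_Integration.integral_sum[symmetric])
      fix i assume i: "i \<in> I"
      have K': "integrable ?M (\<lambda>x. K * (v x \<bullet> G i x))"
        using L2_integrable_inner[OF vL2 GL2[OF i]] by simp
      show "integrable ?M (\<lambda>x. q i x * (v x \<bullet> G i x))"
      proof (rule Bochner_Integration.integrable_bound[OF K'])
        show "AE x in ?M. norm (q i x * (v x \<bullet> G i x)) \<le> norm (K * (v x \<bullet> G i x))"
          using qb[OF i] K by (intro AE_I2) (simp add: abs_mult mult_right_mono)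
      qed (use i in measurable)
    qed
    ultimately show ?thesis by (simp add: q_def sum_distrib_left mult.assoc)
  qed
  \<comment> \<open>The truncation factor lies between 0 and 1, so the absolute value of the
    untruncated sum dominates; its integrability is \<open>int\<close>, which each step of the
    scheme supplies.\<close>
  have lim: "(\<lambda>m. \<integral>x. trunc (real (Suc m)) (\<Sum>i\<in>I. (u i x)\<^sup>2) * (\<Sum>i\<in>I. u i x * (v x \<bullet> G i x)) \<partial>?M)
     \<longlonglongrightarrow> (\<integral>x. (\<Sum>i\<in>I. u i x * (v x \<bullet> G i x)) \<partial>?M)"
  proof (rule integral_dominated_convergence[OF _ _ integrable_norm[OF int]])
    show "AE x in ?M. (\<lambda>m. trunc (real (Suc m)) (\<Sum>i\<in>I. (u i x)\<^sup>2) * (\<Sum>i\<in>I. u i x * (v x \<bullet> G i x)))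
       \<longlonglongrightarrow> (\<Sum>i\<in>I. u i x * (v x \<bullet> G i x))"
    proof (rule AE_I2)
      fix x
      let ?s = "\<Sum>i\<in>I. (u i x)\<^sup>2"
      have "(\<lambda>m. real (Suc m) / (real (Suc m) + ?s)) \<longlonglongrightarrow> 1"
      proof -
        have "(\<lambda>m. 1 / (1 + ?s * inverse (real (Suc m)))) \<longlonglongrightarrow> 1 / (1 + ?s * 0)"
          by (intro tendsto_intros LIMSEQ_inverse_real_of_nat) simp
        moreover have "1 / (1 + ?s * inverse (real (Suc m))) = real (Suc m) / (real (Suc m) + ?s)" for m
        proof -
          have "1 + ?s * inverse (real (Suc m)) = (real (Suc m) + ?s) / real (Suc m)"
            by (simp add: field_simps del: of_nat_Suc)
          then show ?thesis by simp
        qed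
        ultimately show ?thesis by simp
      qed
      then have "(\<lambda>m. trunc (real (Suc m)) ?s) \<longlonglongrightarrow> 1\<^sup>2"
        unfolding trunc_def by (rule tendsto_power)
      from tendsto_mult_right[OF this] show "(\<lambda>m. trunc (real (Suc m)) ?s * (\<Sum>i\<in>I. u i x * (v x \<bullet> G i x)))
       \<longlonglongrightarrow> (\<Sum>i\<in>I. u i x * (v x \<bullet> G i x))" by simp
    qed
    show "AE x in ?M. norm (trunc (real (Suc m)) (\<Sum>i\<in>I. (u i x)\<^sup>2) * (\<Sum>i\<in>I. u i x * (v x \<bullet> G i x)))
        \<le> norm (\<Sum>i\<in>I. u i x * (v x \<bullet> G i x))" for m
    proof (rule AE_I2)
      fix x
      have "0 \<le> trunc (real (Suc m)) (\<Sum>i\<in>I. (u i x)\<^sup>2)" "trunc (real (Suc m)) (\<Sum>i\<in>I. (u i x)\<^sup>2) \<le> 1"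
        by (intro trunc_bounds sum_nonneg; simp)+
      then show "norm (trunc (real (Suc m)) (\<Sum>i\<in>I. (u i x)\<^sup>2) * (\<Sum>i\<in>I. u i x * (v x \<bullet> G i x)))
        \<le> norm (\<Sum>i\<in>I. u i x * (v x \<bullet> G i x))"
        by (simp add: abs_mult mult_left_le_one_le)
    qed
    show "(\<lambda>x. \<Sum>i\<in>I. u i x * (v x \<bullet> G i x)) \<in> borel_measurable ?M" by measurable
    show "(\<lambda>x. trunc (real (Suc m)) (\<Sum>i\<in>I. (u i x)\<^sup>2) * (\<Sum>i\<in>I. u i x * (v x \<bullet> G i x))) \<in> borel_measurable ?M" for m
      unfolding trunc_def by measurable
  qed
  have "(\<integral>x. trunc (real (Suc m)) (\<Sum>i\<in>I. (u i x)\<^sup>2) * (\<Sum>i\<in>I. u i x * (v x \<bullet> G i x)) \<partial>?M) = 0" for m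
    by (rule trunc0) simp
  with lim show ?thesis by (simp add: LIMSEQ_const_iff)
qed

section \<open>Spectral bounds and Poincare inequalities\<close>

text \<open>Bessel's inequality for the gradients \<open>K j\<close> of the eigenfunctions, which
  are orthogonal with squared norms \<open>lam j\<close>. It bounds the spectral norm by the
  gradient norm; this is the direction called for, since the scheme dissipates the gradient norm
  while the energy is written with the spectral one.\<close>

lemma gradient_Bessel:
  fixes e :: "nat \<Rightarrow> 'a \<Rightarrow> 'b::euclidean_space" and K :: "nat \<Rightarrow> 'a \<Rightarrow> 'c::euclidean_space"
  assumes K: "\<And>j. K j \<in> L2 M" and G: "G \<in> L2 M" and lam: "\<And>j. lam j \<ge> 0"
    and GK: "\<And>j. L2_inner M G (K j) = lam j * L2_inner M u (e j)"
    and KK: "\<And>i j. L2_inner M (K i) (K j) = lam j * L2_inner M (e i) (e j)"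
    and e: "\<And>i j. L2_inner M (e i) (e j) = (if i = j then 1 else 0)"
  shows "summable (\<lambda>j. lam j * (L2_inner M u (e j))\<^sup>2)"
    and "(\<Sum>j. lam j * (L2_inner M u (e j))\<^sup>2) \<le> (L2_norm M G)\<^sup>2"
proof -
  have part: "(\<Sum>j<n. lam j * (L2_inner M u (e j))\<^sup>2) \<le> (L2_norm M G)\<^sup>2" for n
  proof -
    \<comment> \<open>For positive \<open>lam j\<close> this is also the Fourier coefficient of
      \<open>G\<close> along \<open>K j\<close>, so \<open>S\<close> below is the projection of
      \<open>G\<close> onto finitely many of the \<open>K j\<close>.\<close>
    define a where "a j = L2_inner M u (e j)" for j
    define S where "S x = (\<Sum>j<n. a j *\<^sub>R K j x)" for x
    have S: "S \<in> L2 M" unfolding S_def by (intro L2_sum L2_scaleR K)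
    have Sin: "L2_inner M S g = (\<Sum>j<n. a j * L2_inner M (K j) g)" if "g \<in> L2 M" for g
      unfolding S_def using that
      by (subst L2_inner_sum_left) (auto intro: L2_scaleR K simp: L2_inner_scaleR_left)
    have SK: "L2_inner M S (K i) = (if i < n then lam i * a i else 0)" for i
      unfolding Sin[OF K] KK e by (simp add: if_distrib mult.commute cong: if_cong)
    have SS: "(L2_norm M S)\<^sup>2 = (\<Sum>j<n. lam j * (a j)\<^sup>2)"
      unfolding L2_norm_power2 by (subst Sin[OF S], rule sum.cong)
         (simp_all add: L2_inner_commute[of M "K _" S] SK power2_eq_square)
    have SG: "L2_inner M G S = (\<Sum>j<n. lam j * (a j)\<^sup>2)"
      unfolding L2_inner_commute[of M G S] Sin[OF G]
      by (simp add: L2_inner_commute[of M "K _" G] GK a_def power2_eq_square mult_ac)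
    have "0 \<le> (L2_norm M (\<lambda>x. G x - S x))\<^sup>2" by simp
    then show ?thesis
      unfolding L2_norm_diff_power2[OF G S] SG SS by (simp add: a_def)
  qed
  show "summable (\<lambda>j. lam j * (L2_inner M u (e j))\<^sup>2)"
    by (rule summableI_nonneg_bounded[OF _ part]) (use lam in auto)
  then show "(\<Sum>j. lam j * (L2_inner M u (e j))\<^sup>2) \<le> (L2_norm M G)\<^sup>2"
    by (rule suminf_le_const[OF _ part])
qed

lemma power_norm_half:
  assumes "\<And>j. lam j > 0" "summable (\<lambda>j. lam j * (L2_inner M u (e j))\<^sup>2)"
  shows "(power_norm M lam e (1/2) u)\<^sup>2 = (\<Sum>j. lam j * (L2_inner M u (e j))\<^sup>2)"
proof -
  have "(lam j powr (1/2) * L2_inner M u (e j))\<^sup>2 = lam j * (L2_inner M u (e j))\<^sup>2" for j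
    using assms(1)[of j] by (simp add: power_mult_distrib powr_half_sqrt)
  then show ?thesis
    unfolding power_norm_def using assms by (simp add: suminf_nonneg less_imp_le)
qed

text \<open>Termwise comparison with Parseval's series, as the eigenvalues increase from
  \<open>lam 0\<close>.\<close>

lemma spectral_Poincare:
  assumes co: "complete_orthonormal M X e" and X: "X \<subseteq> L2 M" and u: "u \<in> X" and lam: "mono lam" "lam 0 > 0"
    and sm: "summable (\<lambda>j. lam j * (L2_inner M u (e j))\<^sup>2)"
  shows "lam 0 * (L2_norm M u)\<^sup>2 \<le> (\<Sum>j. lam j * (L2_inner M u (e j))\<^sup>2)"
proof -
  note P = L2_Parseval[OF co X u]
  have "(\<lambda>j. lam 0 * (L2_inner M u (e j))\<^sup>2) sums (lam 0 * (L2_norm M u)\<^sup>2)" by (rule sums_mult[OF P])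
  then show ?thesis
    by (rule sums_le[OF _ _ summable_sums[OF sm], rotated])
       (use lam in \<open>auto intro!: mult_right_mono simp: monoD\<close>)
qed

lemma spectral_pos:
  fixes lam :: "nat \<Rightarrow> real"
  shows "mono lam \<Longrightarrow> lam 0 > 0 \<Longrightarrow> lam j > 0"
  by (metis monoD less_le_trans le0)

lemma V0_L2: "V0 L \<subseteq> L2 (square_measure L)"
  by (auto simp: V0_def)

text \<open>The weak form of the eigenvalue equation provides the pairings in Bessel's inequality,
  once with the gradient of \<open>u\<close> and once with the gradients of the eigenfunctions
  themselves.\<close>

lemma velocity_gradient_bounds:
  assumes L: "L > 0" and lam: "mono lam" "lam 0 > 0"
    and st: "\<And>j. stokes L (\<zeta> j) (\<lambda>x. lam j *\<^sub>R \<zeta> j x)"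
    and co: "complete_orthonormal (square_measure L) (V0 L) \<zeta>"
    and u: "u \<in> V0 L" and G: "has_grad_vel L u G"
  shows "(power_norm (square_measure L) lam \<zeta> (1/2) u)\<^sup>2 \<le> (L2_norm (square_measure L) G)\<^sup>2"
    and "lam 0 * (L2_norm (square_measure L) u)\<^sup>2 \<le> (power_norm (square_measure L) lam \<zeta> (1/2) u)\<^sup>2"
proof -
  let ?M = "square_measure L"
  note pos = spectral_pos[OF lam]
  have L2G: "has_grad_vel L w H \<Longrightarrow> H \<in> L2 ?M" for w H
    by (rule L2_vec) (simp add: has_grad_vel_def has_grad_def)
  have "\<exists>K. has_grad_vel L (\<zeta> j) K \<and> (\<forall>u G. u \<in> V0 L \<longrightarrow> has_grad_vel L u G \<longrightarrow>
      L2_inner ?M G K = lam j * L2_inner ?M u (\<zeta> j))" for j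
    by (rule stokes_weak[OF less_imp_le[OF L] st[of j]]) blast
  then obtain K where K: "\<And>j. has_grad_vel L (\<zeta> j) (K j)"
    "\<And>j u G. u \<in> V0 L \<Longrightarrow> has_grad_vel L u G \<Longrightarrow> L2_inner ?M G (K j) = lam j * L2_inner ?M u (\<zeta> j)"
    by metis
  have z: "\<zeta> j \<in> V0 L" for j using co by (simp add: complete_orthonormal_def)
  have e: "L2_inner ?M (\<zeta> i) (\<zeta> j) = (if i = j then 1 else 0)" for i j
    using co unfolding complete_orthonormal_def by blast
  note B = gradient_Bessel[where K = K and M = ?M and lam = lam, OF L2G[OF K(1)] L2G[OF G] less_imp_le[OF pos] K(2)[OF u G] K(2)[OF z K(1)] e]
  show "(power_norm ?M lam \<zeta> (1/2) u)\<^sup>2 \<le> (L2_norm ?M G)\<^sup>2"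
    unfolding power_norm_half[OF pos B(1)] by (rule B(2))
  show "lam 0 * (L2_norm ?M u)\<^sup>2 \<le> (power_norm ?M lam \<zeta> (1/2) u)\<^sup>2"
    unfolding power_norm_half[OF pos B(1)] by (rule spectral_Poincare[OF co V0_L2 u lam B(1)])
qed

lemma temperature_Poincare:
  assumes L: "L > 0" and lam: "mono lam" "lam 0 > 0"
    and st: "\<And>j. temp_op L (\<zeta> j) (\<lambda>x. lam j *\<^sub>R \<zeta> j x)"
    and co: "complete_orthonormal (square_measure L) (H0 L) \<zeta>"
    and g: "has_grad_temp L \<theta> g"
  shows "lam 0 * (L2_norm (square_measure L) \<theta>)\<^sup>2 \<le> (L2_norm (square_measure L) g)\<^sup>2"
proof -
  let ?M = "square_measure L"
  note pos = spectral_pos[OF lam]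
  have L2g: "has_grad_temp L w k \<Longrightarrow> k \<in> L2 ?M" for w k
    by (simp add: has_grad_temp_def has_grad_def)
  have \<theta>: "\<theta> \<in> L2 ?M" using g by (simp add: has_grad_temp_def has_grad_def)
  have "\<exists>K. has_grad_temp L (\<zeta> j) K \<and> (\<forall>u G. has_grad_temp L u G \<longrightarrow>
      L2_inner ?M G K = lam j * L2_inner ?M u (\<zeta> j))" for j
    by (rule temp_op_weak[OF less_imp_le[OF L] st[of j]]) blast
  then obtain K where K: "\<And>j. has_grad_temp L (\<zeta> j) (K j)"
    "\<And>j u G. has_grad_temp L u G \<Longrightarrow> L2_inner ?M G (K j) = lam j * L2_inner ?M u (\<zeta> j)"
    by metis
  have e: "L2_inner ?M (\<zeta> i) (\<zeta> j) = (if i = j then 1 else 0)" for i j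
    using co unfolding complete_orthonormal_def by blast
  note B = gradient_Bessel[where K = K and M = ?M and lam = lam, OF L2g[OF K(1)] L2g[OF g] less_imp_le[OF pos] K(2)[OF g] K(2)[OF K(1)] e]
  show ?thesis
    using spectral_Poincare[OF co order_refl \<theta> lam B(1)] B(2) by linarith
qed

section \<open>Energy estimates of one step\<close>

text \<open>Twice the product of \<open>u - v\<close> with \<open>u\<close> is the difference of the
  squared norms plus the squared norm of \<open>u - v\<close>. The last term absorbs twice the
  product of \<open>dW\<close> with \<open>u - v\<close>, up to the squared norm of
  \<open>dW\<close>, which replaces \<open>u\<close> by the earlier iterate \<open>v\<close> in the
  noise term.\<close>

lemma scheme_energy_identity:
  fixes u v :: "'a \<Rightarrow> 'b::euclidean_space"
  assumes "u \<in> L2 M" "v \<in> L2 M" "dW \<in> L2 M"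
    and "L2_inner M (\<lambda>x. u x - v x) u + D = r + L2_inner M dW u"
  shows "(L2_norm M u)\<^sup>2 + 2 * D \<le> (L2_norm M v)\<^sup>2 + 2 * r + 2 * L2_inner M dW v + (L2_norm M dW)\<^sup>2"
proof -
  have 1: "(L2_norm M (\<lambda>x. u x - v x))\<^sup>2 = (L2_norm M u)\<^sup>2 - 2 * L2_inner M u v + (L2_norm M v)\<^sup>2"
    using assms by (intro L2_norm_diff_power2)
  have 2: "L2_inner M (\<lambda>x. u x - v x) u = (L2_norm M u)\<^sup>2 - L2_inner M u v"
    using assms by (simp add: L2_inner_diff_left L2_norm_power2 L2_inner_commute[of M v])
  have "0 \<le> (L2_norm M (\<lambda>x. (u x - v x) - dW x))\<^sup>2" by simp
  also have "\<dots> = (L2_norm M (\<lambda>x. u x - v x))\<^sup>2 - 2 * L2_inner M (\<lambda>x. u x - v x) dW + (L2_norm M dW)\<^sup>2"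
    using assms by (intro L2_norm_diff_power2 L2_diff)
  also have "L2_inner M (\<lambda>x. u x - v x) dW = L2_inner M dW u - L2_inner M dW v"
    using assms by (subst L2_inner_commute) (simp add: L2_inner_diff_right)
  finally have 3: "0 \<le> (L2_norm M (\<lambda>x. u x - v x))\<^sup>2 - 2 * (L2_inner M dW u - L2_inner M dW v) + (L2_norm M dW)\<^sup>2" .
  have "a + 2 * D \<le> c + 2 * r + 2 * y + w"
    if "0 \<le> d - 2 * (x - y) + w" "d = a - 2 * b + c" "e = a - b" "e + D = r + x" for a b c d e x y w :: real
    using that by argo
  from this[OF 3 1 2 assms(4)] show ?thesis .
qed

text \<open>The dissipation is twice \<open>h * \<nu>\<close> times the squared gradient norm. One
  copy becomes the spectral term on the left. By the Poincare inequality the other is at least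
  \<open>h * \<nu> * lam 0\<close> times the squared norm of \<open>u\<close>: half of this is spent
  on Young's inequality for the buoyancy, half is kept as damping.\<close>

lemma velocity_step_energy:
  assumes L: "L > 0" and lam: "mono lam" "lam 0 > 0"
    and st: "\<And>j. stokes L (\<zeta> j) (\<lambda>x. lam j *\<^sub>R \<zeta> j x)"
    and co: "complete_orthonormal (square_measure L) (V0 L) \<zeta>"
    and h: "h \<ge> 0" and nu: "\<nu> > 0" and v: "v \<in> V0 L" and th: "th \<in> L2 (square_measure L)"
    and dW: "dW \<in> L2 (square_measure L)" and step: "velocity_step L h \<nu> v th dW u"
  shows "(L2_norm (square_measure L) u)\<^sup>2 + h * \<nu> * (power_norm (square_measure L) lam \<zeta> (1/2) u)\<^sup>2 + h * (\<nu> * lam 0 / 2) * (L2_norm (square_measure L) u)\<^sup>2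
    \<le> (L2_norm (square_measure L) v)\<^sup>2 + (2 * L2_inner (square_measure L) dW v + (L2_norm (square_measure L) dW)\<^sup>2)
      + h * (2 / (\<nu> * lam 0)) * (L2_norm (square_measure L) th)\<^sup>2"
proof -
  let ?M = "square_measure L"
  obtain G p where u1: "u \<in> V1 L" and G: "has_grad_vel L u G" and p: "leray L (\<lambda>x. th x *\<^sub>R axis 2 1) p"
    and eq: "\<And>\<phi> K. \<phi> \<in> V1 L \<Longrightarrow> has_grad_vel L \<phi> K \<Longrightarrow>
          integrable ?M (\<lambda>x. (G x *v v x) \<bullet> \<phi> x) \<and>
          L2_inner ?M (\<lambda>x. u x - v x) \<phi> + h * \<nu> * L2_inner ?M G K + h * L2_inner ?M (\<lambda>x. G x *v v x) \<phi>
          = h * L2_inner ?M p \<phi> + L2_inner ?M dW \<phi>"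
    using step unfolding velocity_step_def by blast
  have u: "u \<in> V0 L" using u1 by (simp add: V1_def)
  have uL2: "u \<in> L2 ?M" and vL2: "v \<in> L2 ?M" using u v V0_L2 by auto
  have eqi: "(G x *v v x) \<bullet> u x = (\<Sum>i\<in>UNIV. u x $ i * (v x \<bullet> G x $ i))" for x
    by (simp add: inner_vec_def matrix_vector_mult_def mult_ac)
  have "L2_inner ?M (\<lambda>x. G x *v v x) u = 0"
    unfolding L2_inner_def eqi
    by (rule divergence_free_cancellation[OF _ v])
       (use G eq[OF u1 G] in \<open>auto simp: has_grad_vel_def eqi\<close>)
  with eq[OF u1 G] have e: "L2_inner ?M (\<lambda>x. u x - v x) u + h * \<nu> * (L2_norm ?M G)\<^sup>2 = h * L2_inner ?M p u + L2_inner ?M dW u"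
    unfolding L2_norm_power2 by simp
  have pu: "L2_inner ?M p u \<le> L2_norm ?M th * L2_norm ?M u"
  proof -
    have q: "(\<lambda>x. th x *\<^sub>R (axis 2 1 :: real^2)) \<in> L2 ?M" "p \<in> L2 ?M" using p V0_L2 by (auto simp: leray_def)
    have "L2_inner ?M (\<lambda>x. th x *\<^sub>R axis 2 1 - p x) u = 0" using p u by (simp add: leray_def)
    then have "L2_inner ?M p u = L2_inner ?M (\<lambda>x. th x *\<^sub>R axis 2 1) u"
      using L2_inner_diff_left[OF q uL2] by simp
    also have "\<dots> \<le> L2_norm ?M (\<lambda>x. th x *\<^sub>R (axis 2 1 :: real^2)) * L2_norm ?M u"
      using L2_Cauchy_Schwarz[OF q(1) uL2] by simp
    also have "L2_norm ?M (\<lambda>x. th x *\<^sub>R (axis 2 1 :: real^2)) = L2_norm ?M th"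
      by (simp add: L2_norm_def L2_inner_def inner_axis_axis)
    finally show ?thesis .
  qed
  have lp: "\<nu> * lam 0 > 0" using nu lam by simp
  have young: "2 * (L2_norm ?M th * L2_norm ?M u) \<le> (\<nu> * lam 0 / 2) * (L2_norm ?M u)\<^sup>2 + (2 / (\<nu> * lam 0)) * (L2_norm ?M th)\<^sup>2"
  proof -
    have "0 \<le> (\<nu> * lam 0 / 2) * (L2_norm ?M u - (2 / (\<nu> * lam 0)) * L2_norm ?M th)\<^sup>2" using lp by simp
    also have "\<dots> = (\<nu> * lam 0 / 2) * (L2_norm ?M u)\<^sup>2 - 2 * (L2_norm ?M th * L2_norm ?M u) + (2 / (\<nu> * lam 0)) * (L2_norm ?M th)\<^sup>2"
      using nu lam by (simp add: power2_eq_square field_simps)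
    finally show ?thesis by linarith
  qed
  have hy: "2 * (h * L2_inner ?M p u) \<le> h * ((\<nu> * lam 0 / 2) * (L2_norm ?M u)\<^sup>2 + (2 / (\<nu> * lam 0)) * (L2_norm ?M th)\<^sup>2)"
    using mult_left_mono[OF order_trans[OF mult_left_mono[OF pu, of 2] young] h] by (simp add: mult_ac)
  note gb = velocity_gradient_bounds[OF L lam st co u G]
  have g: "h * \<nu> * (power_norm ?M lam \<zeta> (1/2) u)\<^sup>2 \<le> h * \<nu> * (L2_norm ?M G)\<^sup>2"
    "h * \<nu> * (lam 0 * (L2_norm ?M u)\<^sup>2) \<le> h * \<nu> * (power_norm ?M lam \<zeta> (1/2) u)\<^sup>2"
    using gb h nu by (intro mult_left_mono; simp)+
  have "(L2_norm ?M u)\<^sup>2 + 2 * (h * \<nu> * (L2_norm ?M G)\<^sup>2) \<le> (L2_norm ?M v)\<^sup>2 + 2 * (h * L2_inner ?M p u) + 2 * L2_inner ?M dW v + (L2_norm ?M dW)\<^sup>2"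
    by (rule scheme_energy_identity[OF uL2 vL2 dW e])
  with hy g show ?thesis by (simp add: algebra_simps)
qed

text \<open>No force acts besides the noise, so the whole dissipation is turned into damping by the
  Poincare inequality.\<close>

lemma temperature_step_energy:
  assumes L: "L > 0" and lam: "mono lam" "lam 0 > 0"
    and st: "\<And>j. temp_op L (\<zeta> j) (\<lambda>x. lam j *\<^sub>R \<zeta> j x)"
    and co: "complete_orthonormal (square_measure L) (H0 L) \<zeta>"
    and h: "h \<ge> 0" and kap: "\<kappa> > 0" and v: "v \<in> V0 L" and th: "th \<in> L2 (square_measure L)"
    and dW: "dW \<in> L2 (square_measure L)" and step: "temperature_step L lam \<zeta> h \<kappa> v th dW \<theta>"
  shows "(L2_norm (square_measure L) \<theta>)\<^sup>2 + h * (2 * \<kappa> * lam 0) * (L2_norm (square_measure L) \<theta>)\<^sup>2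
    \<le> (L2_norm (square_measure L) th)\<^sup>2 + (2 * L2_inner (square_measure L) dW th + (L2_norm (square_measure L) dW)\<^sup>2)"
proof -
  let ?M = "square_measure L"
  obtain g where H: "\<theta> \<in> H1 L lam \<zeta>" and g: "has_grad_temp L \<theta> g"
    and eq: "\<And>\<psi> k. \<psi> \<in> H1 L lam \<zeta> \<Longrightarrow> has_grad_temp L \<psi> k \<Longrightarrow>
          integrable ?M (\<lambda>x. (v x \<bullet> g x) * \<psi> x) \<and>
          L2_inner ?M (\<lambda>x. \<theta> x - th x) \<psi> + h * \<kappa> * L2_inner ?M g k
            + h * L2_inner ?M (\<lambda>x. v x \<bullet> g x) \<psi> = L2_inner ?M dW \<psi>"
    using step unfolding temperature_step_def by blast
  have \<theta>: "\<theta> \<in> L2 ?M" using g by (simp add: has_grad_temp_def has_grad_def)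
  \<comment> \<open>The scalar case of the cancellation uses a one-element index set, after
    \<open>\<theta>\<close> has been made periodic.\<close>
  have "(\<integral>x. (\<Sum>i\<in>{()}. \<theta> x * (v x \<bullet> g x)) \<partial>?M) = 0"
    by (rule divergence_free_cancellation[OF _ v])
       (use eq[OF H g] has_grad_temp_periodic[OF L g] in \<open>auto simp: mult.commute\<close>)
  then have "L2_inner ?M (\<lambda>x. v x \<bullet> g x) \<theta> = 0"
    by (simp add: L2_inner_def mult.commute)
  with eq[OF H g] have e: "L2_inner ?M (\<lambda>x. \<theta> x - th x) \<theta> + h * \<kappa> * (L2_norm ?M g)\<^sup>2 = 0 + L2_inner ?M dW \<theta>"
    unfolding L2_norm_power2 by simp
  have "h * \<kappa> * (lam 0 * (L2_norm ?M \<theta>)\<^sup>2) \<le> h * \<kappa> * (L2_norm ?M g)\<^sup>2"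
    using temperature_Poincare[OF L lam st co g] h kap by (intro mult_left_mono) auto
  with scheme_energy_identity[OF \<theta> th dW e] show ?thesis
    by (simp add: algebra_simps)
qed

section \<open>Exponential estimates for the noise\<close>

text \<open>Completing the square with \<open>r = 1 - 2 * b * h\<close> gives the exact value
  \<open>exp (a^2 * h / (2 * r)) / sqrt r\<close>. The first subtracted term beats the exponential
  because \<open>r \<ge> 1 - \<eta>\<close>, the second beats \<open>1 / sqrt r\<close>. One
  \<open>\<eta>\<close> serves all modes of the noise, whatever their individual
  \<open>b\<close>.\<close>

lemma nn_integral_Gaussian_exp_quadratic:
  assumes h: "h > 0" and b: "0 \<le> b" and eta: "2 * b * h \<le> \<eta>" "\<eta> \<le> 1/2"
  shows "(\<integral>\<^sup>+x. ennreal (exp (a * x + b * x\<^sup>2 - (a\<^sup>2 * h / (2 * (1 - \<eta>)) + 2 * b * h)))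
           * ennreal (normal_density 0 (sqrt h) x) \<partial>lborel) \<le> 1"
proof -
  define r where "r = 1 - 2 * b * h"
  have r: "1 - \<eta> \<le> r" "r \<le> 1" "0 < r" "1/2 \<le> r" using assms by (auto simp: r_def)
  define \<sigma> where "\<sigma> = sqrt (h / r)"
  define m where "m = a * h / r"
  have \<sigma>: "\<sigma> > 0" "\<sigma>\<^sup>2 = h / r" using h r by (auto simp: \<sigma>_def)
  have gauss: "exp (a * x + b * x\<^sup>2) * normal_density 0 (sqrt h) x
      = (exp (a\<^sup>2 * h / (2 * r)) / sqrt r) * normal_density m \<sigma> x" for x
  proof -
    have e: "a * x + b * x\<^sup>2 - x\<^sup>2 / (2 * h) = a\<^sup>2 * h / (2 * r) - (x - m)\<^sup>2 / (2 * \<sigma>\<^sup>2)"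
    proof -
      have "(x - m)\<^sup>2 / (2 * \<sigma>\<^sup>2) = (x - a * h / r)\<^sup>2 * r / (2 * h)" by (simp add: \<sigma>(2) m_def)
      also have "\<dots> = x\<^sup>2 * r / (2 * h) - a * x + a\<^sup>2 * h / (2 * r)"
        using h r(3) by (simp add: field_simps power2_eq_square)
      also have "x\<^sup>2 * r / (2 * h) = x\<^sup>2 / (2 * h) - b * x\<^sup>2"
        using h by (simp add: r_def field_simps)
      finally show ?thesis by simp
    qed
    have s: "sqrt (2 * pi * \<sigma>\<^sup>2) * sqrt r = sqrt (2 * pi * h)"
      unfolding \<sigma>(2) real_sqrt_mult[symmetric] using r by simp
    have nz: "sqrt r > 0" "sqrt (2 * pi * \<sigma>\<^sup>2) > 0" using r(3) \<sigma>(1) by auto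
    have "exp (a * x + b * x\<^sup>2) * normal_density 0 (sqrt h) x = exp (a * x + b * x\<^sup>2 - x\<^sup>2 / (2 * h)) / sqrt (2 * pi * h)"
    proof -
      have "normal_density 0 (sqrt h) x = exp (- (x\<^sup>2 / (2 * h))) / sqrt (2 * pi * h)"
        using h by (simp add: normal_density_def)
      moreover have "exp (a * x + b * x\<^sup>2 - x\<^sup>2 / (2 * h)) = exp (a * x + b * x\<^sup>2) * exp (- (x\<^sup>2 / (2 * h)))"
        by (simp only: exp_add[symmetric] diff_conv_add_uminus)
      ultimately show ?thesis by simp
    qed
    also have "\<dots> = exp (a\<^sup>2 * h / (2 * r)) * exp (- (x - m)\<^sup>2 / (2 * \<sigma>\<^sup>2)) / (sqrt (2 * pi * \<sigma>\<^sup>2) * sqrt r)"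
      unfolding e s by (simp only: exp_add[symmetric] diff_conv_add_uminus minus_divide_left)
    also have "\<dots> = (exp (a\<^sup>2 * h / (2 * r)) / sqrt r) * normal_density m \<sigma> x"
      using nz by (simp add: normal_density_def)
    finally show ?thesis .
  qed
  define c where "c = exp (a\<^sup>2 * h / (2 * r)) / sqrt r * exp (- (a\<^sup>2 * h / (2 * (1 - \<eta>)) + 2 * b * h))"
  have c: "0 \<le> c" "c \<le> 1"
  proof -
    show "0 \<le> c" using r by (simp add: c_def)
    \<comment> \<open>Since \<open>y \<le> 1/2\<close>,
      \<open>(1 - y) * (1 + 2 * y) = 1 + y * (1 - 2 * y) \<ge> 1\<close>, hence
      \<open>1 / sqrt (1 - y) \<le> exp y\<close>.\<close>
    define y where "y = 2 * b * h"
    have y: "0 \<le> y" "y \<le> 1/2" "r = 1 - y" using assms by (auto simp: y_def r_def)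
    have "1 \<le> r * (1 + 2 * y)"
      unfolding y(3) using y(1,2) mult_nonneg_nonneg[of y "1 - 2 * y"] by (simp add: algebra_simps)
    also have "\<dots> \<le> r * exp (2 * y)" using r by (intro mult_left_mono) auto
    finally have "1 \<le> sqrt (r * exp (2 * y))" by simp
    also have "\<dots> = sqrt r * exp y"
      by (simp add: real_sqrt_mult exp_double)
    finally have 1: "1 / sqrt r \<le> exp y" using r by (simp add: divide_le_eq mult.commute)
    have 2: "a\<^sup>2 * h / (2 * r) \<le> a\<^sup>2 * h / (2 * (1 - \<eta>))"
      using r h eta by (intro divide_left_mono) auto
    have "c = (exp (a\<^sup>2 * h / (2 * r)) * exp (- (a\<^sup>2 * h / (2 * (1 - \<eta>))))) * (1 / sqrt r * exp (- y))"
      unfolding c_def y_def[symmetric] minus_add_distrib exp_add by (simp only: mult_ac times_divide_eq_left times_divide_eq_right mult_1 mult_1_right)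
    also have "\<dots> \<le> 1 * (exp y * exp (- y))"
      using 1 2 r by (intro mult_mono) (auto simp: exp_add[symmetric])
    finally show "c \<le> 1" by (simp add: exp_add[symmetric])
  qed
  have "(\<integral>\<^sup>+x. ennreal (exp (a * x + b * x\<^sup>2 - (a\<^sup>2 * h / (2 * (1 - \<eta>)) + 2 * b * h)))
           * ennreal (normal_density 0 (sqrt h) x) \<partial>lborel)
     = (\<integral>\<^sup>+x. ennreal c * ennreal (normal_density m \<sigma> x) \<partial>lborel)"
  proof (rule nn_integral_cong)
    fix x
    have "exp (a * x + b * x\<^sup>2 - (a\<^sup>2 * h / (2 * (1 - \<eta>)) + 2 * b * h)) * normal_density 0 (sqrt h) x
      = (exp (a * x + b * x\<^sup>2) * normal_density 0 (sqrt h) x) * exp (- (a\<^sup>2 * h / (2 * (1 - \<eta>)) + 2 * b * h))"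
      by (simp only: exp_add diff_conv_add_uminus mult_ac)
    also have "\<dots> = c * normal_density m \<sigma> x" unfolding gauss c_def by simp
    finally show "ennreal (exp (a * x + b * x\<^sup>2 - (a\<^sup>2 * h / (2 * (1 - \<eta>)) + 2 * b * h)))
           * ennreal (normal_density 0 (sqrt h) x) = ennreal c * ennreal (normal_density m \<sigma> x)"
      using c by (simp add: ennreal_mult[symmetric] normal_density_nonneg)
  qed
  also have "\<dots> = ennreal c * (\<integral>\<^sup>+x. ennreal (normal_density m \<sigma> x) \<partial>lborel)"
    by (rule nn_integral_cmult) simp
  also have "(\<integral>\<^sup>+x. ennreal (normal_density m \<sigma> x) \<partial>lborel) = 1"
    using prob_space.emeasure_space_1[OF prob_space_normal_density[OF \<sigma>(1), of m]]
    by (simp add: emeasure_density)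
  finally show ?thesis using c by (simp add: ennreal_le_1)
qed

section \<open>Integrating out independent increments\<close>

lemma Int_stable_events_of: "Int_stable (events_of P X)"
proof (rule Int_stableI)
  fix A B assume "A \<in> events_of P X" "B \<in> events_of P X"
  then obtain a b where "a \<in> sets borel" "b \<in> sets borel" "A = X -` a \<inter> space P" "B = X -` b \<inter> space P"
    by (auto simp: events_of_def)
  then show "A \<inter> B \<in> events_of P X"
    unfolding events_of_def by (intro CollectI exI[of _ "a \<inter> b"]) auto
qed

text \<open>Replaces conditioning on the past: \<open>Y\<close> and \<open>a\<close> are functions
  of the past, \<open>\<xi>\<close> is independent of it, so the integral over \<open>\<xi>\<close>
  may be taken with \<open>a\<close> frozen, and it is at most 1.\<close>

lemma (in prob_space) nn_integral_freezing:
  assumes G: "subalgebra M G" and ind: "indep_set (sets G) (events_of M \<xi>)"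
    and d: "distributed M lborel \<xi> (\<lambda>x. ennreal (D x))"
    and Y [measurable]: "Y \<in> borel_measurable G" and a [measurable]: "a \<in> borel_measurable G"
    and f [measurable]: "(\<lambda>(a, x). f a x) \<in> borel_measurable (borel \<Otimes>\<^sub>M borel)"
    and le: "\<And>a :: real. (\<integral>\<^sup>+x. f a x * ennreal (D x) \<partial>lborel) \<le> 1"
  shows "(\<integral>\<^sup>+w. Y w * f (a w) (\<xi> w) \<partial>M) \<le> (\<integral>\<^sup>+w. Y w \<partial>M)"
proof -
  have sp: "space G = space M" using G by (simp add: subalgebra_def)
  have \<xi> [measurable]: "\<xi> \<in> borel_measurable M" using distributed_measurable[OF d] by simp
  have id [measurable]: "(\<lambda>w. w) \<in> M \<rightarrow>\<^sub>M G" by (rule measurable_from_subalg[OF G]) simp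
  have dist: "distr M lborel \<xi> = density lborel (\<lambda>x. ennreal (D x))"
    by (rule distributed_distr_eq_density[OF d])
  have Dm [measurable]: "(\<lambda>x. ennreal (D x)) \<in> borel_measurable lborel"
    by (rule distributed_borel_measurable[OF d])
  interpret \<xi>: prob_space "distr M lborel \<xi>" by (rule prob_space_distr) simp
  \<comment> \<open>Independence in the form used: the sample point seen through \<open>G\<close>,
    paired with \<open>\<xi>\<close>, has a product law.\<close>
  have prod: "distr M G (\<lambda>w. w) \<Otimes>\<^sub>M distr M lborel \<xi> = distr M (G \<Otimes>\<^sub>M lborel) (\<lambda>w. (w, \<xi> w))"
  proof (rule pair_measure_eqI)
    show "sigma_finite_measure (distr M G (\<lambda>w. w))"
      by (intro prob_space_imp_sigma_finite prob_space_distr id)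
    show "sigma_finite_measure (distr M lborel \<xi>)" by unfold_locales
    show "sets (distr M G (\<lambda>w. w) \<Otimes>\<^sub>M distr M lborel \<xi>) = sets (distr M (G \<Otimes>\<^sub>M lborel) (\<lambda>w. (w, \<xi> w)))"
      by (simp cong: sets_pair_measure_cong)
    fix A B assume "A \<in> sets (distr M G (\<lambda>w. w))" "B \<in> sets (distr M lborel \<xi>)"
    then have AB [measurable]: "A \<in> sets G" "B \<in> sets borel" by simp_all
    have A: "A \<subseteq> space M" using sets.sets_into_space[OF AB(1)] sp by simp
    have eq: "(\<lambda>w. (w, \<xi> w)) -` (A \<times> B) \<inter> space M = A \<inter> (\<xi> -` B \<inter> space M)"
      "(\<lambda>w. w) -` A \<inter> space M = A" using A by auto
    have "prob (A \<inter> (\<xi> -` B \<inter> space M)) = prob A * prob (\<xi> -` B \<inter> space M)"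
      by (rule indep_setD[OF ind]) (auto simp: events_of_def intro: AB)
    then show "emeasure (distr M G (\<lambda>w. w)) A * emeasure (distr M lborel \<xi>) B
        = emeasure (distr M (G \<Otimes>\<^sub>M lborel) (\<lambda>w. (w, \<xi> w))) (A \<times> B)"
      by (simp add: emeasure_distr eq emeasure_eq_measure ennreal_mult[symmetric] Int_absorb2[OF A])
  qed
  have fm [measurable]: "(\<lambda>(w, x). Y w * f (a w) x) \<in> borel_measurable (G \<Otimes>\<^sub>M lborel)"
  proof -
    have "(\<lambda>p. (\<lambda>(a, x). f a x) (a (fst p), snd p)) \<in> borel_measurable (G \<Otimes>\<^sub>M lborel)"
      by (rule measurable_compose[OF _ f]) measurable
    then show ?thesis by (simp add: split_beta)
  qed
  then have fm': "(\<lambda>(w, x). Y w * f (a w) x) \<in> borel_measurable (distr M G (\<lambda>w. w) \<Otimes>\<^sub>M distr M lborel \<xi>)"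
    by (simp cong: measurable_cong_sets sets_pair_measure_cong)
  have pairm: "(\<lambda>w. (w, \<xi> w)) \<in> M \<rightarrow>\<^sub>M G \<Otimes>\<^sub>M lborel"
    using id \<xi> by (intro measurable_Pair) simp_all
  have fx: "(\<lambda>x. f a x) \<in> borel_measurable borel" for a
    using measurable_compose[OF _ f, of "\<lambda>x. (a, x)" borel] by simp
  have "(\<integral>\<^sup>+w. Y w * f (a w) (\<xi> w) \<partial>M) = (\<integral>\<^sup>+p. (\<lambda>(w, x). Y w * f (a w) x) p \<partial>distr M (G \<Otimes>\<^sub>M lborel) (\<lambda>w. (w, \<xi> w)))"
    by (subst nn_integral_distr[OF pairm]) (simp_all add: fm)
  also have "\<dots> = (\<integral>\<^sup>+p. (\<lambda>(w, x). Y w * f (a w) x) p \<partial>(distr M G (\<lambda>w. w) \<Otimes>\<^sub>M distr M lborel \<xi>))"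
    by (simp only: prod)
  also have "\<dots> = (\<integral>\<^sup>+w. \<integral>\<^sup>+x. Y w * f (a w) x \<partial>distr M lborel \<xi> \<partial>distr M G (\<lambda>w. w))"
    by (subst \<xi>.nn_integral_fst[symmetric, OF fm']) simp
  also have "\<dots> \<le> (\<integral>\<^sup>+w. Y w \<partial>distr M G (\<lambda>w. w))"
  proof (rule nn_integral_mono)
    fix w
    have "(\<integral>\<^sup>+x. Y w * f (a w) x \<partial>distr M lborel \<xi>) = Y w * (\<integral>\<^sup>+x. f (a w) x \<partial>distr M lborel \<xi>)"
      by (rule nn_integral_cmult) (simp add: fx)
    also have "(\<integral>\<^sup>+x. f (a w) x \<partial>distr M lborel \<xi>) = (\<integral>\<^sup>+x. f (a w) x * ennreal (D x) \<partial>lborel)"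
      unfolding dist by (subst nn_integral_density) (simp_all add: fx mult.commute)
    also have "Y w * \<dots> \<le> Y w * 1" by (intro mult_left_mono le) simp
    finally show "(\<integral>\<^sup>+x. Y w * f (a w) x \<partial>distr M lborel \<xi>) \<le> Y w" by simp
  qed
  also have "\<dots> = (\<integral>\<^sup>+w. Y w \<partial>M)" by (rule nn_integral_distr[OF id]) (simp add: Y)
  finally show ?thesis .
qed

text \<open>The last factor is integrated out while the earlier ones are counted as part of the
  past, enlarged to the sigma-algebra \<open>G'\<close> of \<open>G\<close> and the earlier
  increments. The injection \<open>\<iota>\<close> picks the modes of one noise out of the index set
  common to both.\<close>

lemma (in prob_space) nn_integral_freezing_prod:
  fixes \<xi> :: "'i \<Rightarrow> 'a \<Rightarrow> real" and \<iota> :: "nat \<Rightarrow> 'i"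
  assumes G: "subalgebra M G"
    and ind: "indep_sets (case_option (sets G) (\<lambda>i. events_of M (\<xi> i))) UNIV"
    and inj: "inj \<iota>"
    and d: "\<And>i. distributed M lborel (\<xi> i) (\<lambda>x. ennreal (D x))"
    and Y: "Y \<in> borel_measurable G" and a: "\<And>j. a j \<in> borel_measurable G"
    and f: "\<And>j. (\<lambda>(a, x). f j a x) \<in> borel_measurable (borel \<Otimes>\<^sub>M borel)"
    and le: "\<And>j (a :: real). (\<integral>\<^sup>+x. f j a x * ennreal (D x) \<partial>lborel) \<le> 1"
  shows "(\<integral>\<^sup>+w. Y w * (\<Prod>j<n. f j (a j w) (\<xi> (\<iota> j) w)) \<partial>M) \<le> (\<integral>\<^sup>+w. Y w \<partial>M)"
proof (induction n)
  case 0 show ?case by simp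
next
  case (Suc n)
  let ?E = "case_option (sets G) (\<lambda>i. events_of M (\<xi> i))"
  define A where "A = (\<Union>k\<in>insert None ((Some \<circ> \<iota>) ` {..<n}). ?E k)"
  define G' where "G' = sigma (space M) A"
  have spG: "space G = space M" "sets G \<subseteq> sets M" using G by (auto simp: subalgebra_def)
  have \<xi>m: "\<xi> i \<in> borel_measurable M" for i using distributed_measurable[OF d[of i]] by simp
  have ev: "events_of M (\<xi> i) \<subseteq> sets M" for i
    using measurable_sets[OF \<xi>m[of i]] by (auto simp: events_of_def)
  have AM: "A \<subseteq> sets M" unfolding A_def using spG ev by (auto split: option.splits)
  then have AP: "A \<subseteq> Pow (space M)" using sets.sets_into_space by blast
  have sG': "sets G' = sigma_sets (space M) A" "space G' = space M"
    unfolding G'_def using AP by (auto simp: space_measure_of_conv)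
  have subG': "subalgebra M G'"
    unfolding subalgebra_def sG' using sets.sigma_sets_subset[OF AM] by simp
  have GG': "subalgebra G' G"
    unfolding subalgebra_def sG' spG(1) by (auto simp: A_def intro: sigma_sets.Basic)
  have \<xi>G': "\<xi> (\<iota> j) \<in> borel_measurable G'" if "j < n" for j
  proof (rule measurableI)
    fix B :: "real set" assume "B \<in> sets borel"
    then have "\<xi> (\<iota> j) -` B \<inter> space M \<in> events_of M (\<xi> (\<iota> j))" by (auto simp: events_of_def)
    then have "\<xi> (\<iota> j) -` B \<inter> space M \<in> A" using that by (auto simp: A_def)
    then show "\<xi> (\<iota> j) -` B \<inter> space G' \<in> sets G'" unfolding sG' by (rule sigma_sets.Basic)
  qed simp
  have indG': "indep_set (sets G') (events_of M (\<xi> (\<iota> n)))"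
  proof -
    \<comment> \<open>Two disjoint blocks of indices: the past with the earlier increments, and the
      single new increment. Grouping preserves independence.\<close>
    define I where "I b = (if b then insert None ((Some \<circ> \<iota>) ` {..<n}) else {Some (\<iota> n)})" for b
    have "indep_sets (\<lambda>b. sigma_sets (space M) (\<Union>i\<in>I b. ?E i)) UNIV"
    proof (rule indep_sets_collect_sigma)
      show "indep_sets ?E (\<Union>b\<in>UNIV. I b)" by (rule indep_sets_mono_index[OF _ ind]) simp
      show "Int_stable (?E i)" for i
        by (cases i) (auto simp: sets.Int_stable Int_stable_events_of)
      show "disjoint_family_on I UNIV"
        using inj by (auto simp: disjoint_family_on_def I_def inj_def split: if_splits)
    qed
    then show ?thesis unfolding indep_set_def
    proof (rule indep_sets_mono_sets)
      fix b :: bool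
      show "(case b of True \<Rightarrow> sets G' | False \<Rightarrow> events_of M (\<xi> (\<iota> n))) \<subseteq> sigma_sets (space M) (\<Union>i\<in>I b. ?E i)"
        by (cases b) (auto simp: sG' I_def A_def intro: sigma_sets.Basic)
    qed
  qed
  have Y': "(\<lambda>w. Y w * (\<Prod>j<n. f j (a j w) (\<xi> (\<iota> j) w))) \<in> borel_measurable G'"
  proof (intro borel_measurable_times_ennreal borel_measurable_prod_ennreal)
    show "Y \<in> borel_measurable G'" by (rule measurable_from_subalg[OF GG' Y])
    fix j assume "j \<in> {..<n}"
    then have "(\<lambda>w. (a j w, \<xi> (\<iota> j) w)) \<in> G' \<rightarrow>\<^sub>M borel \<Otimes>\<^sub>M borel"
      using \<xi>G' measurable_from_subalg[OF GG' a] by (intro measurable_Pair) auto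
    from measurable_compose[OF this f[of j]]
    show "(\<lambda>w. f j (a j w) (\<xi> (\<iota> j) w)) \<in> borel_measurable G'" by simp
  qed
  have "(\<integral>\<^sup>+w. Y w * (\<Prod>j<Suc n. f j (a j w) (\<xi> (\<iota> j) w)) \<partial>M)
      = (\<integral>\<^sup>+w. (Y w * (\<Prod>j<n. f j (a j w) (\<xi> (\<iota> j) w))) * f n (a n w) (\<xi> (\<iota> n) w) \<partial>M)"
    by (simp add: mult.assoc)
  also have "\<dots> \<le> (\<integral>\<^sup>+w. Y w * (\<Prod>j<n. f j (a j w) (\<xi> (\<iota> j) w)) \<partial>M)"
    by (rule nn_integral_freezing[OF subG' indG' d Y' measurable_from_subalg[OF GG' a] f le])
  finally show ?case using Suc.IH by (rule order_trans)
qed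

text \<open>Fatou's lemma carries the bound from finitely many modes to the whole noise, without any
  claim that the products converge.\<close>

lemma (in prob_space) nn_integral_mult_liminf_le:
  fixes Y :: "'a \<Rightarrow> ennreal"
  assumes [measurable]: "Y \<in> borel_measurable M" "\<And>n. X n \<in> borel_measurable M"
    and le: "\<And>n. (\<integral>\<^sup>+w. Y w * X n w \<partial>M) \<le> c"
  shows "(\<integral>\<^sup>+w. Y w * liminf (\<lambda>n. X n w) \<partial>M) \<le> c"
proof -
  have "Y w * liminf (\<lambda>n. X n w) \<le> liminf (\<lambda>n. Y w * X n w)" for w
    unfolding liminf_SUP_INF SUP_mult_left_ennreal
    by (intro SUP_mono bexI INF_greatest mult_left_mono INF_lower) auto
  then have "(\<integral>\<^sup>+w. Y w * liminf (\<lambda>n. X n w) \<partial>M) \<le> (\<integral>\<^sup>+w. liminf (\<lambda>n. Y w * X n w) \<partial>M)"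
    by (rule nn_integral_mono)
  also have "\<dots> \<le> liminf (\<lambda>n. \<integral>\<^sup>+w. Y w * X n w \<partial>M)"
    by (rule nn_integral_liminf) measurable
  also have "\<dots> \<le> liminf (\<lambda>n::nat. c)" by (intro Liminf_mono always_eventually allI le)
  finally show ?thesis by (simp add: Liminf_const)
qed

section \<open>Maximal inequality and exponential moments of a maximum\<close>

text \<open>Doob's argument: the process is replaced by the constant \<open>x\<close> from the first
  time it reaches that level, which keeps its mean from increasing above the initial value 1. The
  supermartingale property is phrased as an inequality against all nonnegative functions of the
  past, which applies directly to the process restricted to the paths that have not yet reached the
  level.\<close>

lemma (in prob_space) supermartingale_maximal_inequality:
  fixes Fl :: "nat \<Rightarrow> 'a measure" and Z D :: "nat \<Rightarrow> 'a \<Rightarrow> ennreal"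
  assumes sub: "\<And>n. n \<le> N \<Longrightarrow> subalgebra M (Fl n)"
    and mono: "\<And>m n. m \<le> n \<Longrightarrow> n \<le> N \<Longrightarrow> subalgebra (Fl n) (Fl m)"
    and D: "\<And>n. n < N \<Longrightarrow> D (Suc n) \<in> borel_measurable (Fl (Suc n))"
    and step: "\<And>n Y. n < N \<Longrightarrow> Y \<in> borel_measurable (Fl n) \<Longrightarrow> (\<integral>\<^sup>+w. Y w * D (Suc n) w \<partial>M) \<le> (\<integral>\<^sup>+w. Y w \<partial>M)"
  defines "Z \<equiv> \<lambda>n w. \<Prod>l=1..n. D l w"
  shows "x * emeasure M {w \<in> space M. \<exists>n\<le>N. x \<le> Z n w} \<le> 1"
    and "n \<le> N \<Longrightarrow> Z n \<in> borel_measurable M"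
proof -
  have Zm: "Z k \<in> borel_measurable (Fl n)" if "k \<le> n" "n \<le> N" for k n
    unfolding Z_def
  proof (intro borel_measurable_prod_ennreal)
    fix l assume "l \<in> {1..k}"
    then obtain m where "l = Suc m" "Suc m \<le> k" by (cases l) auto
    with that D[of m] mono[of "Suc m" n] show "D l \<in> borel_measurable (Fl n)"
      by (auto intro: measurable_from_subalg)
  qed
  show "n \<le> N \<Longrightarrow> Z n \<in> borel_measurable M" for n
    by (rule measurable_from_subalg[OF sub Zm]) auto
  define A where "A n w \<longleftrightarrow> (\<exists>k\<le>n. x \<le> Z k w)" for n w
  have Am: "Measurable.pred (Fl n) (A n)" if "n \<le> N" for n
  proof -
    have "Measurable.pred (Fl n) (\<lambda>w. x \<le> Z k w)" if k: "k \<in> {..n}" for k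
    proof -
      have [measurable]: "Z k \<in> borel_measurable (Fl n)" using Zm k \<open>n \<le> N\<close> by simp
      show ?thesis by measurable
    qed
    then have "Measurable.pred (Fl n) (\<lambda>w. \<exists>k\<in>{..n}. x \<le> Z k w)"
      by (intro pred_intros_finite) auto
    moreover have "A n = (\<lambda>w. \<exists>k\<in>{..n}. x \<le> Z k w)" by (auto simp: A_def fun_eq_iff)
    ultimately show ?thesis by (simp only:)
  qed
  have main: "(\<integral>\<^sup>+w. (if A n w then x else Z n w) \<partial>M) \<le> 1" if "n \<le> N" for n
    using that
  proof (induction n)
    case 0
    have "(\<integral>\<^sup>+w. (if A 0 w then x else Z 0 w) \<partial>M) \<le> (\<integral>\<^sup>+w. 1 \<partial>M)"
      by (intro nn_integral_mono) (auto simp: A_def Z_def)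
    then show ?case by (simp add: emeasure_space_1)
  next
    case (Suc n)
    have Zn: "Z n \<in> borel_measurable (Fl n)" and An: "Measurable.pred (Fl n) (A n)"
      using Zm Am Suc.prems by auto
    have Yn: "(\<lambda>w. if A n w then 0 else Z n w) \<in> borel_measurable (Fl n)"
      using Zn An by measurable
    have c1: "(\<lambda>w. if A n w then x else 0) \<in> borel_measurable (Fl n)"
      using An by measurable
    have Dm: "D (Suc n) \<in> borel_measurable M"
      using measurable_from_subalg[OF sub D] Suc.prems by auto
    note fromn = measurable_from_subalg[OF sub[of n]]
    have "(\<integral>\<^sup>+w. (if A (Suc n) w then x else Z (Suc n) w) \<partial>M)
        \<le> (\<integral>\<^sup>+w. (if A n w then x else 0) + (if A n w then 0 else Z n w) * D (Suc n) w \<partial>M)"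
      by (intro nn_integral_mono) (auto simp: A_def Z_def le_Suc_eq mult.commute)
    also have "\<dots> = (\<integral>\<^sup>+w. (if A n w then x else 0) \<partial>M) + (\<integral>\<^sup>+w. (if A n w then 0 else Z n w) * D (Suc n) w \<partial>M)"
      using Suc.prems by (intro nn_integral_add borel_measurable_times_ennreal fromn c1 Yn Dm) auto
    also have "\<dots> \<le> (\<integral>\<^sup>+w. (if A n w then x else 0) \<partial>M) + (\<integral>\<^sup>+w. (if A n w then 0 else Z n w) \<partial>M)"
      using Suc.prems by (intro add_left_mono step Yn) auto
    also have "\<dots> = (\<integral>\<^sup>+w. (if A n w then x else 0) + (if A n w then 0 else Z n w) \<partial>M)"
      using Suc.prems by (intro nn_integral_add[symmetric] fromn c1 Yn) auto
    also have "\<dots> = (\<integral>\<^sup>+w. (if A n w then x else Z n w) \<partial>M)" by (intro nn_integral_cong) auto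
    also have "\<dots> \<le> 1" using Suc by auto
    finally show ?case .
  qed
  have AN: "{w \<in> space M. A N w} \<in> sets M"
    using measurable_from_subalg[OF sub Am, of N] by simp
  have "x * emeasure M {w \<in> space M. A N w} = (\<integral>\<^sup>+w. x * indicator {w \<in> space M. A N w} w \<partial>M)"
    using AN by (simp add: nn_integral_cmult_indicator)
  also have "\<dots> \<le> (\<integral>\<^sup>+w. (if A N w then x else Z N w) \<partial>M)"
    by (intro nn_integral_mono) (auto split: split_indicator)
  also have "\<dots> \<le> 1" by (rule main) simp
  finally show "x * emeasure M {w \<in> space M. \<exists>n\<le>N. x \<le> Z n w} \<le> 1" by (simp add: A_def)
qed

text \<open>The maximum exceeds \<open>exp k\<close> with probability at most
  \<open>exp (- k)\<close>, so its power \<open>s < 1\<close> has a finite mean by summation over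
  integer levels. \<open>R\<close> majorizes that power for all \<open>n\<close> at once, so it can
  later be evaluated at an index that depends on the path.\<close>

lemma (in prob_space) maximal_exponential_moment:
  fixes Z :: "nat \<Rightarrow> 'a \<Rightarrow> ennreal"
  assumes Z: "\<And>n. n \<le> N \<Longrightarrow> Z n \<in> borel_measurable M"
    and max: "\<And>x. x * emeasure M {w \<in> space M. \<exists>n\<le>N. x \<le> Z n w} \<le> 1"
    and s: "0 < s" "s < 1"
  obtains R where "R \<in> borel_measurable M"
    "(\<integral>\<^sup>+w. R w \<partial>M) \<le> ennreal (1 + exp s / (1 - exp (s - 1)))"
    "\<And>w n r. w \<in> space M \<Longrightarrow> n \<le> N \<Longrightarrow> ennreal (exp r) \<le> Z n w \<Longrightarrow> ennreal (exp (s * r)) \<le> R w"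
proof -
  \<comment> \<open>A value \<open>r \<ge> 0\<close> is rounded down to \<open>k\<close> in the
    event and up to \<open>k + 1\<close> in the weight; the summand 1 in \<open>R\<close> covers
    negative \<open>r\<close>.\<close>
  define A where "A k = {w \<in> space M. \<exists>n\<le>N. ennreal (exp (real k)) \<le> Z n w}" for k :: nat
  define R where "R w = 1 + (\<Sum>k. ennreal (exp (s * (real k + 1))) * indicator (A k) w)" for w
  have A [measurable]: "A k \<in> sets M" for k
  proof -
    have "A k = (\<Union>n\<in>{..N}. {w \<in> space M. ennreal (exp (real k)) \<le> Z n w})" by (auto simp: A_def)
    also have "\<dots> \<in> sets M" using Z by (intro sets.finite_UN borel_measurable_le) auto
    finally show ?thesis .
  qed
  have R: "R \<in> borel_measurable M" unfolding R_def by measurable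
  \<comment> \<open>The weight \<open>exp (s * (k + 1))\<close> against the tail
    \<open>exp (- k)\<close> leaves a geometric series of ratio
    \<open>exp (s - 1) < 1\<close>.\<close>
  have emA: "ennreal (exp (s * (real k + 1))) * emeasure M (A k) \<le> ennreal (exp s * exp (s - 1) ^ k)" for k
  proof -
    have "ennreal (exp (s * (real k + 1))) * emeasure M (A k)
        = ennreal (exp (s * (real k + 1) - real k)) * (ennreal (exp (real k)) * emeasure M (A k))"
      by (simp add: mult.assoc[symmetric] ennreal_mult[symmetric] exp_add[symmetric])
    also have "\<dots> \<le> ennreal (exp (s * (real k + 1) - real k)) * 1"
      unfolding A_def by (intro mult_left_mono max) simp
    also have "s * (real k + 1) - real k = s + real k * (s - 1)" by (simp add: algebra_simps)
    finally show ?thesis by (simp only: exp_add exp_of_nat_mult mult_1_right)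
  qed
  have geo: "(\<lambda>k. exp s * exp (s - 1) ^ k) sums (exp s * (1 / (1 - exp (s - 1))))"
    using s by (intro sums_mult geometric_sums) simp
  have "(\<integral>\<^sup>+w. R w \<partial>M) = 1 + (\<Sum>k. ennreal (exp (s * (real k + 1))) * emeasure M (A k))"
    unfolding R_def
    by (subst nn_integral_add) (simp_all add: nn_integral_suminf nn_integral_cmult_indicator emeasure_space_1)
  also have "\<dots> \<le> 1 + (\<Sum>k. ennreal (exp s * exp (s - 1) ^ k))"
    by (intro add_left_mono suminf_le emA) auto
  also have "(\<Sum>k. ennreal (exp s * exp (s - 1) ^ k)) = ennreal (exp s * (1 / (1 - exp (s - 1))))"
    unfolding sums_unique[OF geo] by (rule suminf_ennreal2[OF _ sums_summable[OF geo]]) simp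
  finally have int: "(\<integral>\<^sup>+w. R w \<partial>M) \<le> ennreal (1 + exp s / (1 - exp (s - 1)))"
    using s by (simp add: ennreal_plus[symmetric] ennreal_1[symmetric] del: ennreal_1 ennreal_plus)
  have bound: "ennreal (exp (s * r)) \<le> R w" if w: "w \<in> space M" "n \<le> N" "ennreal (exp r) \<le> Z n w" for w n r
  proof (cases "r < 0")
    case True
    then have "ennreal (exp (s * r)) \<le> 1" using s by (simp add: mult_nonneg_nonpos)
    also have "\<dots> \<le> R w" by (simp add: R_def)
    finally show ?thesis .
  next
    case False
    define k where "k = nat \<lfloor>r\<rfloor>"
    have k: "real k \<le> r" "r \<le> real k + 1" using False by (auto simp: k_def intro: less_imp_le)
    have "ennreal (exp (real k)) \<le> Z n w" using k w(3) by (intro order_trans[OF ennreal_leI w(3)]) simp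
    then have wA: "w \<in> A k" using w by (auto simp: A_def)
    have "ennreal (exp (s * r)) \<le> ennreal (exp (s * (real k + 1))) * indicator (A k) w"
      using wA k s by (simp add: ennreal_leI mult_left_mono)
    also have "\<dots> \<le> (\<Sum>k. ennreal (exp (s * (real k + 1))) * indicator (A k) w)"
    proof -
      have "g k \<le> suminf g" for g :: "nat \<Rightarrow> ennreal"
        using sum_le_suminf[of g "{k}"] by simp
      then show ?thesis .
    qed
    also have "\<dots> \<le> R w" by (simp add: R_def)
    finally show ?thesis .
  qed
  show thesis by (rule that[OF R int bound])
qed

section \<open>Measurable functionals on the spaces of square-integrable functions\<close>

lemma space_L2_borel: "space (L2_borel M X) = X"
  unfolding L2_borel_def by (rule space_measure_of) auto

text \<open>The sigma-algebra is generated by the norm-open sets, so it contains the preimages of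
  open sets under a Lipschitz functional; inner products and the norm are of this kind.\<close>

lemma L2_borel_measurable_Lipschitz:
  fixes \<phi> :: "('a \<Rightarrow> 'b::euclidean_space) \<Rightarrow> real"
  assumes K: "K \<ge> 0" and lip: "\<And>f g. f \<in> X \<Longrightarrow> g \<in> X \<Longrightarrow> \<bar>\<phi> f - \<phi> g\<bar> \<le> K * L2_norm M (\<lambda>x. f x - g x)"
  shows "\<phi> \<in> borel_measurable (L2_borel M X)"
proof (rule borel_measurableI)
  fix S :: "real set" assume S: "open S"
  have "\<phi> -` S \<inter> X \<in> {U. U \<subseteq> X \<and> (\<forall>f\<in>U. \<exists>\<epsilon>>0. \<forall>g\<in>X. L2_norm M (\<lambda>x. f x - g x) < \<epsilon> \<longrightarrow> g \<in> U)}"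
  proof (intro CollectI conjI ballI)
    fix f assume f: "f \<in> \<phi> -` S \<inter> X"
    then obtain d where d: "d > 0" "ball (\<phi> f) d \<subseteq> S" using S by (auto simp: open_contains_ball)
    show "\<exists>\<epsilon>>0. \<forall>g\<in>X. L2_norm M (\<lambda>x. f x - g x) < \<epsilon> \<longrightarrow> g \<in> \<phi> -` S \<inter> X"
    proof (intro exI[of _ "d / (K + 1)"] conjI ballI impI)
      show "0 < d / (K + 1)" using d K by simp
      fix g assume g: "g \<in> X" and lt: "L2_norm M (\<lambda>x. f x - g x) < d / (K + 1)"
      have "\<bar>\<phi> f - \<phi> g\<bar> \<le> K * L2_norm M (\<lambda>x. f x - g x)" using lip f g by auto
      also have "\<dots> \<le> (K + 1) * L2_norm M (\<lambda>x. f x - g x)" by (intro mult_right_mono) auto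
      also have "\<dots> < d" using lt K by (simp add: less_divide_eq mult.commute)
      finally have "\<phi> g \<in> ball (\<phi> f) d" by (simp add: dist_real_def)
      then show "g \<in> \<phi> -` S \<inter> X" using d g by auto
    qed
  qed auto
  then show "\<phi> -` S \<inter> space (L2_borel M X) \<in> sets (L2_borel M X)"
    unfolding space_L2_borel unfolding L2_borel_def
    by (subst sets_measure_of) (auto intro: sigma_sets.Basic)
qed

lemma L2_borel_measurable_inner:
  assumes X: "X \<subseteq> L2 M" and e: "e \<in> L2 M"
  shows "(\<lambda>f. L2_inner M f e) \<in> borel_measurable (L2_borel M X)"
proof (rule L2_borel_measurable_Lipschitz[where K = "L2_norm M e"])
  fix f g assume "f \<in> X" "g \<in> X"
  then have fg: "f \<in> L2 M" "g \<in> L2 M" using X by auto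
  show "\<bar>L2_inner M f e - L2_inner M g e\<bar> \<le> L2_norm M e * L2_norm M (\<lambda>x. f x - g x)"
    using L2_Cauchy_Schwarz[OF L2_diff[OF fg] e] by (simp add: L2_inner_diff_left fg e mult.commute)
qed simp

lemma L2_borel_measurable_norm:
  assumes X: "X \<subseteq> L2 M"
  shows "L2_norm M \<in> borel_measurable (L2_borel M X)"
proof (rule L2_borel_measurable_Lipschitz[where K = 1])
  fix f g assume "f \<in> X" "g \<in> X"
  then show "\<bar>L2_norm M f - L2_norm M g\<bar> \<le> 1 * L2_norm M (\<lambda>x. f x - g x)"
    unfolding mult_1 using X by (intro L2_norm_diff_ge) auto
qed simp

section \<open>The exponential supermartingale of the noise\<close>

text \<open>In the eigenbasis the exponent is a sum over modes, each quadratic in one independent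
  Gaussian increment with a coefficient from the past, so the Gaussian bound applies mode by mode.
  \<open>D\<close> is assembled from the adapted Brownian motions, because \<open>W\<close> is
  related to them only almost surely; accordingly the last conclusion holds almost surely and only
  from below.\<close>

lemma noise_step:
  fixes b :: "'i \<Rightarrow> real \<Rightarrow> 'w \<Rightarrow> real" and W :: "real \<Rightarrow> 'w \<Rightarrow> 'a \<Rightarrow> 'b::euclidean_space"
  assumes PF: "filtered_prob_space P F" and ibm: "independent_brownian_motions P F b" and inj: "inj \<iota>"
    and ns: "noise_series P M X q e (\<lambda>j. b (\<iota> j)) W"
    and co: "complete_orthonormal M X e" and X: "X \<subseteq> L2 M"
    and q: "\<And>j. q j > 0" "summable q"
    and t: "0 \<le> s" "s < t" and B: "B > 0"
    and eta: "2 * B * suminf q * (t - s) \<le> \<eta>" "\<eta> \<le> 1/2" and rho: "2 * B * suminf q \<le> (1 - \<eta>) * \<rho>"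
    and v: "v \<in> F s \<rightarrow>\<^sub>M L2_borel M X"
  obtains D where "D \<in> borel_measurable (F t)"
    "\<And>Y :: 'w \<Rightarrow> ennreal. Y \<in> borel_measurable (F s) \<Longrightarrow> (\<integral>\<^sup>+w. Y w * D w \<partial>P) \<le> (\<integral>\<^sup>+w. Y w \<partial>P)"
    "AE w in P. ennreal (exp (B * (2 * L2_inner M (\<lambda>x. W t w x - W s w x) (v w) + (L2_norm M (\<lambda>x. W t w x - W s w x))\<^sup>2
        - \<rho> * (t - s) * (L2_norm M (v w))\<^sup>2) - 2 * B * suminf q * (t - s))) \<le> D w"
proof -
  interpret prob_space P using PF by (simp add: filtered_prob_space_def)
  define h where "h = t - s"
  define Q where "Q = suminf q"
  have h: "h > 0" using t by (simp add: h_def)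
  have e: "e j \<in> L2 M" for j using co X by (auto simp: complete_orthonormal_def)
  have qQ: "q j \<le> Q" for j
    unfolding Q_def using q sum_le_suminf[of q "{j}"] by (auto intro: less_imp_le)
  have Q0: "Q > 0" using q(1)[of 0] qQ[of 0] by linarith
  define \<xi> where "\<xi> i w = b i t w - b i s w" for i w
  define c where "c j w = L2_inner M (v w) (e j)" for j w
  \<comment> \<open>The coefficient of the increment of mode \<open>j\<close> in
    \<open>2 * B\<close> times the product of the noise increment with \<open>v\<close>.\<close>
  define a where "a j w = 2 * B * sqrt (q j) * c j w" for j w
  \<comment> \<open>Of the two compensators, the one with the square of \<open>a\<close> sums to at
    most the damping term with \<open>\<rho>\<close>, the other to at most the trace term in the
    third conclusion.\<close>
  define f where "f j a x = ennreal (exp (a * x + B * q j * x\<^sup>2 - (a\<^sup>2 * h / (2 * (1 - \<eta>)) + 2 * (B * q j) * h)))" for j a x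
  define D where "D w = liminf (\<lambda>n. \<Prod>j<n. f j (a j w) (\<xi> (\<iota> j) w))" for w
  have subs: "subalgebra P (F s)" "subalgebra P (F t)" "subalgebra (F t) (F s)"
    using PF t by (auto simp: filtered_prob_space_def)
  have bm: "brownian_motion P F (b i)" for i using ibm by (simp add: independent_brownian_motions_def)
  have bF: "b i r \<in> borel_measurable (F r)" if "r \<ge> 0" for i r
    using bm[of i] that by (simp add: brownian_motion_def)
  have [measurable]: "b i t \<in> borel_measurable (F t)" "b i s \<in> borel_measurable (F t)" for i
    using bF[of t i] measurable_from_subalg[OF subs(3) bF[of s i]] t by auto
  have \<xi>m [measurable]: "\<xi> i \<in> borel_measurable (F t)" for i unfolding \<xi>_def by measurable
  have cm: "c j \<in> borel_measurable (F s)" for j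
    unfolding c_def by (rule measurable_compose[OF v L2_borel_measurable_inner[OF X e]])
  have am: "a j \<in> borel_measurable (F s)" for j
    unfolding a_def using cm by measurable
  note [measurable] = measurable_from_subalg[OF subs(3) am]
  have fm: "(\<lambda>(a, x). f j a x) \<in> borel_measurable (borel \<Otimes>\<^sub>M borel)" for j
    unfolding f_def by measurable
  have prodm: "(\<lambda>w. \<Prod>j<n. f j (a j w) (\<xi> (\<iota> j) w)) \<in> borel_measurable (F t)" for n
    unfolding f_def by measurable
  have Dm: "D \<in> borel_measurable (F t)"
    unfolding D_def by (intro borel_measurable_liminf prodm)
  have dist: "distributed P lborel (\<xi> i) (\<lambda>x. ennreal (normal_density 0 (sqrt h) x))" for i
    using bm[of i] t by (simp add: brownian_motion_def \<xi>_def[abs_def] h_def)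
  have ind: "indep_sets (case_option (sets (F s)) (\<lambda>i. events_of P (\<xi> i))) UNIV"
    using ibm t unfolding independent_brownian_motions_def \<xi>_def[abs_def] by blast
  have gauss: "(\<integral>\<^sup>+x. f j a x * ennreal (normal_density 0 (sqrt h) x) \<partial>lborel) \<le> 1" for j a
    unfolding f_def
  proof (rule nn_integral_Gaussian_exp_quadratic[OF h])
    show "0 \<le> B * q j" using B q(1)[of j] by simp
    have "2 * (B * q j) * h \<le> 2 * B * Q * h" using qQ[of j] B h by simp
    also have "\<dots> \<le> \<eta>" using eta by (simp add: Q_def h_def)
    finally show "2 * (B * q j) * h \<le> \<eta>" .
  qed (rule eta)
  have super: "(\<integral>\<^sup>+w. Y w * D w \<partial>P) \<le> (\<integral>\<^sup>+w. Y w \<partial>P)" if Y: "Y \<in> borel_measurable (F s)" for Y :: "'w \<Rightarrow> ennreal"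
    unfolding D_def
  proof (rule nn_integral_mult_liminf_le)
    show "Y \<in> borel_measurable P" by (rule measurable_from_subalg[OF subs(1) Y])
    show "(\<lambda>w. \<Prod>j<n. f j (a j w) (\<xi> (\<iota> j) w)) \<in> borel_measurable P" for n
      by (rule measurable_from_subalg[OF subs(2) prodm])
    show "(\<integral>\<^sup>+w. Y w * (\<Prod>j<n. f j (a j w) (\<xi> (\<iota> j) w)) \<partial>P) \<le> (\<integral>\<^sup>+w. Y w \<partial>P)" for n
      by (rule nn_integral_freezing_prod[OF subs(1) ind inj dist Y am fm gauss])
  qed
  have lower: "AE w in P. ennreal (exp (B * (2 * L2_inner M (\<lambda>x. W t w x - W s w x) (v w) + (L2_norm M (\<lambda>x. W t w x - W s w x))\<^sup>2
        - \<rho> * (t - s) * (L2_norm M (v w))\<^sup>2) - 2 * B * suminf q * (t - s))) \<le> D w"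
  proof -
    have AEW: "AE w in P. W r w \<in> X \<and> (\<lambda>n. L2_norm M (\<lambda>x. W r w x - (\<Sum>j<n. (sqrt (q j) * b (\<iota> j) r w) *\<^sub>R e j x))) \<longlonglongrightarrow> 0"
      if "r \<ge> 0" for r using ns that by (simp add: noise_series_def)
    have "AE w in P. W s w \<in> X \<and> (\<lambda>n. L2_norm M (\<lambda>x. W s w x - (\<Sum>j<n. (sqrt (q j) * b (\<iota> j) s w) *\<^sub>R e j x))) \<longlonglongrightarrow> 0"
      "AE w in P. W t w \<in> X \<and> (\<lambda>n. L2_norm M (\<lambda>x. W t w x - (\<Sum>j<n. (sqrt (q j) * b (\<iota> j) t w) *\<^sub>R e j x))) \<longlonglongrightarrow> 0"
      using AEW t by auto
    then show ?thesis using AE_space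
    proof eventually_elim
      case (elim w)
      have vX: "v w \<in> X"
        using measurable_space[OF v, of w] elim(3) subs(1) by (simp add: space_L2_borel subalgebra_def)
      then have vL2: "v w \<in> L2 M" using X by auto
      define dW where "dW x = W t w x - W s w x" for x
      have W2: "W t w \<in> L2 M" "W s w \<in> L2 M" using elim X by auto
      have dW: "dW \<in> L2 M" unfolding dW_def using W2 by (intro L2_diff)
      define S where "S n x = (\<Sum>j<n. (sqrt (q j) * \<xi> (\<iota> j) w) *\<^sub>R e j x)" for n x
      have S: "S n \<in> L2 M" for n unfolding S_def by (intro L2_sum L2_scaleR e)
      have conv: "(\<lambda>n. L2_norm M (\<lambda>x. S n x - dW x)) \<longlonglongrightarrow> 0"
      proof -
        let ?p = "\<lambda>r n x. W r w x - (\<Sum>j<n. (sqrt (q j) * b (\<iota> j) r w) *\<^sub>R e j x)"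
        have p: "?p t n \<in> L2 M" "?p s n \<in> L2 M" for n
          using W2 by (intro L2_diff L2_sum L2_scaleR e; simp)+
        have bd: "norm (L2_norm M (\<lambda>x. S n x - dW x)) \<le> L2_norm M (?p t n) + L2_norm M (?p s n)" for n
        proof -
          have "dW x - S n x = ?p t n x + (-1) *\<^sub>R ?p s n x" for x
            unfolding S_def dW_def \<xi>_def
            by (simp add: right_diff_distrib scaleR_left_diff_distrib sum_subtractf)
          then have "L2_norm M (\<lambda>x. dW x - S n x) \<le> L2_norm M (?p t n) + L2_norm M (\<lambda>x. (-1) *\<^sub>R ?p s n x)"
            using L2_norm_triangle[OF p(1)[of n] L2_scaleR[OF p(2)[of n], of "-1"]] by (simp only:)
          also have "L2_norm M (\<lambda>x. (-1) *\<^sub>R ?p s n x) = L2_norm M (?p s n)"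
            unfolding L2_norm_def L2_inner_def by (simp only: scaleR_minus1_left inner_minus_left inner_minus_right minus_minus)
          finally show ?thesis by (simp add: L2_norm_minus_commute[of M "S n"])
        qed
        have lim0: "(\<lambda>n. L2_norm M (?p t n) + L2_norm M (?p s n)) \<longlonglongrightarrow> 0"
          using tendsto_add[OF conjunct2[OF elim(2)] conjunct2[OF elim(1)]] by simp
        show ?thesis
          by (rule Lim_null_comparison[OF always_eventually lim0]) (rule allI, rule bd)
      qed
      \<comment> \<open>The exponent for the noise series cut off at \<open>n\<close>. It converges
        to the exponent in question and, for every \<open>n\<close>, stays below the logarithm of
        the finite product in \<open>D\<close>.\<close>
      define x where "x n = B * (2 * L2_inner M (S n) (v w) + (L2_norm M (S n))\<^sup>2 - \<rho> * h * (L2_norm M (v w))\<^sup>2) - 2 * B * Q * h" for n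
      have xlim: "x \<longlonglongrightarrow> B * (2 * L2_inner M dW (v w) + (L2_norm M dW)\<^sup>2 - \<rho> * h * (L2_norm M (v w))\<^sup>2) - 2 * B * Q * h"
        unfolding x_def
        by (intro tendsto_intros tendsto_L2_norm[OF S dW conv] tendsto_L2_inner[OF S dW conv, of "\<lambda>_. v w" "v w"]) (simp_all add: vL2)
      have le: "ennreal (exp (x n)) \<le> (\<Prod>j<n. f j (a j w) (\<xi> (\<iota> j) w))" for n
      proof -
        have "(\<Prod>j<n. f j (a j w) (\<xi> (\<iota> j) w)) = ennreal (exp (\<Sum>j<n. a j w * \<xi> (\<iota> j) w + B * q j * (\<xi> (\<iota> j) w)\<^sup>2
            - ((a j w)\<^sup>2 * h / (2 * (1 - \<eta>)) + 2 * (B * q j) * h)))"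
          unfolding f_def by (simp add: prod_ennreal exp_sum)
        moreover have "x n \<le> (\<Sum>j<n. a j w * \<xi> (\<iota> j) w + B * q j * (\<xi> (\<iota> j) w)\<^sup>2
            - ((a j w)\<^sup>2 * h / (2 * (1 - \<eta>)) + 2 * (B * q j) * h))"
        proof -
          have 1: "L2_inner M (S n) (v w) = (\<Sum>j<n. sqrt (q j) * \<xi> (\<iota> j) w * c j w)"
            unfolding S_def c_def by (rule L2_inner_orthonormal_sum(2)[OF co X vL2])
          have 2: "(L2_norm M (S n))\<^sup>2 = (\<Sum>j<n. q j * (\<xi> (\<iota> j) w)\<^sup>2)"
            unfolding S_def L2_inner_orthonormal_sum(1)[OF co X]
            using q(1) by (intro sum.cong) (auto simp: power_mult_distrib less_imp_le)
          have bessel: "(\<Sum>j<n. (c j w)\<^sup>2) \<le> (L2_norm M (v w))\<^sup>2"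
            using sum_le_suminf[of "\<lambda>j. (c j w)\<^sup>2" "{..<n}"] L2_Parseval[OF co X vX]
            by (simp add: c_def sums_iff)
          \<comment> \<open>Every \<open>q j\<close> is bounded by the trace and the coefficients of
            \<open>v\<close> by Bessel's inequality; in this way the trace enters the condition
            \<open>rho\<close>.\<close>
          have "(\<Sum>j<n. (a j w)\<^sup>2) \<le> (\<Sum>j<n. 4 * B\<^sup>2 * Q * (c j w)\<^sup>2)"
          proof (rule sum_mono)
            fix j
            have "(a j w)\<^sup>2 = 4 * B\<^sup>2 * q j * (c j w)\<^sup>2"
              using q(1)[of j] by (simp add: a_def power_mult_distrib)
            also have "\<dots> \<le> 4 * B\<^sup>2 * Q * (c j w)\<^sup>2"
              using qQ[of j] by (intro mult_right_mono mult_left_mono) auto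
            finally show "(a j w)\<^sup>2 \<le> 4 * B\<^sup>2 * Q * (c j w)\<^sup>2" .
          qed
          also have "\<dots> \<le> 4 * B\<^sup>2 * Q * (L2_norm M (v w))\<^sup>2"
            unfolding sum_distrib_left[symmetric] using bessel Q0 by (intro mult_left_mono) auto
          finally have a2: "(\<Sum>j<n. (a j w)\<^sup>2) \<le> 4 * B\<^sup>2 * Q * (L2_norm M (v w))\<^sup>2" .
          have "(\<Sum>j<n. (a j w)\<^sup>2 * h / (2 * (1 - \<eta>))) = (\<Sum>j<n. (a j w)\<^sup>2) * (h / (2 * (1 - \<eta>)))"
            unfolding sum_distrib_right by (simp only: times_divide_eq_right)
          also have "\<dots> \<le> 4 * B\<^sup>2 * Q * (L2_norm M (v w))\<^sup>2 * (h / (2 * (1 - \<eta>)))"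
            using a2 h eta by (intro mult_right_mono) auto
          also have "\<dots> = (B * h * (L2_norm M (v w))\<^sup>2 / (1 - \<eta>)) * (2 * B * Q)"
            using eta by (simp add: field_simps power2_eq_square)
          also have "\<dots> \<le> (B * h * (L2_norm M (v w))\<^sup>2 / (1 - \<eta>)) * ((1 - \<eta>) * \<rho>)"
            using rho B h eta by (intro mult_left_mono) (auto simp: Q_def)
          also have "\<dots> = B * \<rho> * h * (L2_norm M (v w))\<^sup>2"
            using eta by (simp add: field_simps)
          finally have 3: "(\<Sum>j<n. (a j w)\<^sup>2 * h / (2 * (1 - \<eta>))) \<le> B * \<rho> * h * (L2_norm M (v w))\<^sup>2" .
          have "(\<Sum>j<n. q j) \<le> Q"
            unfolding Q_def using q by (intro sum_le_suminf) (auto intro: less_imp_le)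
          then have "2 * B * h * (\<Sum>j<n. q j) \<le> 2 * B * h * Q" using B h by (intro mult_left_mono) auto
          then have 4: "(\<Sum>j<n. 2 * (B * q j) * h) \<le> 2 * B * Q * h"
            by (simp add: sum_distrib_left mult_ac)
          have 5: "(\<Sum>j<n. a j w * \<xi> (\<iota> j) w) = 2 * B * L2_inner M (S n) (v w)"
            unfolding 1 by (simp add: a_def sum_distrib_left mult_ac)
          have 6: "(\<Sum>j<n. B * q j * (\<xi> (\<iota> j) w)\<^sup>2) = B * (L2_norm M (S n))\<^sup>2"
            unfolding 2 by (simp add: sum_distrib_left mult_ac)
          show ?thesis
            unfolding sum_subtractf sum.distrib 5 6 x_def using 3 4 by (simp add: algebra_simps)
        qed
        ultimately show ?thesis by (simp add: ennreal_leI)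
      qed
      have "(\<lambda>n. ennreal (exp (x n))) \<longlonglongrightarrow> ennreal (exp (B * (2 * L2_inner M dW (v w) + (L2_norm M dW)\<^sup>2 - \<rho> * h * (L2_norm M (v w))\<^sup>2) - 2 * B * Q * h))"
        by (intro tendsto_ennrealI tendsto_exp xlim)
      from lim_imp_Liminf[OF sequentially_bot this]
      have "ennreal (exp (B * (2 * L2_inner M dW (v w) + (L2_norm M dW)\<^sup>2 - \<rho> * h * (L2_norm M (v w))\<^sup>2) - 2 * B * Q * h)) = liminf (\<lambda>n. ennreal (exp (x n)))" ..
      also have "\<dots> \<le> D w" unfolding D_def by (intro Liminf_mono always_eventually allI le)
      finally show ?case by (simp add: dW_def[abs_def] h_def Q_def)
    qed
  qed
  show thesis by (rule that[OF Dm super lower])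
qed

text \<open>The strict inequality \<open>rho\<close> leaves a margin that is spent twice: on an
  exponent \<open>B'\<close> larger than \<open>B\<close>, as the maximal inequality loses a power
  \<open>s < 1\<close>, and on the factor \<open>1 - \<eta>\<close> from the Gaussian integral. The
  constant depends neither on \<open>N\<close> nor on the process \<open>v\<close>.\<close>

lemma noise_exponential_estimate:
  fixes b :: "'i \<Rightarrow> real \<Rightarrow> 'w \<Rightarrow> real" and W :: "real \<Rightarrow> 'w \<Rightarrow> 'a \<Rightarrow> 'b::euclidean_space"
  assumes PF: "filtered_prob_space P F" and ibm: "independent_brownian_motions P F b" and inj: "inj \<iota>"
    and ns: "noise_series P M X q e (\<lambda>j. b (\<iota> j)) W"
    and co: "complete_orthonormal M X e" and X: "X \<subseteq> L2 M"
    and q: "\<And>j. q j > 0" "summable q"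
    and T: "T > 0" and B: "B > 0" and rho: "2 * B * suminf q < \<rho>"
  shows "\<exists>C\<ge>0. \<forall>\<^sub>F N in sequentially. \<forall>v.
    (\<forall>l<N. v l \<in> F (real l * (T / real N)) \<rightarrow>\<^sub>M L2_borel M X) \<longrightarrow>
    (\<exists>R\<in>borel_measurable P. (\<integral>\<^sup>+w. R w \<partial>P) \<le> ennreal C \<and>
      (AE w in P. \<forall>n\<le>N. ennreal (exp (B * (\<Sum>l=1..n.
         2 * L2_inner M (\<lambda>x. W (real l * (T / real N)) w x - W (real (l - 1) * (T / real N)) w x) (v (l - 1) w)
         + (L2_norm M (\<lambda>x. W (real l * (T / real N)) w x - W (real (l - 1) * (T / real N)) w x))\<^sup>2
         - \<rho> * (T / real N) * (L2_norm M (v (l - 1) w))\<^sup>2))) \<le> R w))"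
proof -
  interpret prob_space P using PF by (simp add: filtered_prob_space_def)
  define Q where "Q = suminf q"
  have Q: "Q > 0" unfolding Q_def using q by (intro suminf_pos)
  define r where "r = 2 * B * Q / \<rho>"
  have rho0: "\<rho> > 0" using rho B Q unfolding Q_def[symmetric]
    by (meson less_trans mult_pos_pos zero_less_numeral)
  have r: "0 < r" "r < 1" using rho rho0 B Q unfolding r_def Q_def[symmetric] by auto
  \<comment> \<open>The two losses together are \<open>(1 - \<eta>)^2 = r + \<eta>^2\<close>, which
    still exceeds \<open>r\<close>.\<close>
  define \<eta> where "\<eta> = (1 - r) / 2"
  define s where "s = 1 - \<eta>"
  have s: "0 < s" "s < 1" and \<eta>: "0 < \<eta>" "\<eta> \<le> 1/2" using r by (auto simp: s_def \<eta>_def)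
  define B' where "B' = B / s"
  have B': "B' > 0" using B s by (simp add: B'_def)
  have rs: "2 * B' * Q \<le> (1 - \<eta>) * \<rho>"
  proof -
    have "r \<le> s * (1 - \<eta>)"
    proof -
      have "s * (1 - \<eta>) = (1 - \<eta>)\<^sup>2" by (simp add: s_def power2_eq_square)
      also have "\<dots> = 1 - 2 * \<eta> + \<eta>\<^sup>2" by (simp add: power2_diff)
      also have "\<dots> = r + \<eta>\<^sup>2" by (simp add: \<eta>_def field_simps)
      finally show ?thesis by simp
    qed
    then have "2 * B * Q \<le> s * (1 - \<eta>) * \<rho>" using rho0 unfolding r_def by (simp add: divide_le_eq)
    then show ?thesis using s by (simp add: B'_def divide_le_eq mult_ac)
  qed
  define C where "C = exp (2 * B * Q * T) * (1 + exp s / (1 - exp (s - 1)))"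
  have C: "C \<ge> 0" using s by (simp add: C_def)
  have "\<forall>\<^sub>F N in sequentially. N \<ge> 1 \<and> 2 * B' * Q * (T / real N) \<le> \<eta>"
  proof -
    have "(\<lambda>N. 2 * B' * Q * (T / real N)) \<longlonglongrightarrow> 2 * B' * Q * 0"
      by (intro tendsto_intros lim_const_over_n)
    then have "\<forall>\<^sub>F N in sequentially. 2 * B' * Q * (T / real N) < \<eta>"
      using \<eta> by (intro order_tendstoD(2)) auto
    then show ?thesis using eventually_ge_at_top[of 1] by eventually_elim auto
  qed
  then have "\<forall>\<^sub>F N in sequentially. \<forall>v.
    (\<forall>l<N. v l \<in> F (real l * (T / real N)) \<rightarrow>\<^sub>M L2_borel M X) \<longrightarrow>
    (\<exists>R\<in>borel_measurable P. (\<integral>\<^sup>+w. R w \<partial>P) \<le> ennreal C \<and>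
      (AE w in P. \<forall>n\<le>N. ennreal (exp (B * (\<Sum>l=1..n.
         2 * L2_inner M (\<lambda>x. W (real l * (T / real N)) w x - W (real (l - 1) * (T / real N)) w x) (v (l - 1) w)
         + (L2_norm M (\<lambda>x. W (real l * (T / real N)) w x - W (real (l - 1) * (T / real N)) w x))\<^sup>2
         - \<rho> * (T / real N) * (L2_norm M (v (l - 1) w))\<^sup>2))) \<le> R w))"
  proof (eventually_elim, intro allI impI, elim conjE)
    fix N :: nat and v :: "nat \<Rightarrow> 'w \<Rightarrow> 'a \<Rightarrow> 'b"
    assume v: "\<forall>l<N. v l \<in> F (real l * (T / real N)) \<rightarrow>\<^sub>M L2_borel M X"
      and N: "1 \<le> N" and small: "2 * B' * Q * (T / real N) \<le> \<eta>"
    define h where "h = T / real N"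
    have h: "h > 0" "real N * h = T" using T N by (auto simp: h_def)
    define y where "y l w = 2 * L2_inner M (\<lambda>x. W (real l * h) w x - W (real (l - 1) * h) w x) (v (l - 1) w)
         + (L2_norm M (\<lambda>x. W (real l * h) w x - W (real (l - 1) * h) w x))\<^sup>2
         - \<rho> * h * (L2_norm M (v (l - 1) w))\<^sup>2" for l w
    have "\<exists>D. D \<in> borel_measurable (F (real (Suc n) * h)) \<and>
        (\<forall>Y :: 'w \<Rightarrow> ennreal. Y \<in> borel_measurable (F (real n * h)) \<longrightarrow> (\<integral>\<^sup>+w. Y w * D w \<partial>P) \<le> (\<integral>\<^sup>+w. Y w \<partial>P)) \<and>
        (AE w in P. ennreal (exp (B' * y (Suc n) w - 2 * B' * Q * h)) \<le> D w)" if n: "n < N" for n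
    proof -
      have d: "real (Suc n) * h - real n * h = h" by (simp add: algebra_simps)
      have t: "0 \<le> real n * h" "real n * h < real (Suc n) * h" using h by auto
      have small': "2 * B' * suminf q * (real (Suc n) * h - real n * h) \<le> \<eta>"
        unfolding d using small by (simp only: h_def Q_def)
      have vn: "v n \<in> F (real n * h) \<rightarrow>\<^sub>M L2_borel M X" using v n by (simp add: h_def)
      obtain D where "D \<in> borel_measurable (F (real (Suc n) * h))"
        "\<And>Y :: 'w \<Rightarrow> ennreal. Y \<in> borel_measurable (F (real n * h)) \<Longrightarrow> (\<integral>\<^sup>+w. Y w * D w \<partial>P) \<le> (\<integral>\<^sup>+w. Y w \<partial>P)"
        "AE w in P. ennreal (exp (B' * y (Suc n) w - 2 * B' * Q * h)) \<le> D w"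
        using noise_step[OF PF ibm inj ns co X q t B' small' \<eta>(2) rs[unfolded Q_def] vn]
        unfolding d Q_def[symmetric] y_def diff_Suc_1 by blast
      then show ?thesis by blast
    qed
    then have "\<forall>n. \<exists>D. n < N \<longrightarrow> D \<in> borel_measurable (F (real (Suc n) * h)) \<and>
        (\<forall>Y :: 'w \<Rightarrow> ennreal. Y \<in> borel_measurable (F (real n * h)) \<longrightarrow> (\<integral>\<^sup>+w. Y w * D w \<partial>P) \<le> (\<integral>\<^sup>+w. Y w \<partial>P)) \<and>
        (AE w in P. ennreal (exp (B' * y (Suc n) w - 2 * B' * Q * h)) \<le> D w)"
      by blast
    from choice[OF this] obtain D0 where D0: "\<forall>n. n < N \<longrightarrow> D0 n \<in> borel_measurable (F (real (Suc n) * h)) \<and>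
        (\<forall>Y :: 'w \<Rightarrow> ennreal. Y \<in> borel_measurable (F (real n * h)) \<longrightarrow> (\<integral>\<^sup>+w. Y w * D0 n w \<partial>P) \<le> (\<integral>\<^sup>+w. Y w \<partial>P)) \<and>
        (AE w in P. ennreal (exp (B' * y (Suc n) w - 2 * B' * Q * h)) \<le> D0 n w)"
      by blast
    \<comment> \<open>\<open>D0 n\<close> belongs to the step that starts at \<open>n\<close>;
      \<open>D l\<close> is indexed by the end of its step, as in the product from 1 to
      \<open>n\<close>.\<close>
    define D where "D l = D0 (l - 1)" for l
    have D: "\<And>n. n < N \<Longrightarrow> D (Suc n) \<in> borel_measurable (F (real (Suc n) * h))"
      "\<And>n Y. n < N \<Longrightarrow> Y \<in> borel_measurable (F (real n * h)) \<Longrightarrow> (\<integral>\<^sup>+w. Y w * D (Suc n) w \<partial>P) \<le> (\<integral>\<^sup>+w. Y w \<partial>P)"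
      "\<And>n. n < N \<Longrightarrow> AE w in P. ennreal (exp (B' * y (Suc n) w - 2 * B' * Q * h)) \<le> D (Suc n) w"
      unfolding D_def diff_Suc_1 using D0 by blast+
    define Z where "Z n w = (\<Prod>l=1..n. D l w)" for n w
    have sub: "subalgebra P (F (real n * h))" "m \<le> n \<Longrightarrow> subalgebra (F (real n * h)) (F (real m * h))" for m n
      using PF h by (auto simp: filtered_prob_space_def mult_right_mono)
    have max: "x * emeasure P {w \<in> space P. \<exists>n\<le>N. x \<le> Z n w} \<le> 1" for x
      unfolding Z_def
      by (rule supermartingale_maximal_inequality(1)[where Fl = "\<lambda>n. F (real n * h)"]) (assumption | rule sub D)+
    have Zm: "Z n \<in> borel_measurable P" if "n \<le> N" for n
      unfolding Z_def[abs_def]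
      by (rule supermartingale_maximal_inequality(2)[where Fl = "\<lambda>n. F (real n * h)", OF _ _ _ _ that])
         (assumption | rule sub D)+
    obtain R where R: "R \<in> borel_measurable P" "(\<integral>\<^sup>+w. R w \<partial>P) \<le> ennreal (1 + exp s / (1 - exp (s - 1)))"
      "\<And>w n r. w \<in> space P \<Longrightarrow> n \<le> N \<Longrightarrow> ennreal (exp r) \<le> Z n w \<Longrightarrow> ennreal (exp (s * r)) \<le> R w"
      by (rule maximal_exponential_moment[OF Zm max s]) (assumption | rule that)+
    define R' where "R' w = ennreal (exp (2 * B * Q * T)) * R w" for w
    have R'm: "R' \<in> borel_measurable P" unfolding R'_def using R(1) by measurable
    have R'int: "(\<integral>\<^sup>+w. R' w \<partial>P) \<le> ennreal C"
    proof -
      have "(\<integral>\<^sup>+w. R' w \<partial>P) = ennreal (exp (2 * B * Q * T)) * (\<integral>\<^sup>+w. R w \<partial>P)"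
        unfolding R'_def by (rule nn_integral_cmult[OF R(1)])
      also have "\<dots> \<le> ennreal (exp (2 * B * Q * T)) * ennreal (1 + exp s / (1 - exp (s - 1)))"
        by (intro mult_left_mono R(2)) simp
      also have "\<dots> = ennreal C" unfolding C_def by (rule ennreal_mult'[symmetric]) simp
      finally show ?thesis .
    qed
    have "AE w in P. \<forall>n\<in>{..<N}. ennreal (exp (B' * y (Suc n) w - 2 * B' * Q * h)) \<le> D (Suc n) w"
      using D(3) by (intro AE_finite_allI) auto
    then have "AE w in P. \<forall>n\<le>N. ennreal (exp (B * (\<Sum>l=1..n. y l w))) \<le> R' w"
      using AE_space
    proof eventually_elim
      case (elim w)
      show ?case
      proof (intro allI impI)
        fix n assume n: "n \<le> N"
        \<comment> \<open>The trace compensators of the \<open>n\<close> steps add up to at most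
          \<open>2 * B' * Q * T\<close>; after multiplication by \<open>s\<close>, which turns
          \<open>B'\<close> into \<open>B\<close>, they give the factor
          \<open>exp (2 * B * Q * T)\<close> in \<open>R'\<close>.\<close>
        define x where "x = (\<Sum>l=1..n. B' * y l w - 2 * B' * Q * h)"
        have "ennreal (exp x) = (\<Prod>l=1..n. ennreal (exp (B' * y l w - 2 * B' * Q * h)))"
          by (simp add: x_def exp_sum prod_ennreal)
        also have "\<dots> \<le> Z n w"
          unfolding Z_def
        proof (rule prod_mono_ennreal)
          fix l assume "l \<in> {1..n}"
          then obtain m where "l = Suc m" "m < N" using n by (cases l) auto
          then show "ennreal (exp (B' * y l w - 2 * B' * Q * h)) \<le> D l w" using elim by auto
        qed
        finally have le: "ennreal (exp (s * x)) \<le> R w" using R(3)[OF elim(2) n] by blast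
        have "s * x = (s * B') * (\<Sum>l=1..n. y l w) - 2 * (s * B') * Q * (real n * h)"
          by (simp add: x_def sum_subtractf sum_distrib_left[symmetric] algebra_simps)
        also have "s * B' = B" using s by (simp add: B'_def)
        finally have sx: "B * (\<Sum>l=1..n. y l w) = 2 * B * Q * (real n * h) + s * x" by simp
        have "real n * h \<le> T" unfolding h(2)[symmetric] using n h(1) by (intro mult_right_mono) auto
        then have "2 * B * Q * (real n * h) \<le> 2 * B * Q * T" using B Q by (intro mult_left_mono) auto
        then have "ennreal (exp (B * (\<Sum>l=1..n. y l w))) \<le> ennreal (exp (2 * B * Q * T)) * ennreal (exp (s * x))"
          unfolding sx by (simp add: ennreal_mult[symmetric] exp_add[symmetric] ennreal_leI)
        also have "\<dots> \<le> R' w" unfolding R'_def by (intro mult_left_mono le) simp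
        finally show "ennreal (exp (B * (\<Sum>l=1..n. y l w))) \<le> R' w" .
      qed
    qed
    with R'm R'int show "\<exists>R\<in>borel_measurable P. (\<integral>\<^sup>+w. R w \<partial>P) \<le> ennreal C \<and>
      (AE w in P. \<forall>n\<le>N. ennreal (exp (B * (\<Sum>l=1..n.
         2 * L2_inner M (\<lambda>x. W (real l * (T / real N)) w x - W (real (l - 1) * (T / real N)) w x) (v (l - 1) w)
         + (L2_norm M (\<lambda>x. W (real l * (T / real N)) w x - W (real (l - 1) * (T / real N)) w x))\<^sup>2
         - \<rho> * (T / real N) * (L2_norm M (v (l - 1) w))\<^sup>2))) \<le> R w)"
      unfolding h_def[symmetric] y_def[symmetric] by (intro bexI[of _ R'] conjI)
  qed
  with C show ?thesis by blast
qed

section \<open>Exponential moments of the scheme\<close>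

text \<open>\<open>lam 0\<close> bounds the eigenvalues from below, so the standing assumption on
  the noise makes its trace finite.\<close>

lemma summable_spectral_weight:
  fixes lam q :: "nat \<Rightarrow> real"
  assumes "mono lam" "lam 0 > 0" "\<And>j. q j \<ge> 0" "summable (\<lambda>j. lam j * q j)"
  shows "summable q"
proof (rule summable_comparison_test')
  show "summable (\<lambda>j. (lam j * q j) / lam 0)" using assms(4) by (rule summable_divide)
  show "norm (q j) \<le> (lam j * q j) / lam 0" if "0 \<le> j" for j
    using assms(2,3) monoD[OF assms(1), of 0 j] by (simp add: le_divide_eq mult.commute mult_right_mono)
qed

text \<open>Each exponential lies above its tangent at the weighted mean. Used pathwise in the role
  of Hoelder's inequality: the four contributions are separated without any independence among
  them.\<close>

lemma exp_convex_combination4: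
  fixes x1 x2 x3 x4 :: real
  assumes "w1 \<ge> 0" "w2 \<ge> 0" "w3 \<ge> 0" "w4 \<ge> 0" and sum: "w1 + w2 + w3 + w4 = 1"
  shows "exp (w1 * x1 + w2 * x2 + w3 * x3 + w4 * x4) \<le> w1 * exp x1 + w2 * exp x2 + w3 * exp x3 + w4 * exp x4"
proof -
  define m where "m = w1 * x1 + w2 * x2 + w3 * x3 + w4 * x4"
  have tangent: "exp m * (1 + (x - m)) \<le> exp x" for x
  proof -
    have "exp m * (1 + (x - m)) \<le> exp m * exp (x - m)" by (intro mult_left_mono exp_ge_add_one_self) simp
    then show ?thesis by (simp add: exp_add[symmetric])
  qed
  have "exp m = exp m * ((w1 + w2 + w3 + w4) + (m - (w1 + w2 + w3 + w4) * m))"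
    by (simp add: sum)
  also have "\<dots> = w1 * (exp m * (1 + (x1 - m))) + w2 * (exp m * (1 + (x2 - m)))
      + w3 * (exp m * (1 + (x3 - m))) + w4 * (exp m * (1 + (x4 - m)))"
    unfolding m_def by (simp add: algebra_simps)
  also have "\<dots> \<le> w1 * exp x1 + w2 * exp x2 + w3 * exp x3 + w4 * exp x4"
    by (intro add_mono mult_left_mono tangent assms)
  finally show ?thesis by (simp add: m_def)
qed

text \<open>
  The buoyancy term is controlled by the maximum of \<open>Th\<close>, attained at some step \<open>m\<close>; the damping terms
  \<open>r U\<close> and \<open>r' Th\<close> at the new step are carried over to the previous one, which costs \<open>h r U 0\<close> and \<open>h r' Th 0\<close>.
\<close>

lemma discrete_energy_bound:
  fixes U Th p m3 m4 :: "nat \<Rightarrow> real"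
  assumes h: "h > 0" and nonneg: "\<And>n. U n \<ge> 0" "\<And>n. Th n \<ge> 0" and c: "c \<ge> 0" and r: "r \<ge> 0" "r' \<ge> 0"
    and U: "\<And>n. n < N \<Longrightarrow> U (Suc n) + h * \<nu> * p (Suc n) + h * r * U (Suc n) \<le> U n + m3 (Suc n) + h * c * Th n"
    and Th: "\<And>n. n < N \<Longrightarrow> Th (Suc n) + h * r' * Th (Suc n) \<le> Th n + m4 (Suc n)"
    and n: "n \<le> N"
  obtains m where "m \<le> N"
    "U n + h * \<nu> * (\<Sum>l=1..n. p l) \<le> (1 + h * r) * U 0 + (\<Sum>l=1..n. m3 l - r * h * U (l - 1))
      + c * (real N * h) * ((1 + h * r') * Th 0 + (\<Sum>l=1..m. m4 l - r' * h * Th (l - 1)))"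
proof -
  have Th_n: "(1 + h * r') * Th n \<le> (1 + h * r') * Th 0 + (\<Sum>l=1..n. m4 l - r' * h * Th (l - 1))" if "n \<le> N" for n
    using that
  proof (induction n)
    case (Suc n)
    then show ?case using Th[of n] by (simp add: algebra_simps)
  qed simp
  have U_n: "(1 + h * r) * U n + h * \<nu> * (\<Sum>l=1..n. p l) \<le> (1 + h * r) * U 0 + (\<Sum>l=1..n. m3 l - r * h * U (l - 1))
      + h * c * (\<Sum>l<n. Th l)" if "n \<le> N" for n
    using that
  proof (induction n)
    case (Suc n)
    then show ?case using U[of n] by (simp add: algebra_simps)
  qed simp
  have "Max (Th ` {..N}) \<in> Th ` {..N}" by (rule Max_in) auto
  then obtain m where m: "m \<le> N" "Max (Th ` {..N}) = Th m" unfolding image_iff by blast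
  have le: "Th l \<le> Th m" if "l \<le> N" for l
    unfolding m(2)[symmetric] using that by (intro Max_ge) auto
  have "(\<Sum>l<n. Th l) \<le> (\<Sum>l<n. Th m)" using n by (intro sum_mono le) auto
  also have "\<dots> \<le> real N * Th m" using n nonneg by (simp add: mult_right_mono)
  finally have "h * c * (\<Sum>l<n. Th l) \<le> h * c * (real N * Th m)" using h c by (intro mult_left_mono) auto
  also have "\<dots> = c * (real N * h) * Th m" by simp
  also have "\<dots> \<le> c * (real N * h) * ((1 + h * r') * Th 0 + (\<Sum>l=1..m. m4 l - r' * h * Th (l - 1)))"
  proof (rule mult_left_mono)
    have "Th m \<le> (1 + h * r') * Th m" using h r nonneg(2)[of m] by (simp add: distrib_right)
    then show "Th m \<le> (1 + h * r') * Th 0 + (\<Sum>l=1..m. m4 l - r' * h * Th (l - 1))"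
      using Th_n[OF m(1)] by linarith
  qed (use h c in simp)
  finally have b: "h * c * (\<Sum>l<n. Th l) \<le> c * (real N * h) * ((1 + h * r') * Th 0 + (\<Sum>l=1..m. m4 l - r' * h * Th (l - 1)))" .
  have "U n \<le> (1 + h * r) * U n" using h r nonneg(1)[of n] by (simp add: distrib_right)
  with U_n[OF n] b show thesis by (intro that[OF m(1)]) linarith
qed

section \<open>Exponential moments for random and for deterministic initial data\<close>

theorem proposition5p3:
  fixes L T \<nu> \<kappa> :: real
    and lam lamt q qt :: "nat \<Rightarrow> real"
    and \<zeta> :: "nat \<Rightarrow> vector_field" and \<zeta>t :: "nat \<Rightarrow> scalar_field"
    and P :: "'w measure" and F :: "real \<Rightarrow> 'w measure"
    and \<beta> \<beta>t :: "nat \<Rightarrow> real \<Rightarrow> 'w \<Rightarrow> real"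
    and W :: "real \<Rightarrow> 'w \<Rightarrow> vector_field" and Wt :: "real \<Rightarrow> 'w \<Rightarrow> scalar_field"
  assumes "L > 0" and "T > 0" and "\<nu> > 0" and "\<kappa> > 0"
    and "mono lam" and "lam 0 > 0" and "\<And>j. stokes L (\<zeta> j) (\<lambda>x. lam j *\<^sub>R \<zeta> j x)"
    and "complete_orthonormal (square_measure L) (V0 L) \<zeta>"
    and "mono lamt" and "lamt 0 > 0" and "\<And>j. temp_op L (\<zeta>t j) (\<lambda>x. lamt j *\<^sub>R \<zeta>t j x)"
    and "complete_orthonormal (square_measure L) (H0 L) \<zeta>t"
    and "\<And>j. q j > 0" and "summable (\<lambda>j. lam j * q j)"
    and "\<And>j. qt j > 0" and "summable (\<lambda>j. lamt j * qt j)"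
    and "filtered_prob_space P F"
    and "independent_brownian_motions P F (case_sum \<beta> \<beta>t)"
    and "noise_series P (square_measure L) (V0 L) q \<zeta> \<beta> W"
    and "noise_series P (square_measure L) (H0 L) qt \<zeta>t \<beta>t Wt"
  defines "TrQ \<equiv> (\<Sum>j. q j)" and "TrQt \<equiv> (\<Sum>j. qt j)"
  shows
    "(\<forall>u0\<in>V0 L. \<forall>\<theta>0\<in>H0 L.
       \<forall>\<alpha>. 0 < \<alpha> \<and>
           \<alpha> < \<nu> * \<kappa> * lam 0 * lamt 0 / (4 * (2 * T * TrQt + \<kappa> * lamt 0 * TrQ)) \<longrightarrow>
         (\<exists>C. \<forall>\<^sub>F N in sequentially. \<forall>u \<theta>.
            euler_scheme L T \<nu> \<kappa> lamt \<zeta>t P F W Wt (\<lambda>_. u0) (\<lambda>_. \<theta>0) N u \<theta> \<longrightarrow>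
            integrable P (\<lambda>w. exp (\<alpha> * max_energy L T \<nu> lam \<zeta> N u w)) \<and>
            prob_space.expectation P (\<lambda>w. exp (\<alpha> * max_energy L T \<nu> lam \<zeta> N u w)) \<le> C))
    \<and>
    (\<forall>u0 \<theta>0 \<gamma> \<gamma>t.
       u0 \<in> F 0 \<rightarrow>\<^sub>M L2_borel (square_measure L) (V0 L) \<and>
       \<theta>0 \<in> F 0 \<rightarrow>\<^sub>M L2_borel (square_measure L) (H0 L) \<and>
       \<gamma> > 0 \<and> \<gamma>t > 0 \<and>
       integrable P (\<lambda>w. exp (\<gamma> * (L2_norm (square_measure L) (u0 w))\<^sup>2)) \<and>
       integrable P (\<lambda>w. exp (\<gamma>t * (L2_norm (square_measure L) (\<theta>0 w))\<^sup>2)) \<longrightarrow>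
       (\<forall>\<alpha>. 0 < \<alpha> \<and>
           \<alpha> < \<nu> * \<kappa> * lam 0 * lamt 0 /
               (4 * (2 * T * TrQt + \<kappa> * lamt 0 * TrQ)
                + 2 * \<kappa> * lamt 0 * T / \<gamma>t + \<nu> * \<kappa> * lam 0 * lamt 0 / \<gamma>) \<longrightarrow>
         (\<exists>C. \<forall>\<^sub>F N in sequentially. \<forall>u \<theta>.
            euler_scheme L T \<nu> \<kappa> lamt \<zeta>t P F W Wt u0 \<theta>0 N u \<theta> \<longrightarrow>
            integrable P (\<lambda>w. exp (\<alpha> * max_energy L T \<nu> lam \<zeta> N u w)) \<and>
            prob_space.expectation P (\<lambda>w. exp (\<alpha> * max_energy L T \<nu> lam \<zeta> N u w)) \<le> C)))"
proof -
  let ?M = "square_measure L"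
  interpret prob_space P using \<open>filtered_prob_space P F\<close> by (simp add: filtered_prob_space_def)
  note lam = \<open>mono lam\<close> \<open>lam 0 > 0\<close> and lamt = \<open>mono lamt\<close> \<open>lamt 0 > 0\<close>
  note pos = \<open>L > 0\<close> \<open>T > 0\<close> \<open>\<nu> > 0\<close> \<open>\<kappa> > 0\<close> lam(2) lamt(2)
  note co = \<open>complete_orthonormal ?M (V0 L) \<zeta>\<close> and cot = \<open>complete_orthonormal ?M (H0 L) \<zeta>t\<close>
  have q: "summable q" and qt: "summable qt"
    using summable_spectral_weight[OF lam] summable_spectral_weight[OF lamt] assms by (metis less_imp_le)+
  have Q: "TrQ > 0" and Qt: "TrQt > 0"
    unfolding TrQ_def TrQt_def using assms q qt by (auto intro!: suminf_pos)
  have sub: "subalgebra P (F t)" if "t \<ge> 0" for t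
    using \<open>filtered_prob_space P F\<close> that by (simp add: filtered_prob_space_def)
  \<comment> \<open>Both noises are driven by one independent family indexed by a sum type; the
    injections into it select the modes of each.\<close>
  have ns: "noise_series P ?M (V0 L) q \<zeta> (\<lambda>j. case_sum \<beta> \<beta>t (Inl j)) W"
    and nst: "noise_series P ?M (H0 L) qt \<zeta>t (\<lambda>j. case_sum \<beta> \<beta>t (Inr j)) Wt"
    using assms by simp_all
  have random: "\<exists>C. \<forall>\<^sub>F N in sequentially. \<forall>u \<theta>.
            euler_scheme L T \<nu> \<kappa> lamt \<zeta>t P F W Wt u0 \<theta>0 N u \<theta> \<longrightarrow>
            integrable P (\<lambda>w. exp (\<alpha> * max_energy L T \<nu> lam \<zeta> N u w)) \<and>
            expectation (\<lambda>w. exp (\<alpha> * max_energy L T \<nu> lam \<zeta> N u w)) \<le> C"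
    if u0: "u0 \<in> F 0 \<rightarrow>\<^sub>M L2_borel ?M (V0 L)" and \<theta>0: "\<theta>0 \<in> F 0 \<rightarrow>\<^sub>M L2_borel ?M (H0 L)"
      and \<gamma>: "\<gamma> > 0" "\<gamma>t > 0"
      and int: "integrable P (\<lambda>w. exp (\<gamma> * (L2_norm ?M (u0 w))\<^sup>2))"
        "integrable P (\<lambda>w. exp (\<gamma>t * (L2_norm ?M (\<theta>0 w))\<^sup>2))"
      and \<alpha>: "0 < \<alpha>" "\<alpha> < \<nu> * \<kappa> * lam 0 * lamt 0 / (4 * (2 * T * TrQt + \<kappa> * lamt 0 * TrQ)
                + 2 * \<kappa> * lamt 0 * T / \<gamma>t + \<nu> * \<kappa> * lam 0 * lamt 0 / \<gamma>)"
    for u0 :: "'w \<Rightarrow> vector_field" and \<theta>0 :: "'w \<Rightarrow> scalar_field" and \<gamma> \<gamma>t \<alpha> :: real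
  proof -
    \<comment> \<open>\<open>c\<close> is the constant that Young's inequality puts in front of the
      squared temperature. Each \<open>l\<close> below is the exponent demanded of one contribution
      divided by an exponent that it can bear; the last two concern the noises.\<close>
    define c where "c = 2 / (\<nu> * lam 0)"
    define l1 where "l1 = \<alpha> / \<gamma>"
    define l2 where "l2 = \<alpha> * c * T / \<gamma>t"
    define l3 where "l3 = 4 * \<alpha> * TrQ / (\<nu> * lam 0)"
    define l4 where "l4 = 4 * \<alpha> * c * T * TrQt / (\<kappa> * lamt 0)"
    define S where "S = l1 + l2 + l3 + l4"
    have c: "c > 0" using pos by (simp add: c_def)
    have l: "l1 > 0" "l2 > 0" "l3 > 0" "l4 > 0"
      using pos \<gamma> \<alpha>(1) Q Qt c by (simp_all add: l1_def l2_def l3_def l4_def)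
    have S0: "S > 0" using l by (simp add: S_def)
    \<comment> \<open>The denominator in the bound for \<open>\<alpha>\<close> is built so that
      \<open>S\<close> equals \<open>\<alpha> * den / num\<close>; being below the threshold means
      exactly that the four ratios sum to less than 1.\<close>
    have S1: "S < 1"
    proof -
      define num where "num = \<nu> * \<kappa> * lam 0 * lamt 0"
      define den where "den = 4 * (2 * T * TrQt + \<kappa> * lamt 0 * TrQ)
                + 2 * \<kappa> * lamt 0 * T / \<gamma>t + \<nu> * \<kappa> * lam 0 * lamt 0 / \<gamma>"
      have num: "num > 0" using pos by (simp add: num_def)
      have den: "den > 0" unfolding den_def using pos \<gamma> Q Qt
        by (intro add_pos_pos mult_pos_pos divide_pos_pos) auto
      have "S = \<alpha> * den / num"
        unfolding S_def l1_def l2_def l3_def l4_def c_def num_def den_def using pos \<gamma> by (simp add: field_simps)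
      also have "\<dots> < 1"
      proof -
        have "\<alpha> < num / den" using \<alpha>(2) by (simp only: num_def den_def)
        then show ?thesis using num den by (simp add: pos_less_divide_eq)
      qed
      finally show ?thesis .
    qed
    \<comment> \<open>Weights proportional to the ratios leave the same relative margin
      \<open>S\<close> in all four contributions; for instance
      \<open>\<alpha> / w1 = S * \<gamma>\<close>.\<close>
    define w1 where "w1 = l1 / S"
    define w2 where "w2 = l2 / S"
    define w3 where "w3 = l3 / S"
    define w4 where "w4 = l4 / S"
    have w: "w1 > 0" "w2 > 0" "w3 > 0" "w4 > 0" using l S0 by (simp_all add: w1_def w2_def w3_def w4_def)
    have wsum: "w1 + w2 + w3 + w4 = 1"
      using S0 unfolding w1_def w2_def w3_def w4_def add_divide_distrib[symmetric] by (simp add: S_def)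
    define r3 where "r3 = \<nu> * lam 0 / 2"
    define r4 where "r4 = 2 * \<kappa> * lamt 0"
    have r: "r3 > 0" "r4 > 0" using pos by (simp_all add: r3_def r4_def)
    define B3 where "B3 = \<alpha> / w3"
    define B4 where "B4 = \<alpha> * c * T / w4"
    have B: "B3 > 0" "B4 > 0" using \<alpha>(1) w c pos by (simp_all add: B3_def B4_def)
    have B3: "2 * B3 * suminf q < r3"
    proof -
      have "2 * B3 * TrQ = S * r3"
        using pos Q \<alpha>(1) S0 by (simp add: B3_def w3_def l3_def r3_def field_simps)
      then show ?thesis using S1 r by (simp add: TrQ_def)
    qed
    \<comment> \<open>With the 4 in \<open>l4\<close> the left side is only a quarter of
      \<open>S * r4\<close>, while the velocity noise has \<open>S * r3\<close> exactly: the
      temperature keeps its entire dissipation as damping.\<close>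
    have B4: "2 * B4 * suminf qt < r4"
    proof -
      have "2 * B4 * TrQt = S * (r4 / 4)"
        using pos Qt \<alpha>(1) S0 c by (simp add: B4_def w4_def l4_def r4_def field_simps)
      also have "\<dots> < 1 * r4" using S1 S0 r by (intro mult_strict_mono) auto
      finally show ?thesis by (simp add: TrQt_def)
    qed
    from noise_exponential_estimate[OF \<open>filtered_prob_space P F\<close> \<open>independent_brownian_motions P F (case_sum \<beta> \<beta>t)\<close>
        inj_Inl ns co V0_L2 \<open>\<And>j. q j > 0\<close> q \<open>T > 0\<close> B(1) B3]
    obtain C3 where C3: "C3 \<ge> 0" and ev3: "\<forall>\<^sub>F N in sequentially. \<forall>v.
    (\<forall>l<N. v l \<in> F (real l * (T / real N)) \<rightarrow>\<^sub>M L2_borel ?M (V0 L)) \<longrightarrow>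
    (\<exists>R\<in>borel_measurable P. (\<integral>\<^sup>+w. R w \<partial>P) \<le> ennreal C3 \<and>
      (AE w in P. \<forall>n\<le>N. ennreal (exp (B3 * (\<Sum>l=1..n.
         2 * L2_inner ?M (\<lambda>x. W (real l * (T / real N)) w x - W (real (l - 1) * (T / real N)) w x) (v (l - 1) w)
         + (L2_norm ?M (\<lambda>x. W (real l * (T / real N)) w x - W (real (l - 1) * (T / real N)) w x))\<^sup>2
         - r3 * (T / real N) * (L2_norm ?M (v (l - 1) w))\<^sup>2))) \<le> R w))"
      by blast
    from noise_exponential_estimate[OF \<open>filtered_prob_space P F\<close> \<open>independent_brownian_motions P F (case_sum \<beta> \<beta>t)\<close>
        inj_Inr nst cot order_refl \<open>\<And>j. qt j > 0\<close> qt \<open>T > 0\<close> B(2) B4]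
    obtain C4 where C4: "C4 \<ge> 0" and ev4: "\<forall>\<^sub>F N in sequentially. \<forall>v.
    (\<forall>l<N. v l \<in> F (real l * (T / real N)) \<rightarrow>\<^sub>M L2_borel ?M (H0 L)) \<longrightarrow>
    (\<exists>R\<in>borel_measurable P. (\<integral>\<^sup>+w. R w \<partial>P) \<le> ennreal C4 \<and>
      (AE w in P. \<forall>n\<le>N. ennreal (exp (B4 * (\<Sum>l=1..n.
         2 * L2_inner ?M (\<lambda>x. Wt (real l * (T / real N)) w x - Wt (real (l - 1) * (T / real N)) w x) (v (l - 1) w)
         + (L2_norm ?M (\<lambda>x. Wt (real l * (T / real N)) w x - Wt (real (l - 1) * (T / real N)) w x))\<^sup>2
         - r4 * (T / real N) * (L2_norm ?M (v (l - 1) w))\<^sup>2))) \<le> R w))"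
      by blast
    define C1 where "C1 = expectation (\<lambda>w. exp (\<gamma> * (L2_norm ?M (u0 w))\<^sup>2))"
    define C2 where "C2 = expectation (\<lambda>w. exp (\<gamma>t * (L2_norm ?M (\<theta>0 w))\<^sup>2))"
    have C12: "C1 \<ge> 0" "C2 \<ge> 0" by (simp_all add: C1_def C2_def)
    define C where "C = w1 * C1 + w2 * C2 + w3 * C3 + w4 * C4"
    \<comment> \<open>Moving the damping to the previous iterate multiplies the initial energies by
      \<open>1 + h * r\<close>; for large \<open>N\<close> the margin \<open>S < 1\<close> absorbs
      this factor.\<close>
    have small: "\<forall>\<^sub>F N in sequentially. S * (1 + T / real N * r) \<le> 1" for r
    proof -
      have "(\<lambda>N. S * (1 + T / real N * r)) \<longlonglongrightarrow> S * (1 + 0 * r)"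
        by (intro tendsto_intros lim_const_over_n)
      then have "\<forall>\<^sub>F N in sequentially. S * (1 + T / real N * r) < 1"
        using S1 by (intro order_tendstoD(2)) auto
      then show ?thesis by (rule eventually_mono) simp
    qed
    have "\<forall>\<^sub>F N in sequentially. \<forall>u \<theta>.
            euler_scheme L T \<nu> \<kappa> lamt \<zeta>t P F W Wt u0 \<theta>0 N u \<theta> \<longrightarrow>
            integrable P (\<lambda>w. exp (\<alpha> * max_energy L T \<nu> lam \<zeta> N u w)) \<and>
            expectation (\<lambda>w. exp (\<alpha> * max_energy L T \<nu> lam \<zeta> N u w)) \<le> C"
      using ev3 ev4 small[of r3] small[of r4] eventually_ge_at_top[of 1]
    proof (eventually_elim, intro allI impI)
      fix N :: nat and u :: "nat \<Rightarrow> 'w \<Rightarrow> vector_field" and \<theta> :: "nat \<Rightarrow> 'w \<Rightarrow> scalar_field"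
      define h where "h = T / real N"
      define dW where "dW l w x = W (real l * h) w x - W (real (l - 1) * h) w x" for l w x
      define dWt where "dWt l w x = Wt (real l * h) w x - Wt (real (l - 1) * h) w x" for l w x
      assume R3: "\<forall>v. (\<forall>l<N. v l \<in> F (real l * (T / real N)) \<rightarrow>\<^sub>M L2_borel ?M (V0 L)) \<longrightarrow>
    (\<exists>R\<in>borel_measurable P. (\<integral>\<^sup>+w. R w \<partial>P) \<le> ennreal C3 \<and>
      (AE w in P. \<forall>n\<le>N. ennreal (exp (B3 * (\<Sum>l=1..n.
         2 * L2_inner ?M (\<lambda>x. W (real l * (T / real N)) w x - W (real (l - 1) * (T / real N)) w x) (v (l - 1) w)
         + (L2_norm ?M (\<lambda>x. W (real l * (T / real N)) w x - W (real (l - 1) * (T / real N)) w x))\<^sup>2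
         - r3 * (T / real N) * (L2_norm ?M (v (l - 1) w))\<^sup>2))) \<le> R w))"
      and R4: "\<forall>v. (\<forall>l<N. v l \<in> F (real l * (T / real N)) \<rightarrow>\<^sub>M L2_borel ?M (H0 L)) \<longrightarrow>
    (\<exists>R\<in>borel_measurable P. (\<integral>\<^sup>+w. R w \<partial>P) \<le> ennreal C4 \<and>
      (AE w in P. \<forall>n\<le>N. ennreal (exp (B4 * (\<Sum>l=1..n.
         2 * L2_inner ?M (\<lambda>x. Wt (real l * (T / real N)) w x - Wt (real (l - 1) * (T / real N)) w x) (v (l - 1) w)
         + (L2_norm ?M (\<lambda>x. Wt (real l * (T / real N)) w x - Wt (real (l - 1) * (T / real N)) w x))\<^sup>2
         - r4 * (T / real N) * (L2_norm ?M (v (l - 1) w))\<^sup>2))) \<le> R w))"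
      and s3: "S * (1 + T / real N * r3) \<le> 1" and s4: "S * (1 + T / real N * r4) \<le> 1" and N: "1 \<le> N"
      and eul: "euler_scheme L T \<nu> \<kappa> lamt \<zeta>t P F W Wt u0 \<theta>0 N u \<theta>"
      have h: "h > 0" "real N * h = T" using N pos by (auto simp: h_def)
      have init: "w \<in> space P \<Longrightarrow> u 0 w = u0 w" "w \<in> space P \<Longrightarrow> \<theta> 0 w = \<theta>0 w" for w
        using eul by (auto simp: euler_scheme_def Let_def)
      \<comment> \<open>The scheme states measurability from \<open>l = 1\<close> on; at
        \<open>l = 0\<close> it comes from the initial data, with which the iterates agree on the
        sample space.\<close>
      have meas: "u l \<in> F (real l * h) \<rightarrow>\<^sub>M L2_borel ?M (V0 L)" "\<theta> l \<in> F (real l * h) \<rightarrow>\<^sub>M L2_borel ?M (H0 L)"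
        if "l \<le> N" for l
      proof -
        have sp: "space (F 0) = space P" using sub[of 0] by (simp add: subalgebra_def)
        have "u 0 \<in> F 0 \<rightarrow>\<^sub>M L2_borel ?M (V0 L)" "\<theta> 0 \<in> F 0 \<rightarrow>\<^sub>M L2_borel ?M (H0 L)"
          using u0 \<theta>0 init measurable_cong[of "F 0" "u 0" u0] measurable_cong[of "F 0" "\<theta> 0" \<theta>0] sp by auto
        moreover have "u l \<in> F (real l * h) \<rightarrow>\<^sub>M L2_borel ?M (V0 L) \<and> \<theta> l \<in> F (real l * h) \<rightarrow>\<^sub>M L2_borel ?M (H0 L)"
          if "l \<in> {1..N}" using eul that unfolding euler_scheme_def Let_def h_def[symmetric] by blast
        ultimately show "u l \<in> F (real l * h) \<rightarrow>\<^sub>M L2_borel ?M (V0 L)" "\<theta> l \<in> F (real l * h) \<rightarrow>\<^sub>M L2_borel ?M (H0 L)"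
          using \<open>l \<le> N\<close> by (cases l; auto)+
      qed
      have uV: "u l w \<in> V0 L" and \<theta>H: "\<theta> l w \<in> H0 L" if "l \<le> N" "w \<in> space P" for l w
      proof -
        have sp: "space (F (real l * h)) = space P" using sub[of "real l * h"] h by (simp add: subalgebra_def)
        show "u l w \<in> V0 L" "\<theta> l w \<in> H0 L"
          using measurable_space[OF meas(1)[OF that(1)], of w] measurable_space[OF meas(2)[OF that(1)], of w] that sp
          by (simp_all add: space_L2_borel)
      qed
      have "\<forall>l<N. u l \<in> F (real l * (T / real N)) \<rightarrow>\<^sub>M L2_borel ?M (V0 L)"
        using meas(1) by (simp add: h_def)
      with R3 obtain R where R: "R \<in> borel_measurable P" "(\<integral>\<^sup>+w. R w \<partial>P) \<le> ennreal C3"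
        "AE w in P. \<forall>n\<le>N. ennreal (exp (B3 * (\<Sum>l=1..n. 2 * L2_inner ?M (dW l w) (u (l - 1) w)
         + (L2_norm ?M (dW l w))\<^sup>2 - r3 * h * (L2_norm ?M (u (l - 1) w))\<^sup>2))) \<le> R w"
        unfolding dW_def[abs_def] h_def by blast
      have "\<forall>l<N. \<theta> l \<in> F (real l * (T / real N)) \<rightarrow>\<^sub>M L2_borel ?M (H0 L)"
        using meas(2) by (simp add: h_def)
      with R4 obtain R' where R': "R' \<in> borel_measurable P" "(\<integral>\<^sup>+w. R' w \<partial>P) \<le> ennreal C4"
        "AE w in P. \<forall>n\<le>N. ennreal (exp (B4 * (\<Sum>l=1..n. 2 * L2_inner ?M (dWt l w) (\<theta> (l - 1) w)
         + (L2_norm ?M (dWt l w))\<^sup>2 - r4 * h * (L2_norm ?M (\<theta> (l - 1) w))\<^sup>2))) \<le> R' w"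
        unfolding dWt_def[abs_def] h_def by blast
      have steps: "AE w in P. \<forall>n\<in>{..<N}.
          velocity_step L h \<nu> (u n w) (\<theta> n w) (dW (Suc n) w) (u (Suc n) w) \<and>
          temperature_step L lamt \<zeta>t h \<kappa> (u n w) (\<theta> n w) (dWt (Suc n) w) (\<theta> (Suc n) w)"
      proof (rule AE_finite_allI)
        fix n assume "n \<in> {..<N}"
        then have "Suc n \<in> {1..N}" by auto
        with eul have "AE w in P.
             velocity_step L h \<nu> (u (Suc n - 1) w) (\<theta> (Suc n - 1) w)
               (\<lambda>x. W (real (Suc n) * h) w x - W (real (Suc n - 1) * h) w x) (u (Suc n) w) \<and>
             temperature_step L lamt \<zeta>t h \<kappa> (u (Suc n - 1) w) (\<theta> (Suc n - 1) w)
               (\<lambda>x. Wt (real (Suc n) * h) w x - Wt (real (Suc n - 1) * h) w x) (\<theta> (Suc n) w)"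
          unfolding euler_scheme_def Let_def h_def[symmetric] by blast
        then show "AE w in P. velocity_step L h \<nu> (u n w) (\<theta> n w) (dW (Suc n) w) (u (Suc n) w) \<and>
          temperature_step L lamt \<zeta>t h \<kappa> (u n w) (\<theta> n w) (dWt (Suc n) w) (\<theta> (Suc n) w)"
          unfolding dW_def[abs_def] dWt_def[abs_def] diff_Suc_1 .
      qed simp
      have noise: "AE w in P. \<forall>n\<in>{..<N}. dW (Suc n) w \<in> L2 ?M \<and> dWt (Suc n) w \<in> L2 ?M"
      proof (rule AE_finite_allI)
        fix n
        have t: "0 \<le> real (Suc n) * h" "0 \<le> real n * h" using h by auto
        have "AE w in P. W t w \<in> V0 L" "AE w in P. Wt t w \<in> H0 L" if "t \<ge> 0" for t
          using ns nst that by (auto simp: noise_series_def elim!: eventually_mono)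
        from this[OF t(1)] this[OF t(2)]
        show "AE w in P. dW (Suc n) w \<in> L2 ?M \<and> dWt (Suc n) w \<in> L2 ?M"
          by eventually_elim (use V0_L2 in \<open>auto simp: dW_def[abs_def] dWt_def[abs_def] intro!: L2_diff\<close>)
      qed simp
      \<comment> \<open>An integrable majorant that does not mention the steps at which the two
        maxima are attained.\<close>
      define bound where "bound w = ennreal w1 * ennreal (exp (\<gamma> * (L2_norm ?M (u0 w))\<^sup>2))
          + ennreal w2 * ennreal (exp (\<gamma>t * (L2_norm ?M (\<theta>0 w))\<^sup>2)) + ennreal w3 * R w + ennreal w4 * R' w" for w
      have AEb: "AE w in P. ennreal (exp (\<alpha> * max_energy L T \<nu> lam \<zeta> N u w)) \<le> bound w"
        using R(3) R'(3) steps noise AE_space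
      proof eventually_elim
        case (elim w)
        define U where "U n = (L2_norm ?M (u n w))\<^sup>2" for n
        define Th where "Th n = (L2_norm ?M (\<theta> n w))\<^sup>2" for n
        define Pn where "Pn n = (power_norm ?M lam \<zeta> (1/2) (u n w))\<^sup>2" for n
        define m3 where "m3 l = 2 * L2_inner ?M (dW l w) (u (l - 1) w) + (L2_norm ?M (dW l w))\<^sup>2" for l
        define m4 where "m4 l = 2 * L2_inner ?M (dWt l w) (\<theta> (l - 1) w) + (L2_norm ?M (dWt l w))\<^sup>2" for l
        have e3: "U (Suc n) + h * \<nu> * Pn (Suc n) + h * r3 * U (Suc n) \<le> U n + m3 (Suc n) + h * c * Th n" if "n < N" for n
          unfolding U_def Th_def Pn_def m3_def r3_def c_def diff_Suc_1
          by (rule velocity_step_energy[OF \<open>L > 0\<close> lam \<open>\<And>j. stokes L (\<zeta> j) (\<lambda>x. lam j *\<^sub>R \<zeta> j x)\<close> co less_imp_le[OF h(1)] \<open>\<nu> > 0\<close>])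
             (use elim that uV \<theta>H in auto)
        have e4: "Th (Suc n) + h * r4 * Th (Suc n) \<le> Th n + m4 (Suc n)" if "n < N" for n
          unfolding Th_def m4_def r4_def diff_Suc_1
          by (rule temperature_step_energy[OF \<open>L > 0\<close> lamt \<open>\<And>j. temp_op L (\<zeta>t j) (\<lambda>x. lamt j *\<^sub>R \<zeta>t j x)\<close> cot less_imp_le[OF h(1)] \<open>\<kappa> > 0\<close>])
             (use elim that uV \<theta>H in auto)
        \<comment> \<open>The maximizing step \<open>n\<close>, like the step \<open>m\<close> for
          the temperature, depends on the path; \<open>R\<close> and \<open>R'\<close> dominate the
          noise sums at all steps simultaneously, so they may be evaluated there.\<close>
        have "max_energy L T \<nu> lam \<zeta> N u w \<in> (\<lambda>n. U n + h * \<nu> * (\<Sum>l=1..n. Pn l)) ` {0..N}"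
          unfolding max_energy_def U_def Pn_def h_def by (rule Max_in) auto
        then obtain n where n: "n \<le> N" "max_energy L T \<nu> lam \<zeta> N u w = U n + h * \<nu> * (\<Sum>l=1..n. Pn l)" by auto
        obtain m where m: "m \<le> N" "U n + h * \<nu> * (\<Sum>l=1..n. Pn l)
            \<le> (1 + h * r3) * U 0 + (\<Sum>l=1..n. m3 l - r3 * h * U (l - 1))
              + c * T * ((1 + h * r4) * Th 0 + (\<Sum>l=1..m. m4 l - r4 * h * Th (l - 1)))"
          using discrete_energy_bound[of h U Th c r3 r4 N \<nu> Pn m3 m4 n] e3 e4 h c r n(1)
          by (auto simp: U_def Th_def)
        \<comment> \<open>Chosen so that the weighted sum of the four is \<open>\<alpha>\<close>
          times the right side of the energy bound. The factor \<open>S\<close> in the first two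
          brings the initial exponents below \<open>\<gamma>\<close> and
          \<open>\<gamma>t\<close>.\<close>
        define x1 where "x1 = \<gamma> * (S * (1 + h * r3) * U 0)"
        define x2 where "x2 = \<gamma>t * (S * (1 + h * r4) * Th 0)"
        define x3 where "x3 = B3 * (\<Sum>l=1..n. m3 l - r3 * h * U (l - 1))"
        define x4 where "x4 = B4 * (\<Sum>l=1..m. m4 l - r4 * h * Th (l - 1))"
        have wx: "w1 * \<gamma> * S = \<alpha>" "w2 * \<gamma>t * S = \<alpha> * c * T" "w3 * B3 = \<alpha>" "w4 * B4 = \<alpha> * c * T"
          using \<gamma> S0 w by (simp_all add: w1_def l1_def w2_def l2_def B3_def B4_def)
        have "w1 * x1 = (w1 * \<gamma> * S) * ((1 + h * r3) * U 0)" "w2 * x2 = (w2 * \<gamma>t * S) * ((1 + h * r4) * Th 0)"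
          "w3 * x3 = (w3 * B3) * (\<Sum>l=1..n. m3 l - r3 * h * U (l - 1))"
          "w4 * x4 = (w4 * B4) * (\<Sum>l=1..m. m4 l - r4 * h * Th (l - 1))"
          by (simp_all only: x1_def x2_def x3_def x4_def mult_ac)
        then have "w1 * x1 + w2 * x2 + w3 * x3 + w4 * x4 = \<alpha> * ((1 + h * r3) * U 0 + (\<Sum>l=1..n. m3 l - r3 * h * U (l - 1))
              + c * T * ((1 + h * r4) * Th 0 + (\<Sum>l=1..m. m4 l - r4 * h * Th (l - 1))))"
          unfolding wx by (simp only: distrib_left mult.assoc add_ac)
        then have "\<alpha> * max_energy L T \<nu> lam \<zeta> N u w \<le> w1 * x1 + w2 * x2 + w3 * x3 + w4 * x4"
          unfolding n(2) using m(2) \<alpha>(1) by (simp only: mult_left_mono less_imp_le)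
        then have "exp (\<alpha> * max_energy L T \<nu> lam \<zeta> N u w) \<le> exp (w1 * x1 + w2 * x2 + w3 * x3 + w4 * x4)" by simp
        also have "\<dots> \<le> w1 * exp x1 + w2 * exp x2 + w3 * exp x3 + w4 * exp x4"
          by (rule exp_convex_combination4) (use w wsum in auto)
        finally have "ennreal (exp (\<alpha> * max_energy L T \<nu> lam \<zeta> N u w)) \<le>
            ennreal w1 * ennreal (exp x1) + ennreal w2 * ennreal (exp x2) + ennreal w3 * ennreal (exp x3) + ennreal w4 * ennreal (exp x4)"
          using w by (simp add: ennreal_mult[symmetric] ennreal_plus[symmetric] ennreal_leI less_imp_le del: ennreal_plus)
        also have "\<dots> \<le> bound w"
          unfolding bound_def
        proof (intro add_mono mult_left_mono)
          have "S * (1 + h * r3) * U 0 \<le> 1 * U 0" using s3 by (intro mult_right_mono) (auto simp: h_def U_def)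
          then show "ennreal (exp x1) \<le> ennreal (exp (\<gamma> * (L2_norm ?M (u0 w))\<^sup>2))"
            using \<gamma> init(1)[OF elim(5)] by (intro ennreal_leI) (simp add: x1_def U_def)
          have "S * (1 + h * r4) * Th 0 \<le> 1 * Th 0" using s4 by (intro mult_right_mono) (auto simp: h_def Th_def)
          then show "ennreal (exp x2) \<le> ennreal (exp (\<gamma>t * (L2_norm ?M (\<theta>0 w))\<^sup>2))"
            using \<gamma> init(2)[OF elim(5)] by (intro ennreal_leI) (simp add: x2_def Th_def)
          show "ennreal (exp x3) \<le> R w" using elim(1) n(1) by (simp add: x3_def m3_def U_def)
          show "ennreal (exp x4) \<le> R' w" using elim(2) m(1) by (simp add: x4_def m4_def Th_def)
        qed auto
        finally show ?case .
      qed
      have uP: "u l \<in> P \<rightarrow>\<^sub>M L2_borel ?M (V0 L)" if "l \<le> N" for l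
        using measurable_from_subalg[OF sub meas(1)[OF that]] h by simp
      have maxm: "(\<lambda>w. max_energy L T \<nu> lam \<zeta> N u w) \<in> borel_measurable P"
        unfolding max_energy_def
      proof (rule borel_measurable_Max)
        fix n assume "n \<in> {0..N}"
        then have n: "n \<le> N" by simp
        have "(\<lambda>w. L2_norm ?M (u l w)) \<in> borel_measurable P" if "l \<le> N" for l
          by (rule measurable_compose[OF uP[OF that] L2_borel_measurable_norm[OF V0_L2]])
        moreover have "(\<lambda>w. power_norm ?M lam \<zeta> (1/2) (u l w)) \<in> borel_measurable P" if "l \<le> N" for l
        proof -
          have "\<zeta> j \<in> L2 ?M" for j using co V0_L2 by (auto simp: complete_orthonormal_def)
          then have [measurable]: "(\<lambda>w. L2_inner ?M (u l w) (\<zeta> j)) \<in> borel_measurable P" for j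
            by (intro measurable_compose[OF uP[OF that] L2_borel_measurable_inner[OF V0_L2]])
          show ?thesis unfolding power_norm_def by measurable
        qed
        ultimately show "(\<lambda>w. (L2_norm ?M (u n w))\<^sup>2 + T / real N * \<nu> *
            (\<Sum>l=1..n. (power_norm ?M lam \<zeta> (1/2) (u l w))\<^sup>2)) \<in> borel_measurable P"
          using n by (intro borel_measurable_add borel_measurable_power borel_measurable_times borel_measurable_sum
              borel_measurable_const) auto
      qed simp
      have expm [measurable]: "(\<lambda>w. exp (\<alpha> * max_energy L T \<nu> lam \<zeta> N u w)) \<in> borel_measurable P"
        using maxm by measurable
      note [measurable] = R(1) R'(1) borel_measurable_integrable[OF int(1)] borel_measurable_integrable[OF int(2)]
      have "(\<integral>\<^sup>+w. ennreal (exp (\<alpha> * max_energy L T \<nu> lam \<zeta> N u w)) \<partial>P) \<le> (\<integral>\<^sup>+w. bound w \<partial>P)"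
        by (rule nn_integral_mono_AE[OF AEb])
      also have "\<dots> = ennreal w1 * ennreal C1 + ennreal w2 * ennreal C2 + ennreal w3 * (\<integral>\<^sup>+w. R w \<partial>P) + ennreal w4 * (\<integral>\<^sup>+w. R' w \<partial>P)"
        unfolding bound_def C1_def C2_def
        by (simp add: nn_integral_add nn_integral_cmult nn_integral_eq_integral[OF int(1)] nn_integral_eq_integral[OF int(2)])
      also have "\<dots> \<le> ennreal w1 * ennreal C1 + ennreal w2 * ennreal C2 + ennreal w3 * ennreal C3 + ennreal w4 * ennreal C4"
        by (intro add_mono mult_left_mono R(2) R'(2) order_refl) auto
      also have "\<dots> = ennreal C"
        unfolding C_def using w C12 C3 C4
        by (simp add: ennreal_mult[symmetric] ennreal_plus[symmetric] less_imp_le del: ennreal_plus)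
      finally have fin: "(\<integral>\<^sup>+w. ennreal (exp (\<alpha> * max_energy L T \<nu> lam \<zeta> N u w)) \<partial>P) \<le> ennreal C" .
      have integ: "integrable P (\<lambda>w. exp (\<alpha> * max_energy L T \<nu> lam \<zeta> N u w))"
        using fin by (intro integrableI_bounded expm) (simp add: le_less_trans[OF fin])
      moreover have "expectation (\<lambda>w. exp (\<alpha> * max_energy L T \<nu> lam \<zeta> N u w)) \<le> C"
      proof -
        have "C \<ge> 0" unfolding C_def using w C12 C3 C4 by (intro add_nonneg_nonneg mult_nonneg_nonneg) auto
        then show ?thesis using fin unfolding nn_integral_eq_integral[OF integ AE_I2[OF exp_ge_zero]] by simp
      qed
      ultimately show "integrable P (\<lambda>w. exp (\<alpha> * max_energy L T \<nu> lam \<zeta> N u w)) \<and>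
            expectation (\<lambda>w. exp (\<alpha> * max_energy L T \<nu> lam \<zeta> N u w)) \<le> C" ..
    qed
    then show ?thesis by blast
  qed
  \<comment> \<open>Constants have exponential moments of every order, so both exponents of the
    initial data are at disposal; one common large value is used.\<close>
  have deterministic: "\<exists>C. \<forall>\<^sub>F N in sequentially. \<forall>u \<theta>.
            euler_scheme L T \<nu> \<kappa> lamt \<zeta>t P F W Wt (\<lambda>_. u0) (\<lambda>_. \<theta>0) N u \<theta> \<longrightarrow>
            integrable P (\<lambda>w. exp (\<alpha> * max_energy L T \<nu> lam \<zeta> N u w)) \<and>
            expectation (\<lambda>w. exp (\<alpha> * max_energy L T \<nu> lam \<zeta> N u w)) \<le> C"
    if u0: "u0 \<in> V0 L" and \<theta>0: "\<theta>0 \<in> H0 L"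
      and \<alpha>: "0 < \<alpha>" "\<alpha> < \<nu> * \<kappa> * lam 0 * lamt 0 / (4 * (2 * T * TrQt + \<kappa> * lamt 0 * TrQ))"
    for u0 \<theta>0 \<alpha>
  proof -
    define num where "num = \<nu> * \<kappa> * lam 0 * lamt 0"
    define den where "den = 4 * (2 * T * TrQt + \<kappa> * lamt 0 * TrQ)"
    define d where "d = num / \<alpha> - den"
    define k where "k = 2 * \<kappa> * lamt 0 * T + num"
    \<comment> \<open>\<open>d\<close> is the room that \<open>\<alpha>\<close> leaves in the
      denominator. With this \<open>\<gamma>\<close> the two extra terms sum to
      \<open>k / \<gamma> = d / 2\<close>, half of that room, and the strict inequality
      survives.\<close>
    define \<gamma> where "\<gamma> = 2 * k / d"
    have num: "num > 0" using pos by (simp add: num_def)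
    have den: "den > 0" unfolding den_def using pos Q Qt by (intro mult_pos_pos add_pos_pos) auto
    have d: "d > 0" using \<alpha> num den unfolding d_def num_def[symmetric] den_def[symmetric]
      by (simp add: less_divide_eq mult.commute)
    have k: "k > 0" unfolding k_def using pos num by (intro add_pos_pos mult_pos_pos) auto
    have \<gamma>: "\<gamma> > 0" using k d by (simp add: \<gamma>_def)
    have lt: "\<alpha> < num / (den + 2 * \<kappa> * lamt 0 * T / \<gamma> + num / \<gamma>)"
    proof -
      have e: "den + 2 * \<kappa> * lamt 0 * T / \<gamma> + num / \<gamma> = den + d / 2"
        unfolding add.assoc add_divide_distrib[symmetric] k_def[symmetric] using k d by (simp add: \<gamma>_def)
      have "\<alpha> * (den + d / 2) < \<alpha> * (den + d)" using \<alpha>(1) d by simp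
      also have "\<dots> = num" using \<alpha>(1) by (simp add: d_def)
      finally show ?thesis unfolding e using den d by (simp add: less_divide_eq)
    qed
    show ?thesis
      by (rule random[OF _ _ \<gamma> \<gamma> _ _ \<alpha>(1) lt[unfolded num_def den_def]])
         (use u0 \<theta>0 in \<open>auto simp: space_L2_borel intro!: measurable_const\<close>)
  qed
  show ?thesis using random deterministic by blast
qed

end
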